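(* Let $K$ and $K'$ be long virtual knots. For any $a,b\in\{0,1\}$, we have (i) $F_{ab}(K\circ K';t)=F_{ab}(K;t)+F_{ab}(K';t)$; (ii) $G_{ab}(K\circ K';t)=G_{ab}(K;t)+G_{ab}(K';t)$; (iii) $H_{ab}(K\circ K';t)=H_{ab}(K;t)+H_{ab}(K';t)+W_a(K;t^{-1})W_b(K';t)+W_a(K';t^{-1})W_b(K;t)$.
   Context: A long virtual knot diagram is an immersed line in $\mathbb{R}^2$ that agrees with the $x$-axis outside some $2$-disk and has finitely many transversal double points, each being either a real crossing (with over/under information) or a virtual crossing (without it); it is oriented from $-\infty$ to $\infty$. A long virtual knot is an equivalence class of such diagrams under generalized Reidemeister moves (the classical moves I, II, III on real crossings, the three analogous moves on virtual crossings, and the mixed move passing a strand having only virtual crossings across a real crossing). Let $D$ be a diagram of a long virtual knot $K$ with real crossings $c_1,\dots,c_n$, and let $\varepsilon_i\in\{1,-1\}$ be the sign of $c_i$. The crossing $c_i$ is of type $0$ if, travelling along $D$ from $-\infty$ to $\infty$, one passes $c_i$ first over and then under; otherwise it is of type $1$. For $a\in\{0,1\}$ put $I_a=\{i\mid c_i\text{ is of type }a\}$ and $\omega_a=\sum_{i\in I_a}\varepsilon_i$. A surface realization of $D$ is a closed, connected, oriented surface $\Sigma_g$ together with an oriented knot diagram on $\Sigma_g$ with a basepoint and with no virtual crossings, whose real crossings coincide with those of $D$ (same order of passage, over/under information and signs), and whose basepoint corresponds to $\pm\infty$ of $D$. Smoothing this diagram at $c_i$ (respecting orientation) gives two oriented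 loops on $\Sigma_g$: $\alpha_i$ is the one not containing the basepoint and $\beta_i$ is the one containing it; they are regarded as homology cycles on $\Sigma_g$. The intersection numbers $\gamma\cdot\gamma'\in\mathbb{Z}$ of such cycles are independent of the choice of surface realization. Put $W_a(K;t)=\sum_{i\in I_a}\varepsilon_i(t^{\alpha_i\cdot\beta_i}-1)$ and \[F_{ab}(K;t)=\sum_{i\in I_a,\,j\in I_b}\varepsilon_i\varepsilon_j(t^{\alpha_i\cdot\alpha_j}-1),\] \[G_{ab}(K;t)=\sum_{i\in I_a,\,j\in I_b}\varepsilon_i\varepsilon_j(t^{\alpha_i\cdot\beta_j}-1)-\omega_bW_a(K;t),\] \[H_{ab}(K;t)=\sum_{i\in I_a,\,j\in I_b}\varepsilon_i\varepsilon_j(t^{\beta_i\cdot\beta_j}-1)-\omega_aW_b(K;t)-\omega_bW_a(K;t^{-1}).\] These Laurent polynomials in $\mathbb{Z}[t,t^{-1}]$ depend only on $K$, not on $D$. For diagrams $D$ of $K$ and $D'$ of $K'$, the product $K\circ K'$ is the long virtual knot presented by the diagram $D\circ D'$ obtained by concatenating $D'$ after $D$; it does not depend on the choice of $D$ and $D'$. *)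

theory Defs
  imports "HOL-Analysis.Analysis" "HOL-Library.Poly_Mapping"
begin

section \<open>Long virtual knot diagrams\<close>

text \<open>
  The plane is the type of complex numbers. A diagram is a parametrized immersed line together
  with its real crossings. A real crossing is the pair \<open>(s, u)\<close> of the parameters at which the line
  passes it over and under, respectively; every double point that does not occur
  in \<open>crossings\<close> (in either order) is a virtual crossing.
\<close>

record lv_diagram =
  curve :: "real \<Rightarrow> complex"
  crossings :: "(real \<times> real) set"

definition velocity :: "lv_diagram \<Rightarrow> real \<Rightarrow> complex" where
  "velocity D t = vector_derivative (curve D) (at t)"

text \<open>The determinant of two plane vectors: positive iff they form a positively oriented basis.\<close>

definition cross :: "complex \<Rightarrow> complex \<Rightarrow> real" where
  "cross z w = Re z * Im w - Im z * Re w"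

text \<open>
  Since the arc between the two straight ends is compact, agreeing with the \<open>x\<close>-axis for large
  \<open>\<bar>t\<bar>\<close> is the same as agreeing with the \<open>x\<close>-axis outside a sufficiently large disk.
\<close>

definition long_virtual_knot_diagram :: "lv_diagram \<Rightarrow> bool" where
  "long_virtual_knot_diagram D \<longleftrightarrow>
     curve D C1_differentiable_on UNIV \<and>
     (\<forall>t. velocity D t \<noteq> 0) \<and>
     (\<exists>R. \<forall>t. R \<le> \<bar>t\<bar> \<longrightarrow> curve D t = of_real t) \<and>
     finite {(s, t). s < t \<and> curve D s = curve D t} \<and>
     (\<forall>r s t. r < s \<and> s < t \<longrightarrow> \<not> (curve D r = curve D s \<and> curve D s = curve D t)) \<and>
     (\<forall>s t. s < t \<and> curve D s = curve D t \<longrightarrow> cross (velocity D s) (velocity D t) \<noteq> 0) \<and>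
     (\<forall>(s, u) \<in> crossings D. s \<noteq> u \<and> curve D s = curve D u \<and> (u, s) \<notin> crossings D)"

definition crossing_sign :: "lv_diagram \<Rightarrow> real \<times> real \<Rightarrow> int" where
  "crossing_sign D c = (if 0 < cross (velocity D (fst c)) (velocity D (snd c)) then 1 else - 1)"

definition crossing_type :: "real \<times> real \<Rightarrow> nat" where
  "crossing_type c = (if fst c < snd c then 0 else 1)"

definition crossings_of_type :: "nat \<Rightarrow> lv_diagram \<Rightarrow> (real \<times> real) set" where
  "crossings_of_type a D = {c \<in> crossings D. crossing_type c = a}"

definition writhe :: "nat \<Rightarrow> lv_diagram \<Rightarrow> int" where
  "writhe a D = (\<Sum>c \<in> crossings_of_type a D. crossing_sign D c)"


section \<open>Generalized Reidemeister moves and long virtual knots\<close>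

text \<open>
  Planar isotopy and change of parametrization. Planar isotopy is expressed by a single orientation
  preserving diffeomorphism of the plane; every such map is isotopic to the identity.
\<close>

definition orientation_preserving_diffeo :: "(complex \<Rightarrow> complex) \<Rightarrow> bool" where
  "orientation_preserving_diffeo \<Phi> \<longleftrightarrow> bij \<Phi> \<and>
     (\<exists>A. (\<forall>z. (\<Phi> has_derivative A z) (at z)) \<and>
          (\<forall>w. continuous_on UNIV (\<lambda>z. A z w)) \<and>
          (\<forall>z. 0 < cross (A z 1) (A z \<i>)))"

definition isotopic :: "lv_diagram \<Rightarrow> lv_diagram \<Rightarrow> bool" where
  "isotopic D E \<longleftrightarrow> (\<exists>\<Phi> \<rho> \<rho>'. orientation_preserving_diffeo \<Phi> \<and>
     bij \<rho> \<and> continuous_on UNIV \<rho>' \<and>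
     (\<forall>t. (\<rho> has_real_derivative \<rho>' t) (at t) \<and> 0 < \<rho>' t) \<and>
     (\<forall>t. curve E (\<rho> t) = \<Phi> (curve D t)) \<and>
     crossings E = map_prod \<rho> \<rho> ` crossings D)"

text \<open>
  The other moves are performed in the square \<open>[-1,1] \<times> [-1,1]\<close>, which the diagrams meet in \<open>k\<close>
  arcs with prescribed shape; up to planar isotopy this is no restriction. In the square
  the arcs \<open>P i\<close> of \<open>D\<close> are replaced by the arcs \<open>Q i\<close> of \<open>E\<close>. The \<open>i\<close>-th arc is run through in the
  parameter interval with centre \<open>m i\<close> and radius \<open>1\<close>, and \<open>\<sigma> i\<close> tells in which direction.
\<close>

definition move_square :: "complex set" where
  "move_square = {z. \<bar>Re z\<bar> \<le> 1 \<and> \<bar>Im z\<bar> \<le> 1}"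

definition replace_arcs ::
  "nat \<Rightarrow> (nat \<Rightarrow> real \<Rightarrow> complex) \<Rightarrow> (nat \<Rightarrow> real \<Rightarrow> complex) \<Rightarrow>
    (nat \<Rightarrow> real) \<Rightarrow> (nat \<Rightarrow> real) \<Rightarrow> lv_diagram \<Rightarrow> lv_diagram \<Rightarrow> bool" where
  "replace_arcs k P Q m \<sigma> D E \<longleftrightarrow>
     (\<forall>i<k. \<sigma> i \<in> {1, -1}) \<and>
     (\<forall>i<k. \<forall>j<k. i \<noteq> j \<longrightarrow> 2 < \<bar>m i - m j\<bar>) \<and>
     (\<forall>i<k. \<forall>x\<in>{-1..1}. curve D (m i + \<sigma> i * x) = P i x \<and> curve E (m i + \<sigma> i * x) = Q i x) \<and>
     (\<forall>t. (\<forall>i<k. 1 < \<bar>t - m i\<bar>) \<longrightarrow> curve D t = curve E t \<and> curve D t \<notin> move_square) \<and>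
     (\<forall>s u. curve D s \<notin> move_square \<longrightarrow> ((s, u) \<in> crossings D \<longleftrightarrow> (s, u) \<in> crossings E))"

text \<open>
  The crossings between different arcs \<open>i\<close> and \<open>j\<close> inside the square are real with \<open>i\<close> over \<open>j\<close> iff
  \<open>(i, j) \<in> ov\<close>; they are virtual if neither \<open>(i, j)\<close> nor \<open>(j, i)\<close> belongs to \<open>ov\<close>.
\<close>

definition over_under ::
  "(nat \<times> nat) set \<Rightarrow> nat \<Rightarrow> (nat \<Rightarrow> real \<Rightarrow> complex) \<Rightarrow> (nat \<Rightarrow> real) \<Rightarrow> (nat \<Rightarrow> real) \<Rightarrow>
    lv_diagram \<Rightarrow> bool" where
  "over_under ov k P m \<sigma> D \<longleftrightarrow>
     (\<forall>i<k. \<forall>j<k. \<forall>x\<in>{-1..1}. \<forall>y\<in>{-1..1}. i \<noteq> j \<and> P i x = P j y \<longrightarrow>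
        ((m i + \<sigma> i * x, m j + \<sigma> j * y) \<in> crossings D \<longleftrightarrow> (i, j) \<in> ov))"

definition bump :: "real \<Rightarrow> real" where
  "bump x = (1 - x\<^sup>2)\<^sup>2"

text \<open>
  Move I, real or virtual: an arc with a single kink is replaced by a straight arc. All
  possibilities for the crossing of the kink (virtual, real with either arc over) are allowed.
\<close>

definition move_I :: "lv_diagram \<Rightarrow> lv_diagram \<Rightarrow> bool" where
  "move_I D E \<longleftrightarrow> (\<exists>m \<sigma>. replace_arcs 1
     (\<lambda>_ x. Complex (x - 2 * x * bump x) (bump x / 2)) (\<lambda>_ x. Complex x 0) m \<sigma> D E)"

text \<open>
  Move II: two arcs which cross twice are replaced by disjoint arcs. Either one arc lies
  over the other at both crossings, or both crossings are virtual.
\<close>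

definition arcs_II :: "nat \<Rightarrow> real \<Rightarrow> complex" where
  "arcs_II i x = (if i = 0 then Complex x 0 else Complex x (1 / 2 - bump x))"

definition arcs_II' :: "nat \<Rightarrow> real \<Rightarrow> complex" where
  "arcs_II' i x = (if i = 0 then Complex x 0 else Complex x (1 / 2))"

definition move_II :: "lv_diagram \<Rightarrow> lv_diagram \<Rightarrow> bool" where
  "move_II D E \<longleftrightarrow> (\<exists>m \<sigma>. \<exists>ov \<in> {{}, {(0, 1)}, {(1, 0)}}.
     replace_arcs 2 arcs_II arcs_II' m \<sigma> D E \<and> over_under ov 2 arcs_II m \<sigma> D)"

text \<open>
  Move III: the arc \<open>0\<close> is passed across the crossing of the arcs \<open>1\<close> and \<open>2\<close>, from above (\<open>c = 1\<close>)
  to below (\<open>c = -1\<close>). The three choices of \<open>ov\<close> are the virtual move (no real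
  crossing), the mixed move (exactly one real crossing, so that the third arc has only virtual
  crossings) and the classical move (the arcs lie at three different heights).
\<close>

definition arcs_III :: "real \<Rightarrow> nat \<Rightarrow> real \<Rightarrow> complex" where
  "arcs_III c i x =
     (if i = 0 then Complex x (c * bump x / 2)
      else if i = 1 then Complex x x else Complex x (- x))"

definition layering_III :: "(nat \<times> nat) set \<Rightarrow> bool" where
  "layering_III ov \<longleftrightarrow> ov = {} \<or>
     (\<exists>i<3. \<exists>j<3. i \<noteq> j \<and> ov = {(i, j)}) \<or>
     (\<exists>h :: nat \<Rightarrow> nat. inj_on h {..<3} \<and> ov = {(i, j). i < 3 \<and> j < 3 \<and> h j < h i})"

definition move_III :: "lv_diagram \<Rightarrow> lv_diagram \<Rightarrow> bool" where
  "move_III D E \<longleftrightarrow> (\<exists>m \<sigma> ov. layering_III ov \<and>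
     replace_arcs 3 (arcs_III 1) (arcs_III (- 1)) m \<sigma> D E \<and>
     over_under ov 3 (arcs_III 1) m \<sigma> D \<and> over_under ov 3 (arcs_III (- 1)) m \<sigma> E)"

definition reidemeister_step :: "lv_diagram \<Rightarrow> lv_diagram \<Rightarrow> bool" where
  "reidemeister_step D E \<longleftrightarrow> long_virtual_knot_diagram D \<and> long_virtual_knot_diagram E \<and>
     (isotopic D E \<or> move_I D E \<or> move_II D E \<or> move_III D E)"

definition diagram_equiv :: "(lv_diagram \<times> lv_diagram) set" where
  "diagram_equiv = {(D, E). long_virtual_knot_diagram D \<and> long_virtual_knot_diagram E \<and>
     equivclp reidemeister_step D E}"

definition long_virtual_knots :: "lv_diagram set set" where
  "long_virtual_knots = {D. long_virtual_knot_diagram D} // diagram_equiv"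


section \<open>Products\<close>

text \<open>\<open>D\<close> agrees with the \<open>x\<close>-axis outside the disk of radius \<open>R\<close> around the origin.\<close>

definition standard_outside :: "real \<Rightarrow> lv_diagram \<Rightarrow> bool" where
  "standard_outside R D \<longleftrightarrow> 0 < R \<and>
     (\<forall>t. R \<le> \<bar>t\<bar> \<longrightarrow> curve D t = of_real t) \<and> (\<forall>t. \<bar>t\<bar> < R \<longrightarrow> cmod (curve D t) < R)"

text \<open>
  \<open>D\<close> and \<open>D'\<close> are shifted so that their nontrivial parts lie in the two disks of radius \<open>R\<close> and \<open>R'\<close>
  which touch each other in the origin.
\<close>

definition concat_diagrams :: "real \<Rightarrow> real \<Rightarrow> lv_diagram \<Rightarrow> lv_diagram \<Rightarrow> lv_diagram" where
  "concat_diagrams R R' D D' =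
     \<lparr>curve = (\<lambda>t. if t \<le> 0 then curve D (t + R) - of_real R else curve D' (t - R') + of_real R'),
      crossings = (\<lambda>(s, u). (s - R, u - R)) ` crossings D \<union>
                  (\<lambda>(s, u). (s + R', u + R')) ` crossings D'\<rparr>"

definition knot_product :: "lv_diagram set \<Rightarrow> lv_diagram set \<Rightarrow> lv_diagram set" (infixl "\<circ>\<^sub>K" 70)
  where
  "K \<circ>\<^sub>K K' = {E. \<exists>D \<in> K. \<exists>D' \<in> K'. \<exists>R R'. standard_outside R D \<and> standard_outside R' D' \<and>
     (concat_diagrams R R' D D', E) \<in> diagram_equiv}"


section \<open>Closed oriented surfaces and intersection numbers\<close>

text \<open>
  A closed connected oriented surface is given by a cell decomposition, encoded as a combinatorial
  map. The darts are the oriented edges, thought of as half-edges issuing from their initial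
  vertices: \<open>opp d\<close> is the same edge with the opposite orientation, and \<open>rot d\<close> is
  the next dart counterclockwise around the initial vertex of \<open>d\<close>. Vertices are the orbits of \<open>rot\<close>,
  and one open disk is glued in along each boundary cycle of the resulting ribbon graph. Every
  closed connected oriented surface with a diagram on it arises in this way, the diagram being part
  of the 1-skeleton of a suitable cell decomposition.
\<close>

record cell_surface =
  darts :: "nat set"
  rot :: "nat \<Rightarrow> nat"
  opp :: "nat \<Rightarrow> nat"

definition closed_surface :: "cell_surface \<Rightarrow> bool" where
  "closed_surface M \<longleftrightarrow> finite (darts M) \<and> darts M \<noteq> {} \<and>
     bij_betw (rot M) (darts M) (darts M) \<and>
     (\<forall>d \<in> darts M. opp M d \<in> darts M \<and> opp M d \<noteq> d \<and> opp M (opp M d) = d) \<and>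
     (\<forall>d \<in> darts M. \<forall>e \<in> darts M.
        (d, e) \<in> {(x, y). x \<in> darts M \<and> (y = rot M x \<or> y = opp M x)}\<^sup>*)"

definition same_vertex :: "cell_surface \<Rightarrow> nat \<Rightarrow> nat \<Rightarrow> bool" where
  "same_vertex M d e \<longleftrightarrow> (\<exists>n. (rot M ^^ n) d = e)"

text \<open>The darts met strictly after \<open>d\<close> and strictly before \<open>e\<close>, counterclockwise from \<open>d\<close> to \<open>e\<close>.\<close>

definition sector :: "cell_surface \<Rightarrow> nat \<Rightarrow> nat \<Rightarrow> nat set" where
  "sector M d e = {x. \<exists>i>0. x = (rot M ^^ i) d \<and> (\<forall>j. 0 < j \<and> j \<le> i \<longrightarrow> (rot M ^^ j) d \<noteq> e)}"

text \<open>
  Closed paths in the 1-skeleton are cyclic lists of oriented edges. Its \<open>p\<close>-th passage through a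
  vertex leaves the vertex along \<open>w ! p\<close> and arrives there along the preceding edge.
\<close>

definition out_dart :: "nat list \<Rightarrow> nat \<Rightarrow> nat" where
  "out_dart w p = w ! p"

definition in_dart :: "cell_surface \<Rightarrow> nat list \<Rightarrow> nat \<Rightarrow> nat" where
  "in_dart M w p = opp M (w ! ((p + length w - 1) mod length w))"

definition closed_path :: "cell_surface \<Rightarrow> nat list \<Rightarrow> bool" where
  "closed_path M w \<longleftrightarrow> w \<noteq> [] \<and> set w \<subseteq> darts M \<and>
     (\<forall>p < length w. same_vertex M (in_dart M w p) (out_dart w p))"

definition left_side :: "cell_surface \<Rightarrow> nat list \<Rightarrow> nat \<Rightarrow> nat set" where
  "left_side M w p = sector M (out_dart w p) (in_dart M w p)"

text \<open>
  The intersection number \<open>v \<cdot> w\<close> of closed paths, as cycles on the surface. Push \<open>w\<close> slightly off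
  itself to its left. The resulting loop is homologous to \<open>w\<close>, meets no vertex, and crosses
  an edge transversally exactly where, near a passage of \<open>w\<close> through a vertex, it crosses the darts at
  the left side of \<open>w\<close>. A point where \<open>v\<close> crosses \<open>w\<close> counts \<open>1\<close> if the tangent vectors of \<open>v\<close> and
  \<open>w\<close>, in this order, form a positive basis, i.e. if \<open>v\<close> runs towards the vertex on the left of \<open>w\<close>,
  and it counts \<open>-1\<close> if \<open>v\<close> runs away from it.
\<close>

definition intersection_number :: "cell_surface \<Rightarrow> nat list \<Rightarrow> nat list \<Rightarrow> int" where
  "intersection_number M v w =
     (\<Sum>p < length w. \<Sum>d \<in> left_side M w p. int (count_list v (opp M d)) - int (count_list v d))"


section \<open>Surface realizations\<close>

text \<open>
  A knot diagram on a closed surface, as a closed path \<open>w\<close> that starts at the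
  basepoint: it runs at most once through every edge and at most twice through every vertex; vertices
  with two passages are the crossings, where the two branches are transversal. \<open>Y\<close>
  consists of the pairs (over passage, under passage). All crossings are real.
\<close>

definition meetings :: "cell_surface \<Rightarrow> nat list \<Rightarrow> (nat \<times> nat) set" where
  "meetings M w = {(p, q). p < length w \<and> q < length w \<and> p \<noteq> q \<and>
     same_vertex M (out_dart w p) (out_dart w q)}"

definition surface_knot_diagram :: "cell_surface \<Rightarrow> nat list \<Rightarrow> (nat \<times> nat) set \<Rightarrow> bool" where
  "surface_knot_diagram M w Y \<longleftrightarrow> closed_surface M \<and> closed_path M w \<and>
     distinct w \<and> (\<forall>d \<in> set w. opp M d \<notin> set w) \<and>
     (\<forall>p q r. (p, q) \<in> meetings M w \<and> (p, r) \<in> meetings M w \<longrightarrow> q = r) \<and>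
     (\<forall>(p, q) \<in> meetings M w.
        (out_dart w q \<in> left_side M w p) \<noteq> (in_dart M w q \<in> left_side M w p)) \<and>
     (\<forall>q. (0, q) \<notin> meetings M w) \<and>
     Y \<subseteq> meetings M w \<and> (\<forall>(p, q) \<in> meetings M w. ((p, q) \<in> Y) \<noteq> ((q, p) \<in> Y))"

definition surface_crossing_sign :: "cell_surface \<Rightarrow> nat list \<Rightarrow> nat \<times> nat \<Rightarrow> int" where
  "surface_crossing_sign M w c =
     (if out_dart w (snd c) \<in> left_side M w (fst c) then 1 else - 1)"

text \<open>
  The real crossings of \<open>D\<close> coincide with the crossings on the surface by means of \<open>f\<close>, which sends
  the parameters at which \<open>D\<close> passes a real crossing to passages of \<open>w\<close>.
\<close>

definition surface_realization ::
  "lv_diagram \<Rightarrow> cell_surface \<times> nat list \<times> (real \<Rightarrow> nat) \<Rightarrow> bool" where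
  "surface_realization D = (\<lambda>(M, w, f).
     strict_mono_on (fst ` crossings D \<union> snd ` crossings D) f \<and>
     surface_knot_diagram M w (map_prod f f ` crossings D) \<and>
     (\<forall>c \<in> crossings D. surface_crossing_sign M w (map_prod f f c) = crossing_sign D c))"

text \<open>
  Smoothing the crossing with passages \<open>p < q\<close> gives the loop between the two passages, and
  the remaining loop through the basepoint, which is passage \<open>0\<close>.
\<close>

definition alpha_path :: "nat list \<Rightarrow> (real \<Rightarrow> nat) \<Rightarrow> real \<times> real \<Rightarrow> nat list" where
  "alpha_path w f c =
     (let p = min (f (fst c)) (f (snd c)); q = max (f (fst c)) (f (snd c))
      in take (q - p) (drop p w))"

definition beta_path :: "nat list \<Rightarrow> (real \<Rightarrow> nat) \<Rightarrow> real \<times> real \<Rightarrow> nat list" where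
  "beta_path w f c =
     (let p = min (f (fst c)) (f (snd c)); q = max (f (fst c)) (f (snd c))
      in take p w @ drop q w)"

text \<open>Intersection numbers do not depend on the surface realization, so we may choose one.\<close>

definition realization :: "lv_diagram \<Rightarrow> cell_surface \<times> nat list \<times> (real \<Rightarrow> nat)" where
  "realization D = (SOME S. surface_realization D S)"

definition alpha_alpha :: "lv_diagram \<Rightarrow> real \<times> real \<Rightarrow> real \<times> real \<Rightarrow> int" where
  "alpha_alpha D c c' = (case realization D of (M, w, f) \<Rightarrow>
     intersection_number M (alpha_path w f c) (alpha_path w f c'))"

definition alpha_beta :: "lv_diagram \<Rightarrow> real \<times> real \<Rightarrow> real \<times> real \<Rightarrow> int" where
  "alpha_beta D c c' = (case realization D of (M, w, f) \<Rightarrow>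
     intersection_number M (alpha_path w f c) (beta_path w f c'))"

definition beta_beta :: "lv_diagram \<Rightarrow> real \<times> real \<Rightarrow> real \<times> real \<Rightarrow> int" where
  "beta_beta D c c' = (case realization D of (M, w, f) \<Rightarrow>
     intersection_number M (beta_path w f c) (beta_path w f c'))"


section \<open>The intersection polynomials\<close>

text \<open>
  The ring of integral Laurent polynomials is the group ring of the additive group of integers.
\<close>

type_synonym laurent_poly = "int \<Rightarrow>\<^sub>0 int"

definition tpow :: "int \<Rightarrow> laurent_poly" where
  "tpow n = Poly_Mapping.single n 1"

text \<open>The substitution of the inverse of \<open>t\<close> for \<open>t\<close>.\<close>

definition invert_t :: "laurent_poly \<Rightarrow> laurent_poly" where
  "invert_t p = Poly_Mapping.map_key uminus p"

definition W_diagram :: "nat \<Rightarrow> lv_diagram \<Rightarrow> laurent_poly" where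
  "W_diagram a D =
     (\<Sum>i \<in> crossings_of_type a D. of_int (crossing_sign D i) * (tpow (alpha_beta D i i) - 1))"

definition F_diagram :: "nat \<Rightarrow> nat \<Rightarrow> lv_diagram \<Rightarrow> laurent_poly" where
  "F_diagram a b D =
     (\<Sum>i \<in> crossings_of_type a D. \<Sum>j \<in> crossings_of_type b D.
        of_int (crossing_sign D i * crossing_sign D j) * (tpow (alpha_alpha D i j) - 1))"

definition G_diagram :: "nat \<Rightarrow> nat \<Rightarrow> lv_diagram \<Rightarrow> laurent_poly" where
  "G_diagram a b D =
     (\<Sum>i \<in> crossings_of_type a D. \<Sum>j \<in> crossings_of_type b D.
        of_int (crossing_sign D i * crossing_sign D j) * (tpow (alpha_beta D i j) - 1))
     - of_int (writhe b D) * W_diagram a D"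

definition H_diagram :: "nat \<Rightarrow> nat \<Rightarrow> lv_diagram \<Rightarrow> laurent_poly" where
  "H_diagram a b D =
     (\<Sum>i \<in> crossings_of_type a D. \<Sum>j \<in> crossings_of_type b D.
        of_int (crossing_sign D i * crossing_sign D j) * (tpow (beta_beta D i j) - 1))
     - of_int (writhe a D) * W_diagram b D
     - of_int (writhe b D) * invert_t (W_diagram a D)"

text \<open>The polynomials of a long virtual knot are the common values on all its diagrams.\<close>

definition W_poly :: "nat \<Rightarrow> lv_diagram set \<Rightarrow> laurent_poly" where
  "W_poly a K = (THE p. \<forall>D \<in> K. W_diagram a D = p)"

definition F_poly :: "nat \<Rightarrow> nat \<Rightarrow> lv_diagram set \<Rightarrow> laurent_poly" where
  "F_poly a b K = (THE p. \<forall>D \<in> K. F_diagram a b D = p)"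

definition G_poly :: "nat \<Rightarrow> nat \<Rightarrow> lv_diagram set \<Rightarrow> laurent_poly" where
  "G_poly a b K = (THE p. \<forall>D \<in> K. G_diagram a b D = p)"

definition H_poly :: "nat \<Rightarrow> nat \<Rightarrow> lv_diagram set \<Rightarrow> laurent_poly" where
  "H_poly a b K = (THE p. \<forall>D \<in> K. H_diagram a b D = p)"

end

theory Submission
  imports Defs
begin

text \<open>
  The proof replaces the surface by the Gauss diagram. Every real crossing has two passages \<open>P\<close>
  and \<open>Q\<close>, named such that the branch through \<open>Q\<close> crosses the branch through \<open>P\<close> from right to
  left. Let \<open>v\<close> and \<open>w\<close> be cycles that are carried by the knot, given by the multiplicities
  \<open>v(P-)\<close> and \<open>v(P+)\<close> with which they run through the edges before and after each passage \<open>P\<close>. If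
  \<open>w\<close> is pushed off to its left, the crossing contributes \<open>v(P-) w(Q-) - v(Q+) w(P+)\<close> to \<open>v \<cdot> w\<close>.
  The sum of these terms, the pairing, involves only the order of the passages along the knot and
  their names, so the intersection numbers are the same for all surface realizations
  (\<open>loop_intersections\<close>, \<open>surface_realization_pairing\<close>). A realization exists, since the Gauss
  diagram determines a ribbon graph (\<open>surface_realization_exists\<close>).

  The pairing is bilinear, and \<open>\<beta>\<^sub>i\<close> is the difference of the whole knot and \<open>\<alpha>\<^sub>i\<close>. Let \<open>n\<^sub>i\<close> be the
  index of the chord \<open>i\<close>, the pairing of \<open>\<alpha>\<^sub>i\<close> with the whole knot, and let \<open>l\<^sub>i\<^sub>j = \<alpha>\<^sub>i \<cdot> \<alpha>\<^sub>j\<close>. Then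
  \<open>\<alpha>\<^sub>i \<cdot> \<beta>\<^sub>j = n\<^sub>i - l\<^sub>i\<^sub>j\<close> and \<open>\<beta>\<^sub>i \<cdot> \<beta>\<^sub>j = l\<^sub>i\<^sub>j - n\<^sub>i + n\<^sub>j\<close> (\<open>intersection_numbers_gauss\<close>). Therefore
  each of the polynomials \<open>F\<close>, \<open>G\<close> and \<open>H\<close> is a sum of the terms \<open>\<epsilon>\<^sub>i \<epsilon>\<^sub>j \<phi>(n\<^sub>i, n\<^sub>j, l\<^sub>i\<^sub>j)\<close> over all
  pairs of chords of the given types; the correction terms with the writhes turn \<open>\<phi>\<close> into
  \<open>t\<^sup>l - 1\<close>, \<open>t\<^sup>m\<^sup>-\<^sup>l - t\<^sup>m\<close> and \<open>t\<^sup>l\<^sup>-\<^sup>m\<^sup>+\<^sup>n - t\<^sup>n - t\<^sup>-\<^sup>m + 1\<close>, respectively, as functions of \<open>m = n\<^sub>i\<close>,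
  \<open>n = n\<^sub>j\<close> and \<open>l = l\<^sub>i\<^sub>j\<close>.

  The polynomials of a knot are the common values on its diagrams, so invariance under the moves
  is part of what has to be shown. All three \<open>\<phi>\<close> vanish if \<open>l\<close> and one of \<open>m\<close>, \<open>n\<close> are \<open>0\<close>; hence
  an isolated chord, which the first move removes, does not contribute (\<open>kink_same_chord_sums\<close>).
  The second move removes two chords that have opposite signs and agree in everything else,
  because their loops differ by the boundary of a bigon (\<open>bigon_same_chord_sums\<close>). The third move
  preserves all signs, indices and linking numbers (\<open>triangle_same_chord_sums\<close>): the contribution
  of the three crossings to the pairing depends only on the values of the two cycles at the six
  points where the arcs enter and leave the square.

  In a product, chords \<open>i\<close> and \<open>j\<close> of different factors have \<open>l\<^sub>i\<^sub>j = 0\<close>, and the indices are those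
  in the factors. So the mixed terms are \<open>\<phi>(n\<^sub>i, n\<^sub>j, 0)\<close>, which is \<open>0\<close> for \<open>F\<close> and \<open>G\<close> and
  \<open>(t\<^sup>-\<^sup>m - 1)(t\<^sup>n - 1)\<close> for \<open>H\<close>. This gives the products of the polynomials \<open>W\<close>
  (\<open>polynomials_concatenation\<close>).
\<close>

section \<open>Cycles on a knot\<close>

datatype side = Before | After

text \<open>
  The contribution of one crossing to the intersection number of the cycles \<open>v\<close> and \<open>w\<close>. The
  passages of \<open>c\<close> are (over, under), so the branch through the second one runs from right to left
  iff the sign \<open>e\<close> is \<open>1\<close>. Push \<open>w\<close> to its left. Where \<open>w\<close> leaves along \<open>P\<close>, it then crosses the
  edge after \<open>Q\<close>, on which \<open>v\<close> runs away from the crossing; where \<open>w\<close> arrives along \<open>Q\<close>, it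
  crosses the edge before \<open>P\<close>, on which \<open>v\<close> runs towards the crossing.
\<close>

definition chord_term ::
  "int \<Rightarrow> 'a \<times> 'a \<Rightarrow> (side \<Rightarrow> 'a \<Rightarrow> int) \<Rightarrow> (side \<Rightarrow> 'a \<Rightarrow> int) \<Rightarrow> int" where
  "chord_term e c v w =
     (let (P, Q) = (if e = 1 then c else prod.swap c)
      in v Before P * w Before Q - v After Q * w After P)"

text \<open>
  The multiplicities of the edges in the loop \<open>\<alpha>\<close> of a chord. They differ on the two sides of its
  ends, which is why the side has to be kept as an argument.
\<close>

definition loop :: "'a::linorder \<times> 'a \<Rightarrow> side \<Rightarrow> 'a \<Rightarrow> int" where
  "loop c \<delta> t = (case \<delta> of
     Before \<Rightarrow> of_bool ((fst c < t \<or> snd c < t) \<and> (t \<le> fst c \<or> t \<le> snd c))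
   | After \<Rightarrow> of_bool ((fst c \<le> t \<or> snd c \<le> t) \<and> (t < fst c \<or> t < snd c)))"

definition coloop :: "'a::linorder \<times> 'a \<Rightarrow> side \<Rightarrow> 'a \<Rightarrow> int" where
  "coloop c \<delta> t = 1 - loop c \<delta> t"

lemma loop_simps:
  "loop (s, u) Before t = of_bool ((s < t \<or> u < t) \<and> (t \<le> s \<or> t \<le> u))"
  "loop (s, u) After t = of_bool ((s \<le> t \<or> u \<le> t) \<and> (t < s \<or> t < u))"
  by (simp_all add: loop_def)

lemma loop_swap: "loop (u, s) = loop (s, u)"
  by (intro ext, rename_tac d t, case_tac d) (auto simp: loop_simps)

section \<open>Sectors at a vertex\<close>

lemma funpow_orbit_period:
  assumes "finite S" "bij_betw f S S" "d \<in> S"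
  obtains n where "n > 0" "(f ^^ n) d = d" "inj_on (\<lambda>k. (f ^^ k) d) {..<n}"
    "\<And>k. (f ^^ k) d = (f ^^ (k mod n)) d"
proof -
  have bij: "bij_betw (f ^^ k) S S" for k
    using assms(2) by (rule bij_betw_funpow)
  have inS: "(f ^^ k) d \<in> S" for k
    using bij[of k] assms(3) by (auto simp: bij_betw_def)
  have ret: "(f ^^ (j - i)) d = d" if "i \<le> j" "(f ^^ i) d = (f ^^ j) d" for i j
  proof -
    have "(f ^^ j) d = (f ^^ i) ((f ^^ (j - i)) d)"
      using that(1) fun_cong[OF funpow_add[of i "j - i" f], of d] by simp
    then have "(f ^^ i) ((f ^^ (j - i)) d) = (f ^^ i) d" using that by simp
    then show ?thesis using bij[of i] inS assms(3) by (auto simp: bij_betw_def inj_on_def)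
  qed
  have "\<not> inj_on (\<lambda>k. (f ^^ k) d) (UNIV :: nat set)"
  proof
    assume "inj_on (\<lambda>k. (f ^^ k) d) (UNIV :: nat set)"
    moreover have "finite ((\<lambda>k. (f ^^ k) d) ` UNIV)"
      by (rule finite_subset[OF _ assms(1)]) (use inS in auto)
    ultimately show False using finite_imageD infinite_UNIV_nat by blast
  qed
  then obtain i j where "i < j" "(f ^^ i) d = (f ^^ j) d"
    unfolding inj_on_def by (metis linorder_neqE_nat)
  then have ex: "\<exists>n>0. (f ^^ n) d = d" using ret[of i j] by (intro exI[of _ "j - i"]) auto
  define n where "n = (LEAST n. n > 0 \<and> (f ^^ n) d = d)"
  have n: "n > 0 \<and> (f ^^ n) d = d" unfolding n_def using ex by (rule LeastI_ex)
  have least: "n \<le> k" if "k > 0" "(f ^^ k) d = d" for k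
    unfolding n_def using that by (intro Least_le) auto
  have "inj_on (\<lambda>k. (f ^^ k) d) {..<n}"
  proof (rule linorder_inj_onI)
    fix i j assume "i < j" "i \<in> {..<n}" "j \<in> {..<n}"
    show "(f ^^ i) d \<noteq> (f ^^ j) d"
    proof
      assume "(f ^^ i) d = (f ^^ j) d"
      then have "(f ^^ (j - i)) d = d" using ret[of i j] \<open>i < j\<close> by simp
      then have "n \<le> j - i" using least[of "j - i"] \<open>i < j\<close> by simp
      then show False using \<open>j \<in> {..<n}\<close> \<open>i < j\<close> by simp
    qed
  qed auto
  moreover have "(f ^^ k) d = (f ^^ (k mod n)) d" for k
    using n by (simp add: funpow_mod_eq)
  ultimately show thesis using that n by blast
qed

lemma sector_same_vertex: "x \<in> sector M d e \<Longrightarrow> same_vertex M d x"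
  by (auto simp: sector_def same_vertex_def)

text \<open>Once the darts of a vertex are numbered counterclockwise, sectors are cyclic intervals.\<close>

lemma sector_iff_cyclic_interval:
  fixes M d
  defines "g \<equiv> \<lambda>k. (rot M ^^ k) d"
  assumes n: "n > 0" and inj: "inj_on g {..<n}" and per: "\<And>k. g k = g (k mod n)"
    and "a < n" "b < n" "k < n" "a \<noteq> b"
  shows "g k \<in> sector M (g a) (g b) \<longleftrightarrow> (if a < b then a < k \<and> k < b else a < k \<or> k < b)"
proof -
  \<comment> \<open>the number of steps from \<open>a\<close> to \<open>b\<close>\<close>
  define e where "e = (if a < b then b - a else b + n - a)"
  have e: "0 < e" "e < n" "(a + e) mod n = b"
    using assms(5-8) by (auto simp: e_def)
  have geq: "g i = g j \<longleftrightarrow> i mod n = j mod n" for i j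
    using per[of i] per[of j] inj n unfolding inj_on_def by (metis lessThan_iff mod_less_divisor)
  have it: "(rot M ^^ i) (g a) = g (a + i)" for i
    unfolding g_def by (metis add.commute comp_apply funpow_add)
  have avoid: "(\<forall>j. 0 < j \<and> j \<le> i \<longrightarrow> g (a + j) \<noteq> g b) \<longleftrightarrow> i < e" for i
  proof
    assume A: "\<forall>j. 0 < j \<and> j \<le> i \<longrightarrow> g (a + j) \<noteq> g b"
    show "i < e"
    proof (rule ccontr)
      assume "\<not> i < e"
      then have "g (a + e) \<noteq> g b" using A e by auto
      then show False using e(3) geq[of "a + e" b] assms(6) by simp
    qed
  next
    assume i: "i < e"
    show "\<forall>j. 0 < j \<and> j \<le> i \<longrightarrow> g (a + j) \<noteq> g b"
    proof (intro allI impI)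
      fix j assume j: "0 < j \<and> j \<le> i"
      have "(a + j) mod n \<noteq> b"
      proof (cases "a + j < n")
        case True then show ?thesis using j i assms(5-8) by (auto simp: e_def split: if_splits)
      next
        case False
        then have "(a + j) mod n = a + j - n" using j i e assms(5)
          by (simp add: le_mod_geq)
        then show ?thesis using False j i assms(5-8) by (auto simp: e_def split: if_splits)
      qed
      then show "g (a + j) \<noteq> g b" using geq[of "a + j" b] assms(6) by simp
    qed
  qed
  have "g k \<in> sector M (g a) (g b) \<longleftrightarrow> (\<exists>i>0. g k = g (a + i) \<and> i < e)"
    unfolding sector_def it by (simp add: avoid)
  also have "\<dots> \<longleftrightarrow> (\<exists>i>0. k = (a + i) mod n \<and> i < e)"
    using assms(7) by (simp add: geq)
  also have "\<dots> \<longleftrightarrow> (if a < b then a < k \<and> k < b else a < k \<or> k < b)"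
  proof
    assume "\<exists>i>0. k = (a + i) mod n \<and> i < e"
    then obtain i where i: "i > 0" "k = (a + i) mod n" "i < e" by blast
    show "if a < b then a < k \<and> k < b else a < k \<or> k < b"
    proof (cases "a + i < n")
      case True then show ?thesis using i by (auto simp: e_def split: if_splits)
    next
      case False
      then have "(a + i) mod n = a + i - n" using i e assms(5)
        by (simp add: le_mod_geq)
      then show ?thesis using False i assms(5-8) by (auto simp: e_def split: if_splits)
    qed
  next
    assume A: "if a < b then a < k \<and> k < b else a < k \<or> k < b"
    show "\<exists>i>0. k = (a + i) mod n \<and> i < e"
    proof (cases "a < k")
      case True
      then show ?thesis using A assms(5-8)
        by (intro exI[of _ "k - a"]) (auto simp: e_def split: if_splits)
    next
      case False
      then show ?thesis using A assms(5-8)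
        by (intro exI[of _ "k + n - a"]) (auto simp: e_def split: if_splits)
    qed
  qed
  finally show ?thesis .
qed

section \<open>Knot diagrams on surfaces\<close>

locale surface_diagram =
  fixes M :: cell_surface and w :: "nat list" and Y :: "(nat \<times> nat) set"
  assumes diagram: "surface_knot_diagram M w Y"
begin

abbreviation "N \<equiv> length w"
abbreviation "outd \<equiv> out_dart w"
abbreviation "ind \<equiv> in_dart M w"

lemma finite_darts: "finite (darts M)"
  and rot_bij: "bij_betw (rot M) (darts M) (darts M)"
  and opp_dart: "d \<in> darts M \<Longrightarrow> opp M d \<in> darts M"
  and opp_opp: "d \<in> darts M \<Longrightarrow> opp M (opp M d) = d"
  and path_nonempty: "0 < N"
  and path_darts: "set w \<subseteq> darts M"
  and path_step: "p < N \<Longrightarrow> same_vertex M (ind p) (outd p)"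
  and path_distinct: "distinct w"
  and opp_notin_path: "d \<in> set w \<Longrightarrow> opp M d \<notin> set w"
  and meeting_unique: "(p, q) \<in> meetings M w \<Longrightarrow> (p, r) \<in> meetings M w \<Longrightarrow> q = r"
  and transversal: "(p, q) \<in> meetings M w \<Longrightarrow>
        (outd q \<in> left_side M w p) \<noteq> (ind q \<in> left_side M w p)"
  and base_no_meeting: "(0, q) \<notin> meetings M w"
  and Y_meetings: "Y \<subseteq> meetings M w"
  and Y_orients: "(p, q) \<in> meetings M w \<Longrightarrow> ((p, q) \<in> Y) \<noteq> ((q, p) \<in> Y)"
  using diagram by (auto simp: surface_knot_diagram_def closed_surface_def closed_path_def)

definition prev :: "nat \<Rightarrow> nat" where
  "prev p = (p + N - 1) mod N"

lemma prev_less: "prev p < N"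
  using path_nonempty by (simp add: prev_def)

lemma prev_pos: "0 < p \<Longrightarrow> p < N \<Longrightarrow> prev p = p - 1"
  by (simp add: prev_def mod_if)

lemma prev_0: "prev 0 = N - 1"
  using path_nonempty by (simp add: prev_def)

lemma prev_inj: assumes "p < N" "q < N" "prev p = prev q" shows "p = q"
  using assms by (cases "p = 0"; cases "q = 0") (auto simp: prev_pos prev_0)

lemma ind_eq: "ind p = opp M (w ! prev p)"
  by (simp add: in_dart_def prev_def)

lemma outd_path: "p < N \<Longrightarrow> outd p \<in> set w"
  by (simp add: out_dart_def)

lemma opp_ind: "opp M (ind p) = w ! prev p"
  unfolding ind_eq using path_darts prev_less by (intro opp_opp) auto

lemma outd_dart: "p < N \<Longrightarrow> outd p \<in> darts M"
  using outd_path path_darts by blast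

lemma ind_dart: "ind p \<in> darts M"
  unfolding ind_eq using path_darts prev_less by (intro opp_dart) auto

lemma outd_inj: "p < N \<Longrightarrow> q < N \<Longrightarrow> outd p = outd q \<Longrightarrow> p = q"
  using path_distinct by (simp add: out_dart_def nth_eq_iff_index_eq)

lemma ind_inj: assumes "p < N" "q < N" "ind p = ind q" shows "p = q"
proof -
  have "w ! prev p = w ! prev q" using assms(3) opp_ind by metis
  then have "prev p = prev q" using path_distinct prev_less by (simp add: nth_eq_iff_index_eq)
  then show ?thesis using assms prev_inj by blast
qed

lemma ind_notin_path: "ind p \<notin> set w"
  unfolding ind_eq using prev_less by (intro opp_notin_path) auto

lemma ind_neq_outd: "q < N \<Longrightarrow> ind p \<noteq> outd q"
  using ind_notin_path outd_path by metis

lemma same_vertex_trans: "same_vertex M d e \<Longrightarrow> same_vertex M e f \<Longrightarrow> same_vertex M d f"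
  unfolding same_vertex_def by (metis comp_apply funpow_add)

lemma same_vertex_sym:
  assumes "d \<in> darts M" "same_vertex M d e" shows "same_vertex M e d"
proof -
  obtain n where n: "n > 0" "(rot M ^^ n) d = d" "\<And>k. (rot M ^^ k) d = (rot M ^^ (k mod n)) d"
    using funpow_orbit_period[OF finite_darts rot_bij assms(1)] by metis
  obtain k where k: "(rot M ^^ k) d = e" using assms(2) by (auto simp: same_vertex_def)
  have "(rot M ^^ (n - k mod n)) e = (rot M ^^ (n - k mod n + k mod n)) d"
    using k n(3)[of k] by (simp only: funpow_add comp_apply)
  also have "\<dots> = d" using n(1,2) by simp
  finally show ?thesis unfolding same_vertex_def by blast
qed

lemma meetings_iff: "(p, q) \<in> meetings M w \<longleftrightarrow>
    p < N \<and> q < N \<and> p \<noteq> q \<and> same_vertex M (outd p) (outd q)"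
  by (auto simp: meetings_def)

lemma meetings_sym: "(p, q) \<in> meetings M w \<Longrightarrow> (q, p) \<in> meetings M w"
  using same_vertex_sym outd_dart by (auto simp: meetings_iff)

text \<open>
  At a crossing the branch through passage \<open>q\<close> runs from the right of passage \<open>p\<close> to its left.
\<close>

definition positive :: "nat \<Rightarrow> nat \<Rightarrow> bool" where
  "positive p q \<longleftrightarrow> (p, q) \<in> meetings M w \<and> outd q \<in> left_side M w p"

text \<open>
  All sectors that loops cut out at a crossing follow from the cyclic order of its four darts,
  which is \<open>outd p\<close>, \<open>outd q\<close>, \<open>ind p\<close>, \<open>ind q\<close> at a positive crossing.
\<close>

lemma crossing_darts_order:
  assumes m: "(p, q) \<in> meetings M w"
  shows "\<exists>n a b c. n > 0 \<and> inj_on (\<lambda>k. (rot M ^^ k) (outd p)) {..<n} \<and>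
    (\<forall>k. (rot M ^^ k) (outd p) = (rot M ^^ (k mod n)) (outd p)) \<and>
    a < n \<and> b < n \<and> c < n \<and> 0 < a \<and> 0 < b \<and> 0 < c \<and> outd q = (rot M ^^ a) (outd p) \<and>
    ind p = (rot M ^^ b) (outd p) \<and> ind q = (rot M ^^ c) (outd p) \<and>
    (if positive p q then a < b \<and> b < c else c < b \<and> b < a)"
proof -
  let ?g = "\<lambda>k. (rot M ^^ k) (outd p)"
  have pq: "p < N" "q < N" "p \<noteq> q" using m by (auto simp: meetings_iff)
  obtain n where n: "n > 0" "inj_on ?g {..<n}" "\<And>k. ?g k = ?g (k mod n)"
    using funpow_orbit_period[OF finite_darts rot_bij outd_dart[OF pq(1)]] by metis
  have idx: "\<exists>k<n. 0 < k \<and> x = ?g k" if "same_vertex M (outd p) x" "x \<noteq> outd p" for x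
  proof -
    from that(1) obtain k where "?g k = x" unfolding same_vertex_def by blast
    then have "?g (k mod n) = x" using n(3) by simp
    moreover have "k mod n \<noteq> 0"
    proof
      assume "k mod n = 0"
      then have "x = outd p" using \<open>?g (k mod n) = x\<close> by simp
      then show False using that by simp
    qed
    ultimately show ?thesis using n(1) by (intro exI[of _ "k mod n"]) auto
  qed
  have sv: "same_vertex M (outd p) (outd q)" using m by (simp add: meetings_iff)
  have svi: "same_vertex M (outd p) (ind p)"
    using same_vertex_sym[OF ind_dart path_step[OF pq(1)]] .
  have svq: "same_vertex M (outd p) (ind q)"
    using same_vertex_trans[OF sv same_vertex_sym[OF ind_dart path_step[OF pq(2)]]] .
  obtain a where a: "a < n" "0 < a" "outd q = ?g a"
    using idx[OF sv] outd_inj[of q p] pq by auto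
  obtain b where b: "b < n" "0 < b" "ind p = ?g b"
    using idx[OF svi] ind_neq_outd[OF pq(1)] by metis
  obtain c where c: "c < n" "0 < c" "ind q = ?g c"
    using idx[OF svq] ind_neq_outd[OF pq(1)] by metis
  have ne: "a \<noteq> b" "a \<noteq> c" "b \<noteq> c"
    using a b c ind_neq_outd[OF pq(2)] ind_inj[OF pq(1,2)] pq(3) by metis+
  have sec: "?g k \<in> left_side M w p \<longleftrightarrow> 0 < k \<and> k < b" if "k < n" for k
    using sector_iff_cyclic_interval[OF n, of 0 b k] that n(1) b by (simp add: left_side_def)
  have "positive p q \<longleftrightarrow> a < b"
    using sec[OF a(1)] a m by (simp add: positive_def)
  moreover have "(a < b) \<noteq> (c < b)"
    using transversal[OF m] sec[OF a(1)] sec[OF c(1)] a c by simp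
  ultimately have "if positive p q then a < b \<and> b < c else c < b \<and> b < a"
    using ne by auto
  with n a b c show ?thesis
    by (intro exI[of _ n] exI[of _ a] exI[of _ b] exI[of _ c]) blast
qed

lemma positive_sectors:
  assumes "positive p q"
  shows "outd q \<in> sector M (outd p) (ind p)" "ind q \<notin> sector M (outd p) (ind p)"
    "outd p \<notin> sector M (outd p) (ind p)" "ind p \<notin> sector M (outd p) (ind p)"
    "ind p \<in> sector M (outd q) (ind q)" "outd p \<notin> sector M (outd q) (ind q)"
    "outd q \<notin> sector M (outd q) (ind q)" "ind q \<notin> sector M (outd q) (ind q)"
    "outd q \<in> sector M (outd p) (ind q)" "ind p \<in> sector M (outd p) (ind q)"
    "outd p \<notin> sector M (outd p) (ind q)" "ind q \<notin> sector M (outd p) (ind q)"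
    "outd p \<notin> sector M (outd q) (ind p)" "outd q \<notin> sector M (outd q) (ind p)"
    "ind p \<notin> sector M (outd q) (ind p)" "ind q \<notin> sector M (outd q) (ind p)"
proof -
  have m: "(p, q) \<in> meetings M w" using assms by (simp add: positive_def)
  obtain n a b c where n: "n > 0" "inj_on (\<lambda>k. (rot M ^^ k) (outd p)) {..<n}"
    "\<forall>k. (rot M ^^ k) (outd p) = (rot M ^^ (k mod n)) (outd p)"
    and abc: "a < n" "b < n" "c < n" "0 < a" "0 < b" "0 < c"
    and e: "outd q = (rot M ^^ a) (outd p)" "ind p = (rot M ^^ b) (outd p)"
      "ind q = (rot M ^^ c) (outd p)"
    and "if positive p q then a < b \<and> b < c else c < b \<and> b < a"
    using crossing_darts_order[OF m] by (elim exE conjE)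
  then have ord: "a < b" "b < c" using assms by simp_all
  have e0: "outd p = (rot M ^^ 0) (outd p)" by simp
  note S = sector_iff_cyclic_interval[OF n(1,2) spec[OF n(3)]]
  show "outd q \<in> sector M (outd p) (ind p)"
    using S[of 0 b a] abc ord e by simp
  show "ind q \<notin> sector M (outd p) (ind p)"
    using S[of 0 b c] abc ord e by simp
  show "outd p \<notin> sector M (outd p) (ind p)"
    using S[of 0 b 0] abc ord e by simp
  show "ind p \<notin> sector M (outd p) (ind p)"
    using S[of 0 b b] abc ord e by simp
  show "ind p \<in> sector M (outd q) (ind q)"
    using S[of a c b] abc ord e by simp
  show "outd p \<notin> sector M (outd q) (ind q)"
    using S[of a c 0] abc ord e by simp
  show "outd q \<notin> sector M (outd q) (ind q)"
    using S[of a c a] abc ord e by simp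
  show "ind q \<notin> sector M (outd q) (ind q)"
    using S[of a c c] abc ord e by simp
  show "outd q \<in> sector M (outd p) (ind q)"
    using S[of 0 c a] abc ord e by simp
  show "ind p \<in> sector M (outd p) (ind q)"
    using S[of 0 c b] abc ord e by simp
  show "outd p \<notin> sector M (outd p) (ind q)"
    using S[of 0 c 0] abc ord e by simp
  show "ind q \<notin> sector M (outd p) (ind q)"
    using S[of 0 c c] abc ord e by simp
  show "outd p \<notin> sector M (outd q) (ind p)"
    using S[of a b 0] abc ord e by simp
  show "outd q \<notin> sector M (outd q) (ind p)"
    using S[of a b a] abc ord e by simp
  show "ind p \<notin> sector M (outd q) (ind p)"
    using S[of a b b] abc ord e by simp
  show "ind q \<notin> sector M (outd q) (ind p)"
    using S[of a b c] abc ord e by simp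
qed

lemma positive_swap:
  assumes m: "(p, q) \<in> meetings M w"
  shows "positive q p \<longleftrightarrow> \<not> positive p q"
proof -
  obtain n a b c where n: "n > 0" "inj_on (\<lambda>k. (rot M ^^ k) (outd p)) {..<n}"
    "\<forall>k. (rot M ^^ k) (outd p) = (rot M ^^ (k mod n)) (outd p)"
    and abc: "a < n" "b < n" "c < n" "0 < a" "0 < b" "0 < c"
    and e: "outd q = (rot M ^^ a) (outd p)" "ind p = (rot M ^^ b) (outd p)"
      "ind q = (rot M ^^ c) (outd p)"
    and ord: "if positive p q then a < b \<and> b < c else c < b \<and> b < a"
    using crossing_darts_order[OF m] by (elim exE conjE)
  have "outd p \<in> left_side M w q \<longleftrightarrow> \<not> positive p q"
    using sector_iff_cyclic_interval[OF n(1,2) spec[OF n(3)], of a c 0] abc ord e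
    by (auto simp: left_side_def split: if_splits)
  then show ?thesis using meetings_sym[OF m] by (simp add: positive_def)
qed

end

section \<open>Intersection numbers of the loops at crossings\<close>

context surface_diagram
begin

text \<open>
  The multiplicity of an edge in a path; the edge before the base point \<open>0\<close> is the last one.
\<close>

definition coeff :: "nat list \<Rightarrow> side \<Rightarrow> nat \<Rightarrow> int" where
  "coeff v \<delta> p = (case \<delta> of Before \<Rightarrow> int (count_list v (w ! prev p)) | After \<Rightarrow> int (count_list v
      (w ! p)))"

text \<open>
  How often \<open>v\<close> runs through the darts \<open>T\<close> of a vertex towards that vertex, minus how often it
  runs away.
\<close>

definition boundary_flow :: "nat list \<Rightarrow> nat set \<Rightarrow> int" where
  "boundary_flow v T = (\<Sum>d\<in>T. int (count_list v (opp M d)) - int (count_list v d))"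

lemma intersection_number_boundary_flow:
  "intersection_number M v u = (\<Sum>i<length u. boundary_flow v (left_side M u i))"
  by (simp add: intersection_number_def boundary_flow_def)

lemma count_list_zero: "set v \<subseteq> set w \<Longrightarrow> d \<notin> set w \<Longrightarrow> count_list v d = 0"
  by (meson count_notin subsetD)

lemma prev_surj: assumes "k < N" obtains r where "r < N" "prev r = k"
proof
  show "(k + 1) mod N < N" using path_nonempty by simp
  show "prev ((k + 1) mod N) = k"
  proof (cases "k + 1 = N")
    case True then show ?thesis by (simp add: prev_0[unfolded prev_def] prev_def) 
  next
    case False then show ?thesis using assms by (simp add: prev_pos)
  qed
qed

text \<open>
  A path along the knot runs only through edges of the knot, and each of these is the outgoing
  dart of one passage and the opposite of the incoming dart of the next one.
\<close>

lemma boundary_flow_passages: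
  assumes "T \<subseteq> darts M" and v: "set v \<subseteq> set w"
  shows "boundary_flow v T = (\<Sum>r<N. (if ind r \<in> T then coeff v Before r else 0)
                                   - (if outd r \<in> T then coeff v After r else 0))"
proof -
  have fin: "finite T" using assms finite_darts finite_subset by blast
  have "(\<Sum>d\<in>T. int (count_list v (opp M d))) = (\<Sum>d\<in>T \<inter> ind ` {..<N}. int (count_list v (opp M d)))"
  proof (rule sum.mono_neutral_right[OF fin])
    show "\<forall>d\<in>T - T \<inter> ind ` {..<N}. int (count_list v (opp M d)) = 0"
    proof
      fix d assume d: "d \<in> T - T \<inter> ind ` {..<N}"
      have "opp M d \<notin> set w"
      proof
        assume "opp M d \<in> set w"
        then obtain k where k: "k < N" "w ! k = opp M d" by (auto simp: in_set_conv_nth)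
        then obtain r where r: "r < N" "prev r = k" using prev_surj by blast
        have "ind r = d" using d assms(1) opp_opp[of d] k r by (auto simp: ind_eq)
        then show False using d r by auto
      qed
      then show "int (count_list v (opp M d)) = 0" using count_list_zero[OF v] by simp
    qed
  qed auto
  also have "\<dots> = (\<Sum>d\<in>ind ` {r\<in>{..<N}. ind r \<in> T}. int (count_list v (opp M d)))"
    by (rule sum.cong) auto
  also have "\<dots> = (\<Sum>r\<in>{r\<in>{..<N}. ind r \<in> T}. coeff v Before r)"
    by (subst sum.reindex) (auto simp: inj_on_def opp_ind coeff_def intro: ind_inj)
  also have "\<dots> = (\<Sum>r<N. if ind r \<in> T then coeff v Before r else 0)"
    by (rule sum.inter_filter) simp
  finally have 1: "(\<Sum>d\<in>T. int (count_list v (opp M d))) = \<dots>" .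
  have "(\<Sum>d\<in>T. int (count_list v d)) = (\<Sum>d\<in>T \<inter> outd ` {..<N}. int (count_list v d))"
  proof (rule sum.mono_neutral_right[OF fin])
    show "\<forall>d\<in>T - T \<inter> outd ` {..<N}. int (count_list v d) = 0"
    proof
      fix d assume d: "d \<in> T - T \<inter> outd ` {..<N}"
      then have "d \<notin> set w" by (auto simp: in_set_conv_nth out_dart_def)
      then show "int (count_list v d) = 0" using count_list_zero[OF v] by simp
    qed
  qed auto
  also have "\<dots> = (\<Sum>d\<in>outd ` {r\<in>{..<N}. outd r \<in> T}. int (count_list v d))"
    by (rule sum.cong) auto
  also have "\<dots> = (\<Sum>r\<in>{r\<in>{..<N}. outd r \<in> T}. coeff v After r)"
    by (subst sum.reindex) (auto simp: inj_on_def out_dart_def coeff_def intro: outd_inj[unfolded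
        out_dart_def])
  also have "\<dots> = (\<Sum>r<N. if outd r \<in> T then coeff v After r else 0)"
    by (rule sum.inter_filter) simp
  finally have 2: "(\<Sum>d\<in>T. int (count_list v d)) = \<dots>" .
  show ?thesis unfolding boundary_flow_def sum_subtractf 1 2 ..
qed

lemma sector_darts: assumes "d \<in> darts M" shows "sector M d e \<subseteq> darts M"
proof -
  have "(rot M ^^ k) d \<in> darts M" for k
    using bij_betw_funpow[OF rot_bij, of k] assms by (auto simp: bij_betw_def)
  then show ?thesis by (auto simp: sector_def)
qed

lemma passage_at_vertex:
  assumes "p < N" "r < N" "T \<subseteq> Collect (same_vertex M (outd p))" "ind r \<in> T \<or> outd r \<in> T" "r \<noteq> p"
  shows "(p, r) \<in> meetings M w"
proof -
  have "same_vertex M (outd p) (outd r)"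
    using assms(3,4) same_vertex_trans path_step[OF assms(2)] by blast
  then show ?thesis using assms by (simp add: meetings_iff)
qed

lemma boundary_flow_crossing:
  assumes m: "(p, q) \<in> meetings M w" and v: "set v \<subseteq> set w"
    and T: "T \<subseteq> darts M" "T \<subseteq> Collect (same_vertex M (outd p))"
  shows "boundary_flow v T =
     (if ind p \<in> T then coeff v Before p else 0) - (if outd p \<in> T then coeff v After p else 0)
   + (if ind q \<in> T then coeff v Before q else 0) - (if outd q \<in> T then coeff v After q else 0)"
proof -
  have pq: "p < N" "q < N" "p \<noteq> q" using m by (auto simp: meetings_iff)
  have "boundary_flow v T = (\<Sum>r\<in>{p, q}. (if ind r \<in> T then coeff v Before r else 0)
                                   - (if outd r \<in> T then coeff v After r else 0))"
    unfolding boundary_flow_passages[OF T(1) v]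
  proof (rule sum.mono_neutral_right)
    show "\<forall>r\<in>{..<N} - {p, q}. (if ind r \<in> T then coeff v Before r else 0)
                                   - (if outd r \<in> T then coeff v After r else 0) = 0"
      using passage_at_vertex[OF pq(1) _ T(2)] meeting_unique[OF m] by auto
  qed (use pq in auto)
  then show ?thesis using pq(3) by simp
qed

text \<open>
  The only darts of the knot at such a vertex are those that bound the sector.
\<close>

lemma boundary_flow_no_crossing:
  assumes p: "p < N" and m: "\<And>q. (p, q) \<notin> meetings M w" and v: "set v \<subseteq> set w"
  shows "boundary_flow v (left_side M w p) = 0"
proof -
  let ?T = "left_side M w p"
  have T: "?T \<subseteq> darts M" "?T \<subseteq> Collect (same_vertex M (outd p))"
    using sector_darts[OF outd_dart[OF p]] sector_same_vertex by (auto simp: left_side_def)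
  obtain n where n: "n > 0" "inj_on (\<lambda>k. (rot M ^^ k) (outd p)) {..<n}"
      "\<And>k. (rot M ^^ k) (outd p) = (rot M ^^ (k mod n)) (outd p)"
    using funpow_orbit_period[OF finite_darts rot_bij outd_dart[OF p]] by metis
  obtain k where "(rot M ^^ k) (outd p) = ind p"
    using same_vertex_sym[OF ind_dart path_step[OF p]] unfolding same_vertex_def by blast
  then have b: "k mod n < n" "ind p = (rot M ^^ (k mod n)) (outd p)" using n by auto
  have "k mod n \<noteq> 0"
  proof
    assume "k mod n = 0"
    then have "ind p = outd p" using b(2) by simp
    then show False using ind_neq_outd[OF p] by metis
  qed
  then have "ind p \<notin> ?T" "outd p \<notin> ?T"
    using sector_iff_cyclic_interval[OF n, of 0 "k mod n" "k mod n"]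
      sector_iff_cyclic_interval[OF n, of 0 "k mod n" 0] b n(1)
    by (simp_all add: left_side_def)
  moreover have "r = p" if "r < N" "ind r \<in> ?T \<or> outd r \<in> ?T" for r
    using passage_at_vertex[OF p that(1) T(2) that(2)] m by blast
  ultimately have "(\<Sum>r<N. (if ind r \<in> ?T then coeff v Before r else 0)
                                   - (if outd r \<in> ?T then coeff v After r else 0)) = 0"
    by (intro sum.neutral) auto
  then show ?thesis unfolding boundary_flow_passages[OF T(1) v] .
qed

text \<open>
  The first two sectors belong to the two branches of the knot, the last two to the corners of the
  two loops that arise by smoothing the crossing.
\<close>

lemma positive_boundary_flow:
  assumes pos: "positive p q" and v: "set v \<subseteq> set w"
  shows "boundary_flow v (sector M (outd p) (ind p)) = - coeff v After q"
    "boundary_flow v (sector M (outd q) (ind q)) = coeff v Before p"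
    "boundary_flow v (sector M (outd p) (ind q)) = coeff v Before p - coeff v After q"
    "boundary_flow v (sector M (outd q) (ind p)) = 0"
proof -
  have m: "(p, q) \<in> meetings M w" using pos by (simp add: positive_def)
  then have pq: "p < N" "q < N" "same_vertex M (outd p) (outd q)" by (auto simp: meetings_iff)
  have 1: "sector M (outd p) e \<subseteq> Collect (same_vertex M (outd p))" for e
    using sector_same_vertex by blast
  have 2: "sector M (outd q) e \<subseteq> Collect (same_vertex M (outd p))" for e
    using sector_same_vertex same_vertex_trans[OF pq(3)] by blast
  note s = positive_sectors[OF pos]
  note d = sector_darts[OF outd_dart[OF pq(1)]] sector_darts[OF outd_dart[OF pq(2)]]
  show "boundary_flow v (sector M (outd p) (ind p)) = - coeff v After q"
    using boundary_flow_crossing[OF m v d(1) 1, of "ind p"] s by simp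
  show "boundary_flow v (sector M (outd q) (ind q)) = coeff v Before p"
    using boundary_flow_crossing[OF m v d(2) 2, of "ind q"] s by simp
  show "boundary_flow v (sector M (outd p) (ind q)) = coeff v Before p - coeff v After q"
    using boundary_flow_crossing[OF m v d(1) 1, of "ind q"] s by simp
  show "boundary_flow v (sector M (outd q) (ind p)) = 0"
    using boundary_flow_crossing[OF m v d(2) 2, of "ind p"] s by simp
qed

definition arc :: "nat \<times> nat \<Rightarrow> nat list" where
  "arc c = (let p = min (fst c) (snd c); q = max (fst c) (snd c) in take (q - p) (drop p w))"

definition coarc :: "nat \<times> nat \<Rightarrow> nat list" where
  "coarc c = (let p = min (fst c) (snd c); q = max (fst c) (snd c) in take p w @ drop q w)"

lemma arc_swap: "arc (q, p) = arc (p, q)" "coarc (q, p) = coarc (p, q)"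
  by (simp_all add: arc_def coarc_def min.commute max.commute)

lemma meetings_pos: "(p, q) \<in> meetings M w \<Longrightarrow> 0 < p \<and> 0 < q \<and> p < N \<and> q < N \<and> p \<noteq> q"
  using base_no_meeting meetings_sym[of p q] meetings_iff[of p q] by (metis gr0I)

lemma set_arc: "set (arc c) \<subseteq> set w" "set (coarc c) \<subseteq> set w"
  by (auto simp: arc_def coarc_def Let_def dest: in_set_takeD in_set_dropD)

lemma count_arc:
  assumes "p < q" "q < N" "r < N"
  shows "int (count_list (arc (p, q)) (w ! r)) = of_bool (p \<le> r \<and> r < q)"
    and "int (count_list (coarc (p, q)) (w ! r)) = 1 - of_bool (p \<le> r \<and> r < q)"
proof -
  have ar: "arc (p, q) = take (q - p) (drop p w)" "coarc (p, q) = take p w @ drop q w"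
    using assms by (simp_all add: arc_def coarc_def)
  have dist: "distinct (arc (p, q))" unfolding ar using path_distinct by simp
  have mem: "w ! r \<in> set (arc (p, q)) \<longleftrightarrow> p \<le> r \<and> r < q"
  proof
    assume "w ! r \<in> set (arc (p, q))"
    then obtain i where "i < q - p" "w ! (p + i) = w ! r"
      using assms by (auto simp: ar in_set_conv_nth)
    moreover have "p + i = r"
      using calculation assms path_distinct by (subst (asm) nth_eq_iff_index_eq) auto
    ultimately show "p \<le> r \<and> r < q" by auto
  next
    assume "p \<le> r \<and> r < q"
    then show "w ! r \<in> set (arc (p, q))"
      using assms by (auto simp: ar in_set_conv_nth intro!: exI[of _ "r - p"])
  qed
  have one: "count_list u x = of_bool (x \<in> set u)" if "distinct u" for u :: "nat list" and x
    using that by (induction u) auto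
  show 1: "int (count_list (arc (p, q)) (w ! r)) = of_bool (p \<le> r \<and> r < q)"
    using one[OF dist] mem by simp
  have "w = take p w @ take (q - p) (drop p w) @ drop q w"
    using assms(1) by (metis append.assoc append_take_drop_id drop_drop le_add_diff_inverse2
        less_imp_le take_add add.commute)
  then have "count_list w (w ! r) = count_list (arc (p, q)) (w ! r) + count_list (coarc (p, q)) (w
      ! r)"
    unfolding ar by (metis add.assoc add.left_commute count_list_append)
  moreover have "count_list w (w ! r) = 1" using one[OF path_distinct] assms(3) by simp
  ultimately show "int (count_list (coarc (p, q)) (w ! r)) = 1 - of_bool (p \<le> r \<and> r < q)"
    using 1 by linarith
qed

lemma coeff_arc_ordered:
  assumes "0 < p" "p < q" "q < N" "r < N"
  shows "coeff (arc (p, q)) \<delta> r = loop (p, q) \<delta> r" "coeff (coarc (p, q)) \<delta> r = coloop (p, q) \<delta> r"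
proof -
  have 1: "loop (p, q) \<delta> r = of_bool (case \<delta> of Before \<Rightarrow> p \<le> prev r \<and> prev r < q | After \<Rightarrow> p \<le> r \<and>
      r < q)"
    using assms by (cases \<delta>; cases "r = 0") (auto simp: loop_simps prev_0 prev_pos)
  show "coeff (arc (p, q)) \<delta> r = loop (p, q) \<delta> r" "coeff (coarc (p, q)) \<delta> r = coloop (p, q) \<delta> r"
    unfolding coloop_def 1 by (cases \<delta>; simp add: coeff_def count_arc assms prev_less)+
qed

lemma coeff_arc:
  assumes "c \<in> meetings M w" "r < N"
  shows "coeff (arc c) \<delta> r = loop c \<delta> r" "coeff (coarc c) \<delta> r = coloop c \<delta> r"
proof -
  obtain p q where c: "c = (p, q)" by fastforce
  have pq: "0 < p" "0 < q" "p < N" "q < N" "p \<noteq> q"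
    using meetings_pos[of p q] assms c by auto
  have sw: "coloop (q, p) = coloop (p, q)" by (intro ext) (simp add: coloop_def loop_swap)
  show "coeff (arc c) \<delta> r = loop c \<delta> r" "coeff (coarc c) \<delta> r = coloop c \<delta> r"
    using coeff_arc_ordered[of p q r \<delta>] coeff_arc_ordered[of q p r \<delta>] pq assms(2)
    unfolding c by (cases "p < q"; simp add: arc_swap[of q p] loop_swap[of q p] sw)+
qed

end

context surface_diagram
begin

text \<open>
  The loop \<open>\<alpha>\<close> runs through its passages like the knot does, except at the crossing itself, where
  it turns from the edge before \<open>q\<close> into the edge after \<open>p\<close>.
\<close>

lemma intersection_arc:
  assumes "0 < p" "p < q" "q < N"
  shows "intersection_number M v (arc (p, q)) =
    (\<Sum>r<N. if r = p then boundary_flow v (sector M (outd p) (ind q))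
            else if p < r \<and> r < q then boundary_flow v (left_side M w r) else 0)"
    (is "_ = sum ?h _")
proof -
  have ar: "arc (p, q) = take (q - p) (drop p w)" using assms by (simp add: arc_def)
  have len: "length (arc (p, q)) = q - p" using assms by (simp add: ar)
  have nth: "arc (p, q) ! i = w ! (p + i)" if "i < q - p" for i
    using that assms by (simp add: ar)
  have left: "left_side M (arc (p, q)) i =
      (if i = 0 then sector M (outd p) (ind q) else left_side M w (p + i))" if "i < q - p" for i
  proof (cases "i = 0")
    case True
    have "(q - p - 1) mod (q - p) = q - p - 1" using assms by simp
    then show ?thesis using True assms nth[of 0] nth[of "q - p - 1"] prev_pos[of q]
      by (simp add: left_side_def out_dart_def in_dart_def[of M "arc (p, q)"] len ind_eq)
  next
    case False
    then have "(i + (q - p) - 1) mod (q - p) = i - 1" using that by (simp add: mod_if)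
    then show ?thesis using False assms that nth[of i] nth[of "i - 1"] prev_pos[of "p + i"]
      by (simp add: left_side_def out_dart_def in_dart_def[of M "arc (p, q)"] len ind_eq)
  qed
  have "intersection_number M v (arc (p, q)) = (\<Sum>i<q - p. ?h (p + i))"
    unfolding intersection_number_boundary_flow len
    by (rule sum.cong) (auto simp: left)
  also have "\<dots> = sum ?h {p..<q}"
    by (rule sum.reindex_bij_witness[where i="\<lambda>r. r - p" and j="\<lambda>i. p + i"]) (use assms in auto)
  also have "\<dots> = sum ?h {..<N}"
    by (rule sum.mono_neutral_left) (use assms in auto)
  finally show ?thesis .
qed

text \<open>
  Likewise, the loop \<open>\<beta>\<close> turns from the edge before \<open>p\<close> into the edge after \<open>q\<close>.
\<close>

lemma intersection_coarc:
  assumes "0 < p" "p < q" "q < N"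
  shows "intersection_number M v (coarc (p, q)) =
    (\<Sum>r<N. if r = q then boundary_flow v (sector M (outd q) (ind p))
            else if r < p \<or> q < r then boundary_flow v (left_side M w r) else 0)"
    (is "_ = sum ?h _")
proof -
  have ar: "coarc (p, q) = take p w @ drop q w" using assms by (simp add: coarc_def)
  define L where "L = p + (N - q)"
  have len: "length (coarc (p, q)) = L" using assms by (simp add: ar L_def)
  \<comment> \<open>the passage of the knot that is the passage \<open>i\<close> of the loop\<close>
  define k where "k i = (if i < p then i else q + i - p)" for i
  have nth: "coarc (p, q) ! i = w ! k i" if "i < L" for i
    using that assms by (auto simp: ar k_def nth_append L_def)
  have left: "left_side M (coarc (p, q)) i =
      (if i = p then sector M (outd q) (ind p) else left_side M w (k i))" if "i < L" for i
  proof -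
    define j where "j = (i + L - 1) mod L"
    have j: "j = (if i = 0 then L - 1 else i - 1)"
      using that assms by (simp add: j_def mod_if L_def)
    have "k j = (if i = p then prev p else prev (k i))" "k p = q" "j < L"
      using that assms by (auto simp: j k_def L_def prev_pos prev_0)
    moreover have "in_dart M (coarc (p, q)) i = opp M (w ! k j)"
      unfolding in_dart_def len j_def[symmetric] using nth[OF \<open>j < L\<close>] by simp
    ultimately show ?thesis using nth[OF that]
      by (simp add: left_side_def out_dart_def ind_eq split: if_splits)
  qed
  have "intersection_number M v (coarc (p, q)) = (\<Sum>i<L. ?h (k i))"
    unfolding intersection_number_boundary_flow len
    by (rule sum.cong) (use assms in \<open>auto simp: left k_def L_def\<close>)
  also have "\<dots> = sum ?h ({..<p} \<union> {q..<N})"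
    by (rule sum.reindex_bij_witness[where i="\<lambda>r. if r < p then r else r + p - q" and j=k])
      (use assms in \<open>auto simp: k_def L_def\<close>)
  also have "\<dots> = sum ?h {..<N}"
    by (rule sum.mono_neutral_left) (use assms in auto)
  finally show ?thesis .
qed

text \<open>
  \<open>Y\<close> contains every crossing once, and the two passages of distinct crossings are distinct.
\<close>

lemma sum_over_crossings:
  fixes h :: "nat \<Rightarrow> int"
  assumes "\<And>r. r < N \<Longrightarrow> (\<And>q. (r, q) \<notin> meetings M w) \<Longrightarrow> h r = 0"
  shows "(\<Sum>r<N. h r) = (\<Sum>y\<in>Y. h (fst y) + h (snd y))"
proof -
  have sub: "fst ` Y \<union> snd ` Y \<subseteq> {..<N}" using Y_meetings meetings_iff by auto
  have snd_m: "(u, s) \<in> meetings M w" if "(s, u) \<in> Y" for s u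
    using that Y_meetings meetings_sym by blast
  have uniq: "s = s' \<and> u = u'" if "(s, u) \<in> Y" "(s', u') \<in> Y" "s = s' \<or> u = u'" for s s' u u'
    using that snd_m[OF that(1)] snd_m[OF that(2)] subsetD[OF Y_meetings that(1)]
      subsetD[OF Y_meetings that(2)] meeting_unique by blast
  have inj: "inj_on fst Y" "inj_on snd Y"
    by (rule inj_onI, metis uniq prod.collapse)+
  have disj: "fst ` Y \<inter> snd ` Y = {}"
  proof (rule ccontr)
    assume "fst ` Y \<inter> snd ` Y \<noteq> {}"
    then obtain r s t where "(r, s) \<in> Y" "(t, r) \<in> Y" by force
    then have "(r, s) \<in> meetings M w" "(r, t) \<in> meetings M w" using Y_meetings snd_m by auto
    then have "s = t" using meeting_unique by blast
    then show False using Y_orients[of r s] \<open>(r, s) \<in> Y\<close> \<open>(t, r) \<in> Y\<close> Y_meetings by blast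
  qed
  have fin: "finite Y"
    by (rule finite_subset[of _ "{..<N} \<times> {..<N}"]) (use sub in auto)
  have "h r = 0" if "r \<in> {..<N} - (fst ` Y \<union> snd ` Y)" for r
  proof (rule assms)
    show "r < N" using that by simp
    fix q show "(r, q) \<notin> meetings M w"
    proof
      assume "(r, q) \<in> meetings M w"
      then have "(r, q) \<in> Y \<or> (q, r) \<in> Y" using Y_orients by blast
      then show False using that by force
    qed
  qed
  then have "sum h {..<N} = sum h (fst ` Y \<union> snd ` Y)"
    by (intro sum.mono_neutral_right) (use sub in auto)
  also have "\<dots> = sum h (fst ` Y) + sum h (snd ` Y)"
    using fin disj by (intro sum.union_disjoint) auto
  also have "\<dots> = (\<Sum>y\<in>Y. h (fst y) + h (snd y))"
    using inj by (simp add: sum.reindex sum.distrib)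
  finally show ?thesis .
qed

lemma sign_positive:
  assumes "y \<in> Y"
  shows "surface_crossing_sign M w y = 1 \<longleftrightarrow> positive (fst y) (snd y)"
  using assms Y_meetings by (auto simp: surface_crossing_sign_def positive_def)

text \<open>
  The order of the passages in \<open>Y\<close> is (over, under); the statement translates it into the order in
  which the second branch runs from right to left.
\<close>

lemma crossing_contribution:
  assumes y: "y \<in> Y"
    and h: "\<And>P Q. positive P Q \<Longrightarrow> {P, Q} = {fst y, snd y} \<Longrightarrow>
      h P + h Q = V Before P * W Before Q - V After Q * W After P"
  shows "h (fst y) + h (snd y) = chord_term (surface_crossing_sign M w y) y V W"
proof (cases "positive (fst y) (snd y)")
  case True
  then show ?thesis using h[OF True] sign_positive[OF y] by (simp add: chord_term_def
      case_prod_beta)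
next
  case False
  have "(fst y, snd y) \<in> meetings M w" using y Y_meetings by auto
  then have "positive (snd y) (fst y)" using positive_swap False by blast
  then show ?thesis using h[of "snd y" "fst y"] sign_positive[OF y] False
    by (simp add: chord_term_def case_prod_beta insert_commute add.commute)
qed

lemma intersection_arc_formula:
  assumes v: "set v \<subseteq> set w" and c: "c \<in> meetings M w"
  shows "intersection_number M v (arc c) =
      (\<Sum>y\<in>Y. chord_term (surface_crossing_sign M w y) y (coeff v) (loop c))" (is ?A)
    and "intersection_number M v (coarc c) =
      (\<Sum>y\<in>Y. chord_term (surface_crossing_sign M w y) y (coeff v) (coloop c))" (is ?B)
proof -
  define p where "p = min (fst c) (snd c)"
  define q where "q = max (fst c) (snd c)"
  have "c = (p, q) \<or> c = (q, p)" unfolding p_def q_def by (cases c) (auto simp: min_def max_def)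
  then have eqs: "arc c = arc (p, q)" "coarc c = coarc (p, q)" "loop c = loop (p, q)"
    "coloop c = coloop (p, q)" and m: "(p, q) \<in> meetings M w" "(q, p) \<in> meetings M w"
    using arc_swap[of p q] loop_swap[of p q] c meetings_sym by (auto simp: coloop_def fun_eq_iff)
  have pq: "0 < p" "p < q" "q < N"
    using meetings_pos[OF m(1)] unfolding p_def q_def by auto
  have other: "P \<noteq> p \<and> P \<noteq> q \<and> Q \<noteq> p \<and> Q \<noteq> q" if "positive P Q" "(P, Q) \<noteq> (p, q)" "(P, Q) \<noteq> (q,
      p)" for P Q
  proof -
    have "(P, Q) \<in> meetings M w" "(Q, P) \<in> meetings M w"
      using that(1) meetings_sym by (auto simp: positive_def)
    then show ?thesis using m meeting_unique that(2,3) by blast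
  qed
  let ?f = "\<lambda>r. boundary_flow v (left_side M w r)"
  let ?h = "\<lambda>r. if r = p then boundary_flow v (sector M (outd p) (ind q))
            else if p < r \<and> r < q then ?f r else 0"
  let ?k = "\<lambda>r. if r = q then boundary_flow v (sector M (outd q) (ind p))
            else if r < p \<or> q < r then ?f r else 0"
  have h: "?h P + ?h Q = coeff v Before P * loop c Before Q - coeff v After Q * loop c After P"
    and k: "?k P + ?k Q = coeff v Before P * coloop c Before Q - coeff v After Q * coloop c After P"
    if pos: "positive P Q" for P Q
  proof -
    note fl = positive_boundary_flow[OF pos v, folded left_side_def]
    let ?goal = "?h P + ?h Q = coeff v Before P * loop c Before Q - coeff v After Q * loop c After
        P \<and>
      ?k P + ?k Q = coeff v Before P * coloop c Before Q - coeff v After Q * coloop c After P"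
    have ?goal if "P = p" "Q = q"
      using pq(2) unfolding eqs that
      by (simp add: fl[unfolded that] loop_simps coloop_def)
    moreover have ?goal if "P = q" "Q = p"
      using pq(2) unfolding eqs that
      by (simp add: fl[unfolded that] loop_simps coloop_def)
    moreover have ?goal if ne: "P \<noteq> p \<and> P \<noteq> q \<and> Q \<noteq> p \<and> Q \<noteq> q"
    proof -
      have "P < p \<or> (p < P \<and> P < q) \<or> q < P" "Q < p \<or> (p < Q \<and> Q < q) \<or> q < Q"
        using ne by auto
      then show ?goal
        using pq(2) unfolding eqs
        by (elim disjE) (simp_all add: fl loop_simps coloop_def)
    qed
    ultimately have ?goal using other[OF pos] by blast
    then show "?h P + ?h Q = coeff v Before P * loop c Before Q - coeff v After Q * loop c After P"
      "?k P + ?k Q = coeff v Before P * coloop c Before Q - coeff v After Q * coloop c After P"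
      by blast+
  qed
  have zero: "?h r = 0" "?k r = 0" if "r < N" "\<And>t. (r, t) \<notin> meetings M w" for r
    using boundary_flow_no_crossing[OF that v] that m by auto
  show ?A
  proof -
    have "intersection_number M v (arc c) = (\<Sum>r<N. ?h r)"
      unfolding eqs(1) intersection_arc[OF pq] ..
    also have "\<dots> = (\<Sum>y\<in>Y. ?h (fst y) + ?h (snd y))"
      by (rule sum_over_crossings) (rule zero(1))
    also have "\<dots> = (\<Sum>y\<in>Y. chord_term (surface_crossing_sign M w y) y (coeff v) (loop c))"
      by (rule sum.cong[OF refl], rule crossing_contribution[where h = ?h], assumption, rule h)
    finally show ?thesis .
  qed
  show ?B
  proof -
    have "intersection_number M v (coarc c) = (\<Sum>r<N. ?k r)"
      unfolding eqs(2) intersection_coarc[OF pq] ..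
    also have "\<dots> = (\<Sum>y\<in>Y. ?k (fst y) + ?k (snd y))"
      by (rule sum_over_crossings) (rule zero(2))
    also have "\<dots> = (\<Sum>y\<in>Y. chord_term (surface_crossing_sign M w y) y (coeff v) (coloop c))"
      by (rule sum.cong[OF refl], rule crossing_contribution[where h = ?k], assumption, rule k)
    finally show ?thesis .
  qed
qed

theorem loop_intersections:
  assumes c: "c \<in> meetings M w" "c' \<in> meetings M w"
  shows "intersection_number M (arc c) (arc c') =
      (\<Sum>y\<in>Y. chord_term (surface_crossing_sign M w y) y (loop c) (loop c'))"
    and "intersection_number M (arc c) (coarc c') =
      (\<Sum>y\<in>Y. chord_term (surface_crossing_sign M w y) y (loop c) (coloop c'))"
    and "intersection_number M (coarc c) (coarc c') =
      (\<Sum>y\<in>Y. chord_term (surface_crossing_sign M w y) y (coloop c) (coloop c'))"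
proof -
  have lt: "fst y < N" "snd y < N" if "y \<in> Y" for y
    using that Y_meetings meetings_iff[of "fst y" "snd y"] by auto
  have *: "chord_term e y V W = chord_term e y V' W'"
    if "y \<in> Y" "\<And>\<delta> t. t < N \<Longrightarrow> V \<delta> t = V' \<delta> t" "\<And>\<delta> t. t < N \<Longrightarrow> W \<delta> t = W' \<delta> t" for e y V V' W W'
    unfolding chord_term_def case_prod_beta using that(2,3) lt[OF that(1)] by simp
  show "intersection_number M (arc c) (arc c') =
      (\<Sum>y\<in>Y. chord_term (surface_crossing_sign M w y) y (loop c) (loop c'))"
    unfolding intersection_arc_formula(1)[OF set_arc(1) c(2)]
    by (rule sum.cong[OF refl], rule *) (simp_all add: coeff_arc c)
  show "intersection_number M (arc c) (coarc c') =
      (\<Sum>y\<in>Y. chord_term (surface_crossing_sign M w y) y (loop c) (coloop c'))"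
    unfolding intersection_arc_formula(2)[OF set_arc(1) c(2)]
    by (rule sum.cong[OF refl], rule *) (simp_all add: coeff_arc c)
  show "intersection_number M (coarc c) (coarc c') =
      (\<Sum>y\<in>Y. chord_term (surface_crossing_sign M w y) y (coloop c) (coloop c'))"
    unfolding intersection_arc_formula(2)[OF set_arc(2) c(2)]
    by (rule sum.cong[OF refl], rule *) (simp_all add: coeff_arc c)
qed

end

section \<open>The pairing of a Gauss diagram\<close>

text \<open>
  Chords are pairs of points on a line, ordered as (over, under).
\<close>

definition chord_diagram :: "('a \<times> 'a) set \<Rightarrow> bool" where
  "chord_diagram C \<longleftrightarrow> finite C \<and> (\<forall>c\<in>C. fst c \<noteq> snd c) \<and>
     (\<forall>c\<in>C. \<forall>d\<in>C. c \<noteq> d \<longrightarrow> {fst c, snd c} \<inter> {fst d, snd d} = {})"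

definition pairing ::
  "('a \<times> 'a) set \<Rightarrow> ('a \<times> 'a \<Rightarrow> int) \<Rightarrow> (side \<Rightarrow> 'a \<Rightarrow> int) \<Rightarrow> (side \<Rightarrow> 'a \<Rightarrow> int) \<Rightarrow> int" where
  "pairing C e v w = (\<Sum>c\<in>C. chord_term (e c) c v w)"

abbreviation diagram_pairing ::
  "lv_diagram \<Rightarrow> (side \<Rightarrow> real \<Rightarrow> int) \<Rightarrow> (side \<Rightarrow> real \<Rightarrow> int) \<Rightarrow> int" where
  "diagram_pairing D \<equiv> pairing (crossings D) (crossing_sign D)"

abbreviation whole :: "side \<Rightarrow> 'a \<Rightarrow> int" where
  "whole \<equiv> \<lambda>_ _. 1"

definition conserved :: "('a \<times> 'a) set \<Rightarrow> (side \<Rightarrow> 'a \<Rightarrow> int) \<Rightarrow> bool" where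
  "conserved C v \<longleftrightarrow>
     (\<forall>c\<in>C. v Before (fst c) + v Before (snd c) = v After (fst c) + v After (snd c))"

lemma chord_diagram_ends:
  assumes "chord_diagram C" "c \<in> C" "d \<in> C" "c \<noteq> d" "t \<in> {fst c, snd c}"
  shows "t \<noteq> fst d" "t \<noteq> snd d"
  using assms unfolding chord_diagram_def by blast+

lemma loop_constant: "t \<noteq> fst c \<Longrightarrow> t \<noteq> snd c \<Longrightarrow> loop c Before t = loop c After t"
  by (auto simp: loop_def)

lemma loop_self:
  assumes "fst c \<noteq> snd c"
  shows "loop c Before (fst c) * loop c Before (snd c) = 0"
    "loop c After (fst c) * loop c After (snd c) = 0"
    "loop c Before (fst c) + loop c Before (snd c) = 1"
    "loop c After (fst c) + loop c After (snd c) = 1"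
  using assms by (auto simp: loop_def)

lemma conserved_loop:
  assumes "chord_diagram C" "c \<in> C"
  shows "conserved C (loop c)"
  unfolding conserved_def
proof
  fix d assume d: "d \<in> C"
  show "loop c Before (fst d) + loop c Before (snd d) = loop c After (fst d) + loop c After (snd d)"
  proof (cases "d = c")
    case True
    then show ?thesis using loop_self[of c] assms by (simp add: chord_diagram_def)
  next
    case False
    have "loop c Before t = loop c After t" if "t \<in> {fst d, snd d}" for t
      by (rule loop_constant) (rule chord_diagram_ends[OF assms(1) d assms(2) False that])+
    then show ?thesis by simp
  qed
qed

lemma conserved_whole: "conserved C whole"
  by (simp add: conserved_def)

text \<open>
  The values of the loop of \<open>c\<close> at the ends of another chord do not jump, so the two products in
  the term of that chord cancel. At \<open>c\<close> itself the loop starts at one end and stops at the other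
  one, so both products are \<open>0\<close>.
\<close>

lemma pairing_loop_self:
  assumes "chord_diagram C" "c \<in> C"
  shows "pairing C e (loop c) (loop c) = 0"
  unfolding pairing_def
proof (rule sum.neutral, rule)
  fix d assume d: "d \<in> C"
  show "chord_term (e d) d (loop c) (loop c) = 0"
  proof (cases "d = c")
    case True
    then show ?thesis using loop_self[of c] assms by (auto simp: chord_diagram_def chord_term_def
        case_prod_beta mult.commute)
  next
    case False
    have "loop c Before t = loop c After t" if "t \<in> {fst d, snd d}" for t
      by (rule loop_constant) (rule chord_diagram_ends[OF assms(1) d assms(2) False that])+
    then show ?thesis by (simp add: chord_term_def case_prod_beta)
  qed
qed

lemma pairing_diff_right: "pairing C e v (\<lambda>\<delta> t. w \<delta> t - w' \<delta> t) = pairing C e v w - pairing C e v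
    w'"
  unfolding pairing_def sum_subtractf[symmetric]
  by (rule sum.cong) (auto simp: chord_term_def case_prod_beta algebra_simps)

lemma pairing_diff_left: "pairing C e (\<lambda>\<delta> t. v \<delta> t - v' \<delta> t) w = pairing C e v w - pairing C e v' w"
  unfolding pairing_def sum_subtractf[symmetric]
  by (rule sum.cong) (auto simp: chord_term_def case_prod_beta algebra_simps)

lemma pairing_whole_whole: "pairing C e whole whole = 0"
  by (simp add: pairing_def chord_term_def case_prod_beta)

text \<open>
  If one of the cycles is the whole knot, the antisymmetry of each single term amounts to the
  conservation of the other cycle.
\<close>

lemma pairing_whole_left:
  assumes "conserved C v"
  shows "pairing C e whole v = - pairing C e v whole"
proof -
  have "chord_term (e c) c whole v = - chord_term (e c) c v whole" if "c \<in> C" for c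
    using assms that by (auto simp: conserved_def chord_term_def case_prod_beta)
  then show ?thesis unfolding pairing_def sum_negf[symmetric] by (intro sum.cong) auto
qed

lemma pairing_coloop:
  assumes "chord_diagram C" "c \<in> C" "d \<in> C"
  shows "pairing C e (loop c) (coloop d) = pairing C e (loop c) whole - pairing C e (loop c) (loop
      d)"
    and "pairing C e (coloop c) (coloop d) =
      pairing C e (loop c) (loop d) - pairing C e (loop c) whole + pairing C e (loop d) whole"
proof -
  have co: "coloop x = (\<lambda>\<delta> t. whole \<delta> t - loop x \<delta> t)" for x :: "'a \<times> 'a"
    by (simp add: coloop_def fun_eq_iff)
  show 1: "pairing C e (loop c) (coloop d) = pairing C e (loop c) whole - pairing C e (loop c)
      (loop d)"
    unfolding co pairing_diff_right ..
  have "pairing C e (coloop c) (coloop d) = pairing C e whole (coloop d) - pairing C e (loop c)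
      (coloop d)"
    unfolding co[of c] pairing_diff_left ..
  also have "pairing C e whole (coloop d) = pairing C e (loop d) whole"
    unfolding co pairing_diff_right using pairing_whole_left[OF conserved_loop[OF assms(1,3)]]
    by (simp add: pairing_whole_whole)
  finally show "pairing C e (coloop c) (coloop d) =
      pairing C e (loop c) (loop d) - pairing C e (loop c) whole + pairing C e (loop d) whole"
    using 1 by simp
qed

lemma loop_strict_mono:
  fixes f :: "'a::linorder \<Rightarrow> 'b::linorder"
  assumes "strict_mono_on X f" "t \<in> X" "fst c \<in> X" "snd c \<in> X"
  shows "loop (map_prod f f c) \<delta> (f t) = loop c \<delta> t"
  using strict_mono_on_less[OF assms(1)] strict_mono_on_less_eq[OF assms(1)] assms(2-)
  by (cases \<delta>) (simp_all add: loop_def)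

lemma chord_term_map:
  "chord_term e (map_prod f f c) v w = chord_term e c (\<lambda>\<delta> t. v \<delta> (f t)) (\<lambda>\<delta> t. w \<delta> (f t))"
  by (simp add: chord_term_def case_prod_beta)

lemma chord_term_cong:
  assumes "\<And>\<delta> t. t \<in> {fst c, snd c} \<Longrightarrow> v \<delta> t = v' \<delta> t" "\<And>\<delta> t. t \<in> {fst c, snd c} \<Longrightarrow> u \<delta> t = u' \<delta> t"
  shows "chord_term e c v u = chord_term e c v' u'"
  using assms by (auto simp: chord_term_def case_prod_beta)

lemma pairing_map:
  assumes "inj_on (map_prod f f) C" "\<And>c. c \<in> C \<Longrightarrow> e' (map_prod f f c) = e c"
    "\<And>c \<delta> t. c \<in> C \<Longrightarrow> t \<in> {fst c, snd c} \<Longrightarrow> v' \<delta> (f t) = v \<delta> t"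
    "\<And>c \<delta> t. c \<in> C \<Longrightarrow> t \<in> {fst c, snd c} \<Longrightarrow> w' \<delta> (f t) = w \<delta> t"
  shows "pairing (map_prod f f ` C) e' v' w' = pairing C e v w"
proof -
  have "pairing (map_prod f f ` C) e' v' w' = (\<Sum>c\<in>C. chord_term (e' (map_prod f f c)) (map_prod f
      f c) v' w')"
    unfolding pairing_def sum.reindex[OF assms(1)] comp_def ..
  also have "\<dots> = pairing C e v w"
    unfolding pairing_def
  proof (rule sum.cong[OF refl])
    fix c assume c: "c \<in> C"
    show "chord_term (e' (map_prod f f c)) (map_prod f f c) v' w' = chord_term (e c) c v w"
      unfolding chord_term_map assms(2)[OF c]
      by (rule chord_term_cong) (rule assms(3)[OF c] assms(4)[OF c], assumption)+
  qed
  finally show ?thesis .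
qed

section \<open>Intersection numbers from the Gauss diagram\<close>

lemma strict_mono_on_inj_prod:
  fixes f :: "'a::linorder \<Rightarrow> 'b::linorder"
  assumes "strict_mono_on (fst ` C \<union> snd ` C) f"
  shows "inj_on (map_prod f f) C"
proof (rule inj_onI)
  fix x y assume xy: "x \<in> C" "y \<in> C" "map_prod f f x = map_prod f f y"
  note inj = inj_onD[OF strict_mono_on_imp_inj_on[OF assms]]
  have "f (fst x) = f (fst y)" "f (snd x) = f (snd y)"
    using xy(3) by (metis fst_map_prod, metis snd_map_prod)
  then have "fst x = fst y" "snd x = snd y"
    using xy(1,2) by (auto intro!: inj)
  then show "x = y" by (rule prod_eqI)
qed

text \<open>
  The pairing depends only on the order of the passages, which \<open>f\<close> preserves.
\<close>

lemma surface_realization_pairing: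
  assumes S: "surface_realization D (M, w, f)" and c: "c \<in> crossings D" "d \<in> crossings D"
  defines "P \<equiv> diagram_pairing D"
  shows "intersection_number M (alpha_path w f c) (alpha_path w f d) = P (loop c) (loop d)"
    and "intersection_number M (alpha_path w f c) (beta_path w f d) = P (loop c) (coloop d)"
    and "intersection_number M (beta_path w f c) (beta_path w f d) = P (coloop c) (coloop d)"
proof -
  define C where "C = crossings D"
  define X where "X = fst ` C \<union> snd ` C"
  have f: "strict_mono_on X f" and k: "surface_knot_diagram M w (map_prod f f ` C)"
    and sg: "\<And>c. c \<in> C \<Longrightarrow> surface_crossing_sign M w (map_prod f f c) = crossing_sign D c"
    using S by (auto simp: surface_realization_def C_def X_def)
  interpret surface_diagram M w "map_prod f f ` C" by unfold_locales (rule k)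
  have ar: "alpha_path w f x = arc (map_prod f f x)" "beta_path w f x = coarc (map_prod f f x)"
      for x
    by (simp_all add: alpha_path_def arc_def beta_path_def coarc_def)
  have lp: "loop (map_prod f f x) \<delta> (f t) = loop x \<delta> t" "coloop (map_prod f f x) \<delta> (f t) = coloop
      x \<delta> t"
    if "x \<in> C" "y \<in> C" "t \<in> {fst y, snd y}" for x y t \<delta>
  proof -
    have "t \<in> X" "fst x \<in> X" "snd x \<in> X" using that by (auto simp: X_def)
    then show "loop (map_prod f f x) \<delta> (f t) = loop x \<delta> t"
      "coloop (map_prod f f x) \<delta> (f t) = coloop x \<delta> t"
      unfolding coloop_def using loop_strict_mono[OF f] by auto
  qed
  have m: "map_prod f f x \<in> meetings M w" if "x \<in> C" for x using that Y_meetings by auto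
  have cC: "c \<in> C" "d \<in> C" using c by (simp_all add: C_def)
  have tr: "(\<Sum>y\<in>map_prod f f ` C. chord_term (surface_crossing_sign M w y) y v' u') = P v u"
    if "\<And>c \<delta> t. c \<in> C \<Longrightarrow> t \<in> {fst c, snd c} \<Longrightarrow> v' \<delta> (f t) = v \<delta> t"
      "\<And>c \<delta> t. c \<in> C \<Longrightarrow> t \<in> {fst c, snd c} \<Longrightarrow> u' \<delta> (f t) = u \<delta> t" for v v' u u'
    unfolding P_def C_def[symmetric]
    using pairing_map[where f = f and C = C and e = "crossing_sign D"
        and e' = "surface_crossing_sign M w" and v = v and v' = v' and w = u and w' = u',
        OF strict_mono_on_inj_prod[OF f[unfolded X_def]] sg that]
    by (simp add: pairing_def)
  show "intersection_number M (alpha_path w f c) (alpha_path w f d) = P (loop c) (loop d)"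
    "intersection_number M (alpha_path w f c) (beta_path w f d) = P (loop c) (coloop d)"
    "intersection_number M (beta_path w f c) (beta_path w f d) = P (coloop c) (coloop d)"
    unfolding ar loop_intersections[OF m[OF cC(1)] m[OF cC(2)]]
    by (rule tr; rule lp[OF cC(1)] lp[OF cC(2)]; assumption)+
qed

section \<open>Existence of surface realizations\<close>

lemma chord_diagram_orient:
  assumes "chord_diagram C"
  shows "chord_diagram ((\<lambda>c. if P c then c else prod.swap c) ` C)"
proof -
  define g where "g c = (if P c then c else prod.swap c)" for c :: "'a \<times> 'a"
  have "{fst (g c), snd (g c)} = {fst c, snd c}" "fst (g c) = snd (g c) \<longleftrightarrow> fst c = snd c" for c
    by (auto simp: g_def)
  note g = this
  have "chord_diagram (g ` C)"
    unfolding chord_diagram_def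
  proof (intro conjI ballI impI)
    show "finite (g ` C)" using assms by (simp add: chord_diagram_def)
  next
    fix c assume "c \<in> g ` C"
    then show "fst c \<noteq> snd c" using assms g(2) by (auto simp: chord_diagram_def)
  next
    fix c d assume "c \<in> g ` C" "d \<in> g ` C" "c \<noteq> d"
    then obtain c' d' where "c' \<in> C" "d' \<in> C" "c = g c'" "d = g d'" "c' \<noteq> d'" by blast
    then show "{fst c, snd c} \<inter> {fst d, snd d} = {}"
      using assms g(1)[of c'] g(1)[of d'] by (simp only: chord_diagram_def) blast
  qed
  then show ?thesis by (simp add: g_def[abs_def])
qed

text \<open>
  The ribbon graph of a Gauss diagram has the chords as vertices of valency 4 and the base point
  as a vertex of valency 2. A pair \<open>(P, Q)\<close> in \<open>Z\<close> means that \<open>Q\<close> crosses \<open>P\<close> from right to left,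
  so counterclockwise around the vertex follow the outgoing darts of \<open>P\<close> and \<open>Q\<close> and then the
  incoming darts of \<open>P\<close> and \<open>Q\<close>.
\<close>

locale gauss_surface =
  fixes Z :: "(nat \<times> nat) set" and N :: nat
  assumes Z: "chord_diagram Z" and N: "0 < N"
    and ends: "fst ` Z \<union> snd ` Z \<subseteq> {1..<N}"
begin

text \<open>
  Passage \<open>k\<close> has the outgoing dart \<open>2 * k\<close> and the incoming dart \<open>2 * k + 1\<close>, so that turning
  around a vertex does not involve the neighbouring passages.
\<close>

definition turn :: "nat \<Rightarrow> nat" where
  "turn d = (let k = d div 2 in
     if k \<in> fst ` Z then 2 * (THE q. (k, q) \<in> Z) + d mod 2
     else if k \<in> snd ` Z then 2 * (THE p. (p, k) \<in> Z) + (1 - d mod 2)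
     else 2 * k + (1 - d mod 2))"

definition flip :: "nat \<Rightarrow> nat" where
  "flip d = (if even d then 2 * ((d div 2 + 1) mod N) + 1 else 2 * ((d div 2 + N - 1) mod N))"

definition surface :: cell_surface where
  "surface = \<lparr>darts = {..<2 * N}, rot = turn, opp = flip\<rparr>"

definition path :: "nat list" where
  "path = map (\<lambda>k. 2 * k) [0..<N]"

lemma Z_unique: "(p, q) \<in> Z \<Longrightarrow> (p, r) \<in> Z \<Longrightarrow> q = r" "(p, q) \<in> Z \<Longrightarrow> (r, q) \<in> Z \<Longrightarrow> p = r"
    "(p, q) \<in> Z \<Longrightarrow> (q, r) \<notin> Z" "(p, q) \<in> Z \<Longrightarrow> p \<noteq> q"
  using Z unfolding chord_diagram_def by fastforce+

lemma Z_less: "(p, q) \<in> Z \<Longrightarrow> 0 < p \<and> p < N \<and> 0 < q \<and> q < N"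
  using ends by force

lemma turn_Z:
  assumes "(p, q) \<in> Z"
  shows "turn (2 * p) = 2 * q" "turn (2 * p + 1) = 2 * q + 1"
    "turn (2 * q) = 2 * p + 1" "turn (2 * q + 1) = 2 * p"
proof -
  have p: "p \<in> fst ` Z" and q: "q \<in> snd ` Z" "q \<notin> fst ` Z"
    using assms Z_unique(3)[OF assms] by force+
  have t: "(THE r. (p, r) \<in> Z) = q" "(THE r. (r, q) \<in> Z) = p"
    using assms Z_unique(1,2) by (auto intro!: the_equality)
  show "turn (2 * p) = 2 * q" "turn (2 * p + 1) = 2 * q + 1"
    "turn (2 * q) = 2 * p + 1" "turn (2 * q + 1) = 2 * p"
    unfolding turn_def using p q t by (simp_all add: Let_def)
qed

lemma turn_other:
  assumes "k \<notin> fst ` Z" "k \<notin> snd ` Z"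
  shows "turn (2 * k) = 2 * k + 1" "turn (2 * k + 1) = 2 * k"
  unfolding turn_def using assms by (simp_all add: Let_def)

lemma passage_cases:
  obtains q where "(k, q) \<in> Z" | p where "(p, k) \<in> Z" | "k \<notin> fst ` Z" "k \<notin> snd ` Z"
  by (metis fst_conv imageE prod.collapse snd_conv)

lemma dart_cases: fixes d :: nat obtains k where "d = 2 * k" | k where "d = 2 * k + 1"
  by (metis evenE oddE)

lemma turn_less: assumes "d < 2 * N" shows "turn d < 2 * N"
proof (cases d rule: dart_cases)
  case (1 k)
  then show ?thesis using assms turn_Z turn_other Z_less
    by (cases k rule: passage_cases) (auto, fastforce+)
next
  case (2 k)
  then show ?thesis using assms turn_Z turn_other Z_less
    by (cases k rule: passage_cases) (auto, fastforce+)
qed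

text \<open>
  Every vertex has valency 4 or 2, so four steps make up one or two full turns.
\<close>

lemma turn_turn: "turn (turn (turn (turn d))) = d"
proof -
  have "turn (turn (turn (turn (2 * k)))) = 2 * k \<and>
      turn (turn (turn (turn (2 * k + 1)))) = 2 * k + 1" for k
  proof (cases k rule: passage_cases)
    case (1 q) then show ?thesis by (simp only: turn_Z[OF 1])
  next
    case (2 p) then show ?thesis by (simp only: turn_Z[OF 2])
  next
    case 3 then show ?thesis by (simp only: turn_other[OF 3])
  qed
  then show ?thesis by (cases d rule: dart_cases) blast+
qed

lemma turn_bij: "bij_betw turn {..<2 * N} {..<2 * N}"
  by (rule bij_betw_byWitness[where f' = "\<lambda>d. turn (turn (turn d))"])
    (auto simp: turn_turn turn_less)

lemma in_to_out: "\<exists>n. (turn ^^ n) (2 * k + 1) = 2 * k" "\<exists>n. (turn ^^ n) (2 * k) = 2 * k + 1"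
proof -
  have one: "(turn ^^ 1) d = turn d" and two: "(turn ^^ 2) d = turn (turn d)" for d
    by (simp_all add: numeral_2_eq_2)
  show "\<exists>n. (turn ^^ n) (2 * k + 1) = 2 * k"
  proof (cases k rule: passage_cases)
    case (1 q) then show ?thesis using two[of "2 * k + 1"] by (metis turn_Z)
  next
    case (2 p) then show ?thesis using two[of "2 * k + 1"] by (metis turn_Z)
  next
    case 3 then show ?thesis using one[of "2 * k + 1"] by (metis turn_other)
  qed
  show "\<exists>n. (turn ^^ n) (2 * k) = 2 * k + 1"
  proof (cases k rule: passage_cases)
    case (1 q) then show ?thesis using two[of "2 * k"] by (metis turn_Z)
  next
    case (2 p) then show ?thesis using two[of "2 * k"] by (metis turn_Z)
  next
    case 3 then show ?thesis using one[of "2 * k"] by (metis turn_other)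
  qed
qed

lemma surface_simps [simp]: "darts surface = {..<2 * N}" "rot surface = turn" "opp surface = flip"
  by (simp_all add: surface_def)

lemma flip_simps: "flip (2 * k) = 2 * ((k + 1) mod N) + 1" "flip (2 * k + 1) = 2 * ((k + N - 1)
    mod N)"
  by (simp_all add: flip_def)

lemma flip_involution:
  assumes "d < 2 * N" shows "flip d < 2 * N" "flip d \<noteq> d" "flip (flip d) = d"
proof -
  have m: "x mod N < N" for x using N by simp
  have parity: "2 * x + 1 \<noteq> 2 * y" "2 * y \<noteq> 2 * x + 1" for x y :: nat by presburger+
  have b: "2 * y + 1 < 2 * N" "2 * y < 2 * N" if "y < N" for y using that by auto
  show "flip d < 2 * N"
    unfolding flip_def by (cases "even d") (simp_all only: if_True if_False b m)
  show "flip d \<noteq> d" 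
  proof (cases d rule: dart_cases)
    case (1 k) then show ?thesis by (simp only: flip_simps parity not_False_eq_True)
  next
    case (2 k) then show ?thesis by (simp only: flip_simps parity not_False_eq_True)
  qed
  show "flip (flip d) = d"
  proof (cases d rule: dart_cases)
    case (1 k)
    then have "k < N" using assms by simp
    then have "((k + 1) mod N + N - 1) mod N = k" by (cases "k + 1 = N") auto
    then show ?thesis unfolding 1 flip_simps by simp
  next
    case (2 k)
    then have "k < N" using assms by simp
    then have "((k + N - 1) mod N + 1) mod N = k" by (cases k) (auto simp: mod_if)
    then show ?thesis unfolding 2 flip_simps by simp
  qed
qed

abbreviation "step \<equiv> {(x, y). x \<in> darts surface \<and> (y = rot surface x \<or> y = opp surface x)}"

lemma step_turn: "(d, e) \<in> step\<^sup>*" if "(turn ^^ n) d = e" "d < 2 * N"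
proof -
  have "(d, (turn ^^ n) d) \<in> step\<^sup>* \<and> (turn ^^ n) d < 2 * N"
  proof (induction n)
    case 0 then show ?case using that by simp
  next
    case (Suc n)
    then have "((turn ^^ n) d, turn ((turn ^^ n) d)) \<in> step" by simp
    then show ?case using Suc by (auto intro: rtrancl_into_rtrancl simp: turn_less)
  qed
  then show ?thesis using that by simp
qed

lemma step_in_out: assumes "k < N" shows "(2 * k + 1, 2 * k) \<in> step\<^sup>*" "(2 * k, 2 * k + 1) \<in> step\<^sup>*"
proof -
  obtain n m where "(turn ^^ n) (2 * k + 1) = 2 * k" "(turn ^^ m) (2 * k) = 2 * k + 1"
    using in_to_out by blast
  then show "(2 * k + 1, 2 * k) \<in> step\<^sup>*" "(2 * k, 2 * k + 1) \<in> step\<^sup>*"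
    using step_turn[of n "2 * k + 1" "2 * k"] step_turn[of m "2 * k" "2 * k + 1"] assms by simp_all
qed

lemma step_flip: "d < 2 * N \<Longrightarrow> (d, flip d) \<in> step"
  by simp

text \<open>
  The knot itself connects all vertices.
\<close>

lemma connected_to_base: assumes "k < N" shows "(0, 2 * k) \<in> step\<^sup>* \<and> (2 * k, 0) \<in> step\<^sup>*"
  using assms
proof (induction k)
  case 0 then show ?case by simp
next
  case (Suc k)
  then have IH: "(0, 2 * k) \<in> step\<^sup>*" "(2 * k, 0) \<in> step\<^sup>*" and k: "k < N" by auto
  have "flip (2 * k) = 2 * Suc k + 1" "flip (2 * Suc k + 1) = 2 * k"
    using Suc.prems by (simp_all only: flip_simps) (simp_all add: mod_if)
  then have "(2 * k, 2 * Suc k + 1) \<in> step" "(2 * Suc k + 1, 2 * k) \<in> step"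
    using step_flip[of "2 * k"] step_flip[of "2 * Suc k + 1"] Suc.prems by simp_all
  then show ?case
    using IH step_in_out[OF Suc.prems] by (meson rtrancl.rtrancl_into_rtrancl rtrancl_trans)
qed

lemma dart_connected: assumes "d < 2 * N" shows "(0, d) \<in> step\<^sup>*" "(d, 0) \<in> step\<^sup>*"
proof -
  have "(0, d) \<in> step\<^sup>* \<and> (d, 0) \<in> step\<^sup>*"
  proof (cases d rule: dart_cases)
    case (1 k) then show ?thesis using connected_to_base assms by simp
  next
    case (2 k)
    then have "k < N" using assms by simp
    then show ?thesis using connected_to_base[of k] step_in_out[of k] 2 by (meson rtrancl_trans)
  qed
  then show "(0, d) \<in> step\<^sup>*" "(d, 0) \<in> step\<^sup>*" by auto
qed

lemma closed: "closed_surface surface"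
  unfolding closed_surface_def
proof (intro conjI ballI)
  show "finite (darts surface)" by simp
  have "0 \<in> {..<2 * N}" using N by simp
  then show "darts surface \<noteq> {}" by (metis empty_iff surface_simps(1))
  show "bij_betw (rot surface) (darts surface) (darts surface)" using turn_bij by simp
next
  fix d assume "d \<in> darts surface"
  then show "opp surface d \<in> darts surface" "opp surface d \<noteq> d" "opp surface (opp surface d) = d"
    using flip_involution[of d] by auto
next
  fix d e assume "d \<in> darts surface" "e \<in> darts surface"
  then show "(d, e) \<in> step\<^sup>*" using dart_connected[of d] dart_connected[of e] by (auto intro:
      rtrancl_trans)
qed

lemma length_path: "length path = N"
  by (simp add: path_def)

lemma out_path: "k < N \<Longrightarrow> out_dart path k = 2 * k"
  by (simp add: out_dart_def path_def)

lemma in_path: assumes "k < N" shows "in_dart surface path k = 2 * k + 1"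
proof -
  have "((k + N - 1) mod N + 1) mod N = k" using assms by (cases k) (auto simp: mod_if)
  moreover have "path ! ((k + N - 1) mod N) = 2 * ((k + N - 1) mod N)"
    using N by (simp add: path_def)
  ultimately show ?thesis
    unfolding in_dart_def length_path by (simp only: surface_simps flip_simps)
qed

lemma path_closed: "closed_path surface path"
  unfolding closed_path_def
proof (intro conjI allI impI)
  show "path \<noteq> []" using N by (simp add: path_def)
  show "set path \<subseteq> darts surface" by (auto simp: path_def)
  fix p assume "p < length path"
  then show "same_vertex surface (in_dart surface path p) (out_dart path p)"
    using in_to_out(1)[of p] by (simp add: same_vertex_def length_path in_path out_path)
qed

lemma vertex_Z:
  assumes "(p, q) \<in> Z" "d \<in> {2 * p, 2 * p + 1, 2 * q, 2 * q + 1}"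
  shows "(turn ^^ n) d \<in> {2 * p, 2 * p + 1, 2 * q, 2 * q + 1}"
  using assms(2) turn_Z[OF assms(1)] by (induction n) auto

lemma vertex_other:
  assumes "k \<notin> fst ` Z" "k \<notin> snd ` Z"
  shows "(turn ^^ n) (2 * k) \<in> {2 * k, 2 * k + 1}"
  using turn_other[OF assms] by (induction n) auto

lemma meetings_path: "meetings surface path = Z \<union> Z\<inverse>"
proof (intro set_eqI iffI)
  fix x assume "x \<in> meetings surface path"
  then obtain p q where x: "x = (p, q)" "p < N" "q < N" "p \<noteq> q"
    "same_vertex surface (2 * p) (2 * q)"
    by (auto simp: meetings_def length_path out_path)
  then obtain n where n: "(turn ^^ n) (2 * p) = 2 * q" by (auto simp: same_vertex_def)
  show "x \<in> Z \<union> Z\<inverse>"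
  proof (cases p rule: passage_cases)
    case (1 r)
    then have "q = r" using vertex_Z[OF 1, of "2 * p" n] n x(4) by (auto; presburger)
    then show ?thesis using 1 x by simp
  next
    case (2 r)
    then have "q = r" using vertex_Z[OF 2, of "2 * p" n] n x(4) by (auto; presburger)
    then show ?thesis using 2 x by simp
  next
    case 3
    then have "q = p" using vertex_other[OF 3, of n] n by (auto; presburger)
    then show ?thesis using x by simp
  qed
next
  fix x assume "x \<in> Z \<union> Z\<inverse>"
  then obtain p q where x: "x = (p, q)" "(p, q) \<in> Z \<or> (q, p) \<in> Z" by (cases x) auto
  have "(turn ^^ 1) (2 * p) = 2 * q" if "(p, q) \<in> Z" using turn_Z[OF that] by simp
  moreover have "(turn ^^ 3) (2 * p) = 2 * q" if "(q, p) \<in> Z"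
    using turn_Z[OF that] by (simp add: numeral_3_eq_3)
  ultimately have "same_vertex surface (2 * p) (2 * q)"
    using x(2) unfolding same_vertex_def surface_simps by blast
  moreover have "p < N" "q < N" "p \<noteq> q" using x(2) Z_less Z_unique(4) by blast+
  ultimately show "x \<in> meetings surface path"
    by (simp add: x(1) meetings_def length_path out_path)
qed

lemma sector_single:
  assumes "rot M d = x" "rot M x = e" "x \<noteq> e"
  shows "sector M d e = {x}"
proof (intro set_eqI iffI)
  fix y assume "y \<in> sector M d e"
  then obtain i where i: "i > 0" "y = (rot M ^^ i) d" "\<And>j. 0 < j \<and> j \<le> i \<Longrightarrow> (rot M ^^ j) d \<noteq> e"
    by (auto simp: sector_def)
  have "(rot M ^^ 2) d = e" using assms by (simp add: numeral_2_eq_2)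
  then have "i = 1" using i(1) i(3)[of 2] by (cases "i \<ge> 2") auto
  then show "y \<in> {x}" using i(2) assms by simp
next
  fix y assume "y \<in> {x}"
  then show "y \<in> sector M d e"
    unfolding sector_def using assms by (auto intro!: exI[of _ 1] simp: le_Suc_eq)
qed

lemma left_side_path:
  assumes "(p, q) \<in> Z"
  shows "left_side surface path p = {2 * q}" "left_side surface path q = {2 * p + 1}"
proof -
  have pq: "p < N" "q < N" using Z_less[OF assms] by auto
  have "sector surface (2 * p) (2 * p + 1) = {2 * q}"
  proof (rule sector_single)
    show "2 * q \<noteq> 2 * p + 1" by presburger
  qed (simp_all only: surface_simps turn_Z[OF assms])
  then show "left_side surface path p = {2 * q}"
    using pq by (simp add: left_side_def out_path in_path)
  have "sector surface (2 * q) (2 * q + 1) = {2 * p + 1}"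
  proof (rule sector_single)
    show "2 * p + 1 \<noteq> 2 * q + 1" using Z_unique(4)[OF assms] by simp
  qed (simp_all only: surface_simps turn_Z[OF assms])
  then show "left_side surface path q = {2 * p + 1}"
    using pq by (simp add: left_side_def out_path in_path)
qed

lemma knot_diagram:
  assumes "Y \<subseteq> Z \<union> Z\<inverse>" "\<And>p q. (p, q) \<in> Z \<Longrightarrow> ((p, q) \<in> Y) \<noteq> ((q, p) \<in> Y)"
  shows "surface_knot_diagram surface path Y"
  unfolding surface_knot_diagram_def
proof (intro conjI)
  show "\<forall>d\<in>set path. opp surface d \<notin> set path"
  proof
    fix d assume "d \<in> set path"
    then obtain k where "d = 2 * k" by (auto simp: path_def)
    then have "odd (opp surface d)" by (simp add: flip_def)
    then show "opp surface d \<notin> set path" by (auto simp: path_def)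
  qed
  show "\<forall>p q r. (p, q) \<in> meetings surface path \<and> (p, r) \<in> meetings surface path \<longrightarrow> q = r"
    unfolding meetings_path using Z_unique by blast
  have "(2 * q \<in> left_side surface path p) \<noteq> (2 * q + 1 \<in> left_side surface path p)"
    if "(p, q) \<in> Z \<or> (q, p) \<in> Z" for p q
    using that
  proof
    assume "(p, q) \<in> Z" then show ?thesis by (simp add: left_side_path)
  next
    assume "(q, p) \<in> Z" then show ?thesis by (simp add: left_side_path)
  qed
  then show "\<forall>(p, q)\<in>meetings surface path.
      (out_dart path q \<in> left_side surface path p) \<noteq> (in_dart surface path q \<in> left_side surface
          path p)"
    unfolding meetings_path using Z_less by (auto simp: out_path in_path)
  show "\<forall>q. (0, q) \<notin> meetings surface path"
    unfolding meetings_path using Z_less by blast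
  show "Y \<subseteq> meetings surface path" using assms(1) meetings_path by simp
  show "\<forall>(p, q)\<in>meetings surface path. ((p, q) \<in> Y) \<noteq> ((q, p) \<in> Y)"
    unfolding meetings_path using assms(2) by blast
qed (use closed path_closed in \<open>auto simp: path_def distinct_map inj_on_def\<close>)

lemma crossing_sign_path:
  assumes "(p, q) \<in> Z"
  shows "surface_crossing_sign surface path (p, q) = 1" "surface_crossing_sign surface path (q, p)
      = - 1"
proof -
  have "p < N" "q < N" using Z_less[OF assms] by auto
  moreover have "2 * p \<noteq> Suc (2 * p)" by presburger
  ultimately show "surface_crossing_sign surface path (p, q) = 1"
    "surface_crossing_sign surface path (q, p) = - 1"
    by (simp_all add: surface_crossing_sign_def left_side_path[OF assms] out_path)
qed

end

lemma strict_mono_rank: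
  fixes X :: "'a::linorder set"
  assumes "finite X"
  shows "strict_mono_on X (\<lambda>t. card {x\<in>X. x \<le> t})"
    and "t \<in> X \<Longrightarrow> card {x\<in>X. x \<le> t} \<in> {1..card X}"
proof -
  show "strict_mono_on X (\<lambda>t. card {x\<in>X. x \<le> t})"
  proof (rule strict_mono_onI)
    fix r s assume "r \<in> X" "s \<in> X" "r < s"
    then have "{x\<in>X. x \<le> r} \<subseteq> {x\<in>X. x \<le> s}" "s \<in> {x\<in>X. x \<le> s}" "s \<notin> {x\<in>X. x \<le> r}" by auto
    then have "{x\<in>X. x \<le> r} \<subset> {x\<in>X. x \<le> s}" by blast
    then show "card {x\<in>X. x \<le> r} < card {x\<in>X. x \<le> s}"
      using assms by (intro psubset_card_mono) auto
  qed
  assume t: "t \<in> X"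
  then have "card {x\<in>X. x \<le> t} > 0" using assms by (auto simp: card_gt_0_iff)
  moreover have "card {x\<in>X. x \<le> t} \<le> card X" using assms by (intro card_mono) auto
  ultimately show "card {x\<in>X. x \<le> t} \<in> {1..card X}" by simp
qed

lemma chord_diagram_map:
  assumes "chord_diagram C" "inj_on f (fst ` C \<union> snd ` C)"
  shows "chord_diagram (map_prod f f ` C)"
proof -
  have eq: "f s = f t \<longleftrightarrow> s = t" if "c \<in> C" "d \<in> C" "s \<in> {fst c, snd c}" "t \<in> {fst d, snd d}" for c
      d s t
    by (rule inj_on_eq_iff[OF assms(2)]) (use that in auto)
  show ?thesis
    unfolding chord_diagram_def
  proof (intro conjI ballI impI)
    show "finite (map_prod f f ` C)" using assms(1) by (simp add: chord_diagram_def)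
  next
    fix c assume "c \<in> map_prod f f ` C"
    then obtain c0 where c: "c0 \<in> C" "c = map_prod f f c0" by (rule imageE)
    then have "fst c0 \<noteq> snd c0" using assms(1) unfolding chord_diagram_def by blast
    then show "fst c \<noteq> snd c" using eq[OF c(1) c(1), of "fst c0" "snd c0"] c by simp
  next
    fix c d assume "c \<in> map_prod f f ` C" "d \<in> map_prod f f ` C" "c \<noteq> d"
    obtain c0 d0 where c: "c0 \<in> C" "c = map_prod f f c0" "d0 \<in> C" "d = map_prod f f d0"
      using \<open>c \<in> _\<close> \<open>d \<in> _\<close> by (elim imageE)
    moreover from this have "c0 \<noteq> d0" using \<open>c \<noteq> d\<close> by metis
    ultimately have "{fst c0, snd c0} \<inter> {fst d0, snd d0} = {}" using assms(1) unfolding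
        chord_diagram_def by blast
    then show "{fst c, snd c} \<inter> {fst d, snd d} = {}"
      using eq[OF c(1,3), of "fst c0" "fst d0"] eq[OF c(1,3), of "fst c0" "snd d0"]
        eq[OF c(1,3), of "snd c0" "fst d0"] eq[OF c(1,3), of "snd c0" "snd d0"] c
      by (simp, metis)
  qed
qed

text \<open>
  Number the ends of the chords by \<open>1, 2, \<dots>\<close> in their order on the line; \<open>0\<close> is the base point.
\<close>

lemma surface_realization_exists:
  assumes "chord_diagram (crossings D)"
  shows "\<exists>S. surface_realization D S"
proof -
  define C where "C = crossings D"
  define X where "X = fst ` C \<union> snd ` C"
  define f where "f t = card {x\<in>X. x \<le> t}" for t
  have C: "chord_diagram C" and fX: "finite X"
    using assms by (auto simp: C_def X_def chord_diagram_def)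
  have f: "strict_mono_on X f" "\<And>t. t \<in> X \<Longrightarrow> f t \<in> {1..card X}"
    using strict_mono_rank[OF fX] unfolding f_def[abs_def] by blast+
  have inj: "inj_on f X" using f(1) by (rule strict_mono_on_imp_inj_on)
  \<comment> \<open>in each pair of \<open>Z\<close> the second passage crosses the first one from right to left\<close>
  define r where "r c = (if crossing_sign D c = 1 then map_prod f f c else prod.swap (map_prod f f
      c))" for c
  define Z where "Z = r ` C"
  have Z1: "chord_diagram (map_prod f f ` C)"
    using chord_diagram_map[OF C] inj by (simp add: X_def)
  have injC: "inj_on (map_prod f f) C" using strict_mono_on_inj_prod f(1) by (simp add: X_def)
  have "Z = (\<lambda>y. if crossing_sign D (inv_into C (map_prod f f) y) = 1 then y else prod.swap y) `
      (map_prod f f ` C)"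
    unfolding Z_def image_image r_def by (rule image_cong) (simp_all add: inv_into_f_f[OF injC])
  then have Z: "chord_diagram Z" using chord_diagram_orient[OF Z1] by simp
  have ends: "fst ` Z \<union> snd ` Z \<subseteq> {1..<card X + 1}"
  proof -
    have "f (fst c) \<in> {1..<card X + 1} \<and> f (snd c) \<in> {1..<card X + 1}" if "c \<in> C" for c
      using f(2)[of "fst c"] f(2)[of "snd c"] that by (auto simp: X_def)
    then show ?thesis by (auto simp: Z_def r_def)
  qed
  interpret gauss_surface Z "card X + 1"
    by unfold_locales (use Z ends in auto)
  have zc: "(map_prod f f c \<in> Z \<and> crossing_sign D c = 1) \<or> (prod.swap (map_prod f f c) \<in> Z \<and>
      crossing_sign D c = - 1)"
    if "c \<in> C" for c
  proof -
    have "r c \<in> Z" using that by (simp add: Z_def)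
    then show ?thesis unfolding r_def by (auto simp: crossing_sign_def split: if_splits)
  qed
  have zc': "\<exists>c\<in>C. z = map_prod f f c \<or> prod.swap z = map_prod f f c" if "z \<in> Z" for z
  proof -
    obtain c where "c \<in> C" "z = r c" using \<open>z \<in> Z\<close> unfolding Z_def by blast
    then show ?thesis by (intro bexI[of _ c]) (auto simp: r_def)
  qed
  have "surface_knot_diagram surface path (map_prod f f ` C)"
  proof (rule knot_diagram)
    show "map_prod f f ` C \<subseteq> Z \<union> Z\<inverse>"
      using zc by fastforce
    fix p q assume pq: "(p, q) \<in> Z"
    have "\<not> ((p, q) \<in> map_prod f f ` C \<and> (q, p) \<in> map_prod f f ` C)"
    proof
      assume A: "(p, q) \<in> map_prod f f ` C \<and> (q, p) \<in> map_prod f f ` C"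
      have "(p, q) \<noteq> (q, p)" using Z_unique(4)[OF pq] by simp
      then have "p \<noteq> fst (q, p)" "p \<noteq> snd (q, p)"
        using chord_diagram_ends[OF Z1, of "(p, q)" "(q, p)" p] A by auto
      then show False by simp
    qed
    then show "((p, q) \<in> map_prod f f ` C) \<noteq> ((q, p) \<in> map_prod f f ` C)"
      using zc'[OF pq] by auto
  qed
  moreover have "surface_crossing_sign surface path (map_prod f f c) = crossing_sign D c" if "c \<in>
      C" for c
    using zc[OF that] crossing_sign_path[of "f (fst c)" "f (snd c)"] crossing_sign_path[of "f (snd
        c)" "f (fst c)"]
    by (cases c) auto
  ultimately have "surface_realization D (surface, path, f)"
    using f(1) by (simp add: surface_realization_def C_def X_def)
  then show ?thesis by blast
qed

text \<open>
  The chosen realization is as good as any other one.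
\<close>

theorem intersection_numbers_gauss:
  assumes C: "chord_diagram (crossings D)" and c: "c \<in> crossings D" "d \<in> crossings D"
  defines "P \<equiv> diagram_pairing D"
  shows "alpha_alpha D c d = P (loop c) (loop d)"
    "alpha_beta D c d = P (loop c) whole - P (loop c) (loop d)"
    "beta_beta D c d = P (loop c) (loop d) - P (loop c) whole + P (loop d) whole"
proof -
  obtain M w f where S: "realization D = (M, w, f)" by (metis prod_cases3)
  then have "surface_realization D (M, w, f)"
    using surface_realization_exists[OF C] someI_ex[of "surface_realization D"] by (simp add:
        realization_def)
  note R = surface_realization_pairing[OF this c, folded P_def]
  show "alpha_alpha D c d = P (loop c) (loop d)"
    "alpha_beta D c d = P (loop c) whole - P (loop c) (loop d)"
    "beta_beta D c d = P (loop c) (loop d) - P (loop c) whole + P (loop d) whole"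
    unfolding alpha_alpha_def alpha_beta_def beta_beta_def S
    using R pairing_coloop[OF C c, of "crossing_sign D", folded P_def] by simp_all
qed

section \<open>The polynomials as sums over chords\<close>

definition index :: "lv_diagram \<Rightarrow> real \<times> real \<Rightarrow> int" where
  "index D c = diagram_pairing D (loop c) whole"

definition linking :: "lv_diagram \<Rightarrow> real \<times> real \<Rightarrow> real \<times> real \<Rightarrow> int" where
  "linking D c d = diagram_pairing D (loop c) (loop d)"

definition chord_sum :: "nat \<Rightarrow> lv_diagram \<Rightarrow> (int \<Rightarrow> laurent_poly) \<Rightarrow> laurent_poly" where
  "chord_sum a D \<psi> = (\<Sum>i\<in>crossings_of_type a D. of_int (crossing_sign D i) * \<psi> (index D i))"

definition chord_pair_sum ::
  "nat \<Rightarrow> nat \<Rightarrow> lv_diagram \<Rightarrow> (int \<Rightarrow> int \<Rightarrow> int \<Rightarrow> laurent_poly) \<Rightarrow> laurent_poly" where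
  "chord_pair_sum a b D \<phi> = (\<Sum>i\<in>crossings_of_type a D. \<Sum>j\<in>crossings_of_type b D.
     of_int (crossing_sign D i * crossing_sign D j) * \<phi> (index D i) (index D j) (linking D i j))"

lemma crossings_of_type_subset: "crossings_of_type a D \<subseteq> crossings D"
  by (auto simp: crossings_of_type_def)

lemma tpow_0: "tpow 0 = 1" by (simp add: tpow_def)

lemma tpow_add: "tpow (m + n) = tpow m * tpow n"
  by (simp add: tpow_def mult_single)

lemma W_diagram_chord_sum:
  assumes "chord_diagram (crossings D)"
  shows "W_diagram a D = chord_sum a D (\<lambda>n. tpow n - 1)"
  unfolding W_diagram_def chord_sum_def
proof (rule sum.cong[OF refl])
  fix i assume "i \<in> crossings_of_type a D"
  then have i: "i \<in> crossings D" using crossings_of_type_subset by blast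
  have "alpha_beta D i i = index D i"
    using intersection_numbers_gauss(2)[OF assms i i] pairing_loop_self[OF assms i]
    by (simp add: index_def)
  then show "of_int (crossing_sign D i) * (tpow (alpha_beta D i i) - 1) =
      of_int (crossing_sign D i) * (tpow (index D i) - 1)" by simp
qed

lemma F_diagram_chord_pair_sum:
  assumes "chord_diagram (crossings D)"
  shows "F_diagram a b D = chord_pair_sum a b D (\<lambda>m n l. tpow l - 1)"
  unfolding F_diagram_def chord_pair_sum_def linking_def
  by (intro sum.cong refl)
    (simp add: intersection_numbers_gauss(1)[OF assms] subsetD[OF crossings_of_type_subset])

text \<open>
  The product of the writhe and \<open>W\<close> is itself a sum over pairs of chords.
\<close>

lemma G_diagram_chord_pair_sum:
  assumes "chord_diagram (crossings D)"
  shows "G_diagram a b D = chord_pair_sum a b D (\<lambda>m n l. tpow (m - l) - tpow m)"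
proof -
  let ?e = "\<lambda>i. of_int (crossing_sign D i) :: laurent_poly"
  let ?A = "crossings_of_type a D" and ?B = "crossings_of_type b D"
  have 1: "of_int (writhe b D) * W_diagram a D = (\<Sum>i\<in>?A. \<Sum>j\<in>?B. ?e i * ?e j * (tpow (index D i) -
      1))"
    unfolding W_diagram_chord_sum[OF assms] chord_sum_def writhe_def of_int_sum sum_product
    by (subst sum.swap) (simp add: ac_simps)
  have 2: "(\<Sum>i\<in>?A. \<Sum>j\<in>?B. of_int (crossing_sign D i * crossing_sign D j) * (tpow (alpha_beta D i
      j) - 1))
      = (\<Sum>i\<in>?A. \<Sum>j\<in>?B. ?e i * ?e j * (tpow (index D i - linking D i j) - 1))"
    by (intro sum.cong refl)
      (simp add: intersection_numbers_gauss(2)[OF assms] subsetD[OF crossings_of_type_subset]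
          linking_def index_def)
  show ?thesis
    unfolding G_diagram_def 1 2 chord_pair_sum_def sum_subtractf[symmetric]
    by (intro sum.cong refl) (simp add: algebra_simps)
qed

lemma invert_t_plus: "invert_t (p + q) = invert_t p + invert_t q"
  unfolding invert_t_def by (rule map_key_plus) (simp add: inj_def)

lemma invert_t_single: "invert_t (Poly_Mapping.single n c) = Poly_Mapping.single (- n) c"
proof -
  have "Poly_Mapping.single n c = Poly_Mapping.single (- (- n)) c" by simp
  then show ?thesis unfolding invert_t_def
    using map_key_single[of "uminus :: int \<Rightarrow> int" "- n" c] by (simp add: inj_def)
qed

lemma invert_t_tpow: "invert_t (tpow n) = tpow (- n)"
  by (simp add: tpow_def invert_t_single)

lemma invert_t_uminus: "invert_t (- p) = - invert_t p"
proof -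
  have "invert_t (p + - p) = 0" by (simp add: invert_t_def)
  then show ?thesis unfolding invert_t_plus by (simp add: eq_neg_iff_add_eq_0 add.commute)
qed

lemma invert_t_minus: "invert_t (p - q) = invert_t p - invert_t q"
  using invert_t_plus[of p "- q"] by (simp add: invert_t_uminus)

lemma invert_t_0: "invert_t 0 = 0"
  by (simp add: invert_t_def)

lemma invert_t_1: "invert_t 1 = 1"
  using invert_t_tpow[of 0] by (simp add: tpow_0)

lemma invert_t_sum: "invert_t (\<Sum>x\<in>A. f x) = (\<Sum>x\<in>A. invert_t (f x))"
  by (induction A rule: infinite_finite_induct) (simp_all add: invert_t_0 invert_t_plus)

lemma crossing_sign_cases: "crossing_sign D c = 1 \<or> crossing_sign D c = - 1"
  by (simp add: crossing_sign_def)

lemma invert_t_chord_sum: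
  "invert_t (chord_sum a D (\<lambda>n. tpow n - 1)) = chord_sum a D (\<lambda>n. tpow (- n) - 1)"
  unfolding chord_sum_def invert_t_sum
proof (rule sum.cong[OF refl])
  fix i
  show "invert_t (of_int (crossing_sign D i) * (tpow (index D i) - 1)) =
      of_int (crossing_sign D i) * (tpow (- index D i) - 1)"
    using crossing_sign_cases[of D i]
    by (elim disjE) (simp_all add: invert_t_minus invert_t_tpow invert_t_1)
qed

lemma H_diagram_chord_pair_sum:
  assumes "chord_diagram (crossings D)"
  shows "H_diagram a b D =
    chord_pair_sum a b D (\<lambda>m n l. tpow (l - m + n) - tpow n - tpow (- m) + 1)"
proof -
  let ?e = "\<lambda>i. of_int (crossing_sign D i) :: laurent_poly"
  let ?A = "crossings_of_type a D" and ?B = "crossings_of_type b D"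
  have 0: "of_int (writhe a D) * W_diagram b D = (\<Sum>i\<in>?A. \<Sum>j\<in>?B. ?e i * ?e j * (tpow (index D j) -
      1))"
    unfolding W_diagram_chord_sum[OF assms] chord_sum_def writhe_def of_int_sum sum_product
    by (simp add: ac_simps)
  have 1: "of_int (writhe b D) * invert_t (W_diagram a D) =
      (\<Sum>i\<in>?A. \<Sum>j\<in>?B. ?e i * ?e j * (tpow (- index D i) - 1))"
    unfolding W_diagram_chord_sum[OF assms] invert_t_chord_sum
    unfolding chord_sum_def writhe_def of_int_sum sum_product
    by (subst sum.swap) (simp add: ac_simps)
  have 2: "(\<Sum>i\<in>?A. \<Sum>j\<in>?B. of_int (crossing_sign D i * crossing_sign D j) * (tpow (beta_beta D i j)
      - 1))
      = (\<Sum>i\<in>?A. \<Sum>j\<in>?B. ?e i * ?e j * (tpow (linking D i j - index D i + index D j) - 1))"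
    by (intro sum.cong refl)
      (simp add: intersection_numbers_gauss(3)[OF assms] subsetD[OF crossings_of_type_subset]
          linking_def index_def)
  show ?thesis
    unfolding H_diagram_def 0 1 2 chord_pair_sum_def sum_subtractf[symmetric]
    by (intro sum.cong refl) (simp add: algebra_simps)
qed

section \<open>Comparing diagrams\<close>

text \<open>
  A chord with index 0 that is linked with no chord does not contribute to the sums over functions
  that satisfy the two conditions below.
\<close>

definition same_chord_sums :: "lv_diagram \<Rightarrow> lv_diagram \<Rightarrow> bool" where
  "same_chord_sums D E \<longleftrightarrow>
     (\<forall>a \<psi>. \<psi> 0 = 0 \<longrightarrow> chord_sum a D \<psi> = chord_sum a E \<psi>) \<and>
     (\<forall>a b \<phi>. (\<forall>n. \<phi> 0 n 0 = 0 \<and> \<phi> n 0 0 = 0) \<longrightarrow> chord_pair_sum a b D \<phi> = chord_pair_sum a b E \<phi>)"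

lemma same_chord_sums_polynomials:
  assumes "chord_diagram (crossings D)" "chord_diagram (crossings E)" "same_chord_sums D E"
  shows "W_diagram a D = W_diagram a E" "F_diagram a b D = F_diagram a b E"
    "G_diagram a b D = G_diagram a b E" "H_diagram a b D = H_diagram a b E"
  using assms(3)
  by (simp_all add: W_diagram_chord_sum F_diagram_chord_pair_sum G_diagram_chord_pair_sum
      H_diagram_chord_pair_sum assms same_chord_sums_def tpow_0)

lemma same_chord_sums_bij:
  assumes h: "bij_betw h (crossings D) (crossings E)"
    and ty: "\<And>c. c \<in> crossings D \<Longrightarrow> crossing_type (h c) = crossing_type c"
    and sg: "\<And>c. c \<in> crossings D \<Longrightarrow> crossing_sign E (h c) = crossing_sign D c"
    and ix: "\<And>c. c \<in> crossings D \<Longrightarrow> index E (h c) = index D c"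
    and lk: "\<And>c d. c \<in> crossings D \<Longrightarrow> d \<in> crossings D \<Longrightarrow> linking E (h c) (h d) = linking D c d"
  shows "same_chord_sums D E"
proof -
  have b: "bij_betw h (crossings_of_type a D) (crossings_of_type a E)" for a
  proof (rule bij_betw_subset[OF h])
    show "h ` crossings_of_type a D = crossings_of_type a E"
    proof (intro set_eqI iffI)
      fix x assume "x \<in> h ` crossings_of_type a D"
      then obtain c where "c \<in> crossings_of_type a D" "x = h c" by (rule imageE)
      then show "x \<in> crossings_of_type a E"
        using bij_betwE[OF h] ty[of c] by (simp add: crossings_of_type_def)
    next
      fix x assume x: "x \<in> crossings_of_type a E"
      then have "x \<in> h ` crossings D" using h by (simp add: crossings_of_type_def bij_betw_def)
      then obtain c where "c \<in> crossings D" "x = h c" by (rule imageE)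
      then show "x \<in> h ` crossings_of_type a D"
        using x ty[of c] by (intro image_eqI[of _ _ c]) (simp_all add: crossings_of_type_def)
    qed
  qed (rule crossings_of_type_subset)
  have "chord_sum a E \<psi> = chord_sum a D \<psi>" for a \<psi>
    unfolding chord_sum_def sum.reindex_bij_betw[OF b, symmetric]
    by (intro sum.cong refl) (simp add: sg ix subsetD[OF crossings_of_type_subset])
  moreover have "chord_pair_sum a b E \<phi> = chord_pair_sum a b D \<phi>" for a b \<phi>
    unfolding chord_pair_sum_def sum.reindex_bij_betw[OF b, symmetric]
    by (intro sum.cong refl) (simp add: sg ix lk subsetD[OF crossings_of_type_subset])
  ultimately show ?thesis by (simp add: same_chord_sums_def)
qed

lemma sum_off_diagonal:
  fixes g :: "'a \<Rightarrow> 'a \<Rightarrow> 'b::comm_monoid_add"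
  assumes fin: "finite A" "finite B" and sub: "A' \<subseteq> A" "B' \<subseteq> B"
    and z: "\<And>j. j \<in> B \<Longrightarrow> (\<Sum>i\<in>A - A'. g i j) = 0" "\<And>i. i \<in> A' \<Longrightarrow> (\<Sum>j\<in>B - B'. g i j) = 0"
  shows "(\<Sum>i\<in>A. \<Sum>j\<in>B. g i j) = (\<Sum>i\<in>A'. \<Sum>j\<in>B'. g i j)"
proof -
  have "(\<Sum>i\<in>A. \<Sum>j\<in>B. g i j) = (\<Sum>j\<in>B. \<Sum>i\<in>A. g i j)" by (rule sum.swap)
  also have "\<dots> = (\<Sum>j\<in>B. \<Sum>i\<in>A'. g i j)"
  proof (rule sum.cong[OF refl])
    fix j assume "j \<in> B"
    then show "(\<Sum>i\<in>A. g i j) = (\<Sum>i\<in>A'. g i j)"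
      using sum.subset_diff[OF sub(1) fin(1), of "\<lambda>i. g i j"] z(1) by simp
  qed
  also have "\<dots> = (\<Sum>i\<in>A'. \<Sum>j\<in>B. g i j)" by (rule sum.swap)
  also have "\<dots> = (\<Sum>i\<in>A'. \<Sum>j\<in>B'. g i j)"
  proof (rule sum.cong[OF refl])
    fix i assume "i \<in> A'"
    then show "(\<Sum>j\<in>B. g i j) = (\<Sum>j\<in>B'. g i j)"
      using sum.subset_diff[OF sub(2) fin(2), of "g i"] z(2) by simp
  qed
  finally show ?thesis .
qed

text \<open>
  The chords \<open>X\<close> can be dropped if their contributions cancel whatever the other chord is: this
  covers both isolated chords and pairs of parallel chords with opposite signs.
\<close>

lemma same_chord_sums_drop:
  assumes fin: "finite (crossings D)" and C: "crossings D = crossings E \<union> X" "crossings E \<inter> X = {}"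
    and sg: "\<And>c. c \<in> crossings E \<Longrightarrow> crossing_sign E c = crossing_sign D c"
    and ix: "\<And>c. c \<in> crossings E \<Longrightarrow> index E c = index D c"
    and lk: "\<And>c d. c \<in> crossings E \<Longrightarrow> d \<in> crossings E \<Longrightarrow> linking E c d = linking D c d"
    and X: "(\<exists>x. X = {x} \<and> index D x = 0 \<and> (\<forall>d\<in>crossings D. linking D x d = 0 \<and> linking D d x =
        0)) \<or>
      (\<exists>x y. X = {x, y} \<and> x \<noteq> y \<and> crossing_type x = crossing_type y \<and>
        crossing_sign D x = - crossing_sign D y \<and> index D x = index D y \<and>
        (\<forall>d\<in>crossings D. linking D x d = linking D y d \<and> linking D d x = linking D d y))"
  shows "same_chord_sums D E"
proof -
  have t: "crossings_of_type a D = crossings_of_type a E \<union> {x\<in>X. crossing_type x = a}"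
    "crossings_of_type a E \<inter> {x\<in>X. crossing_type x = a} = {}" for a
    using C by (auto simp: crossings_of_type_def)
  have diff: "crossings_of_type a D - crossings_of_type a E = {x\<in>X. crossing_type x = a}" for a
    using t[of a] by blast
  have sub: "crossings_of_type a E \<subseteq> crossings_of_type a D" for a using t[of a] by blast
  have finD: "finite (crossings_of_type a D)" for a
    using finite_subset[OF crossings_of_type_subset fin] .
  have cancel: "(\<Sum>x | x \<in> X \<and> crossing_type x = a. of_int (crossing_sign D x) * f x) = (0 ::
      laurent_poly)"
    if "\<And>x. X = {x} \<Longrightarrow> index D x = 0 \<Longrightarrow> (\<forall>d\<in>crossings D. linking D x d = 0 \<and> linking D d x = 0) \<Longrightarrow> f
        x = 0"
      "\<And>x y. X = {x, y} \<Longrightarrow> index D x = index D y \<Longrightarrow>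
        (\<forall>d\<in>crossings D. linking D x d = linking D y d \<and> linking D d x = linking D d y) \<Longrightarrow> f x = f
            y" for a f
    using X
  proof (elim disjE exE conjE)
    fix x assume x: "X = {x}" "index D x = 0" "\<forall>d\<in>crossings D. linking D x d = 0 \<and> linking D d x =
        0"
    have "f x = 0" by (rule that(1)[OF x])
    then show ?thesis unfolding x(1) by (intro sum.neutral) simp
  next
    fix x y assume x: "X = {x, y}" "x \<noteq> y" "crossing_type x = crossing_type y"
        "crossing_sign D x = - crossing_sign D y" "index D x = index D y"
        "\<forall>d\<in>crossings D. linking D x d = linking D y d \<and> linking D d x = linking D d y"
    have f: "f x = f y" by (rule that(2)[OF x(1,5,6)])
    have e: "{z. z \<in> {x, y} \<and> crossing_type z = a} = (if crossing_type y = a then {x, y} else {})"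
      using x(3) by auto
    show ?thesis unfolding x(1) e using x(2,4) f by simp
  qed
  have "chord_sum a D \<psi> = chord_sum a E \<psi>" if "\<psi> 0 = 0" for a \<psi>
  proof -
    have "chord_sum a D \<psi> = (\<Sum>i\<in>crossings_of_type a E. of_int (crossing_sign D i) * \<psi> (index D i))"
      unfolding chord_sum_def sum.subset_diff[OF sub finD] diff
      by (subst cancel) (simp_all add: that)
    also have "\<dots> = chord_sum a E \<psi>"
      unfolding chord_sum_def
      by (intro sum.cong refl) (simp add: sg ix subsetD[OF crossings_of_type_subset])
    finally show ?thesis .
  qed
  moreover have "chord_pair_sum a b D \<phi> = chord_pair_sum a b E \<phi>"
    if p: "\<forall>n. \<phi> 0 n 0 = 0 \<and> \<phi> n 0 0 = 0" for a b \<phi>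
  proof -
    have 1: "(\<Sum>i\<in>crossings_of_type a D - crossings_of_type a E. of_int (crossing_sign D i *
        crossing_sign D j) *
        \<phi> (index D i) (index D j) (linking D i j)) = 0" if "j \<in> crossings_of_type b D" for j
    proof -
      have j: "j \<in> crossings D" using that crossings_of_type_subset by blast
      have "(\<Sum>x | x \<in> X \<and> crossing_type x = a. of_int (crossing_sign D x) *
          (of_int (crossing_sign D j) * \<phi> (index D x) (index D j) (linking D x j))) = 0"
        by (rule cancel) (use j p in auto)
      then show ?thesis unfolding diff by (simp add: mult.assoc)
    qed
    have 2: "(\<Sum>j\<in>crossings_of_type b D - crossings_of_type b E. of_int (crossing_sign D i *
        crossing_sign D j) *
        \<phi> (index D i) (index D j) (linking D i j)) = 0" if "i \<in> crossings_of_type a E" for i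
    proof -
      have i: "i \<in> crossings D" using that crossings_of_type_subset C by blast
      have "(\<Sum>x | x \<in> X \<and> crossing_type x = b. of_int (crossing_sign D x) *
          (of_int (crossing_sign D i) * \<phi> (index D i) (index D x) (linking D i x))) = 0"
        by (rule cancel) (use i p in auto)
      then show ?thesis unfolding diff by (simp add: ac_simps)
    qed
    have "chord_pair_sum a b D \<phi> = (\<Sum>i\<in>crossings_of_type a E. \<Sum>j\<in>crossings_of_type b E.
        of_int (crossing_sign D i * crossing_sign D j) * \<phi> (index D i) (index D j) (linking D i j))"
      unfolding chord_pair_sum_def by (rule sum_off_diagonal[OF finD finD sub sub 1 2])
    also have "\<dots> = chord_pair_sum a b E \<phi>"
      unfolding chord_pair_sum_def
      by (intro sum.cong refl) (simp add: sg ix lk subsetD[OF crossings_of_type_subset])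
    finally show ?thesis .
  qed
  ultimately show ?thesis by (simp add: same_chord_sums_def)
qed

section \<open>Disjoint unions of Gauss diagrams\<close>

text \<open>
  A factorization of \<open>\<phi> m n 0\<close> makes the sum over the mixed pairs a product of two sums.
\<close>

lemma chord_sum_union:
  fixes f :: "real \<times> real \<Rightarrow> real \<times> real"
  assumes fin: "finite (crossings D)" "finite (crossings D')"
    and C: "crossings E = h ` crossings D \<union> h' ` crossings D'" "h ` crossings D \<inter> h' ` crossings
        D' = {}"
    and inj: "inj_on h (crossings D)" "inj_on h' (crossings D')"
    and ty: "\<And>c. c \<in> crossings D \<Longrightarrow> crossing_type (h c) = crossing_type c"
      "\<And>c. c \<in> crossings D' \<Longrightarrow> crossing_type (h' c) = crossing_type c"
    and sg: "\<And>c. c \<in> crossings D \<Longrightarrow> crossing_sign E (h c) = crossing_sign D c"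
      "\<And>c. c \<in> crossings D' \<Longrightarrow> crossing_sign E (h' c) = crossing_sign D' c"
    and ix: "\<And>c. c \<in> crossings D \<Longrightarrow> index E (h c) = index D c"
      "\<And>c. c \<in> crossings D' \<Longrightarrow> index E (h' c) = index D' c"
    and lk: "\<And>c d. c \<in> crossings D \<Longrightarrow> d \<in> crossings D \<Longrightarrow> linking E (h c) (h d) = linking D c d"
      "\<And>c d. c \<in> crossings D' \<Longrightarrow> d \<in> crossings D' \<Longrightarrow> linking E (h' c) (h' d) = linking D' c d"
      "\<And>c d. c \<in> crossings D \<Longrightarrow> d \<in> crossings D' \<Longrightarrow> linking E (h c) (h' d) = 0"
      "\<And>c d. c \<in> crossings D \<Longrightarrow> d \<in> crossings D' \<Longrightarrow> linking E (h' d) (h c) = 0"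
    and \<phi>: "\<And>m n. \<phi> m n 0 = \<mu> m * \<nu> n"
  shows "chord_pair_sum a b E \<phi> = chord_pair_sum a b D \<phi> + chord_pair_sum a b D' \<phi>
      + chord_sum a D \<mu> * chord_sum b D' \<nu> + chord_sum a D' \<mu> * chord_sum b D \<nu>"
proof -
  let ?T = crossings_of_type
  have T: "?T a E = h ` ?T a D \<union> h' ` ?T a D'" for a
    using C ty by (auto simp: crossings_of_type_def)
  have dj: "h ` ?T a D \<inter> h' ` ?T a D' = {}" for a
    using C(2) crossings_of_type_subset by blast
  have f: "finite (?T a D)" "finite (?T a D')" for a
    using fin finite_subset[OF crossings_of_type_subset] by auto
  have i: "inj_on h (?T a D)" "inj_on h' (?T a D')" for a
    using inj inj_on_subset[OF _ crossings_of_type_subset] by auto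
  have split: "(\<Sum>x\<in>?T a E. k x) = (\<Sum>x\<in>?T a D. k (h x)) + (\<Sum>x\<in>?T a D'. k (h' x))"
    for a and k :: "real \<times> real \<Rightarrow> laurent_poly"
    unfolding T using f dj i by (simp add: sum.union_disjoint sum.reindex)
  have s: "c \<in> crossings X" if "c \<in> ?T a X" for a c X using that crossings_of_type_subset by blast
  have 1: "(\<Sum>i\<in>?T a D. \<Sum>j\<in>?T b D. of_int (crossing_sign E (h i) * crossing_sign E (h j)) *
      \<phi> (index E (h i)) (index E (h j)) (linking E (h i) (h j))) = chord_pair_sum a b D \<phi>"
    unfolding chord_pair_sum_def by (intro sum.cong refl) (simp add: s sg ix lk)
  have 2: "(\<Sum>i\<in>?T a D'. \<Sum>j\<in>?T b D'. of_int (crossing_sign E (h' i) * crossing_sign E (h' j)) *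
      \<phi> (index E (h' i)) (index E (h' j)) (linking E (h' i) (h' j))) = chord_pair_sum a b D' \<phi>"
    unfolding chord_pair_sum_def by (intro sum.cong refl) (simp add: s sg ix lk)
  have 3: "(\<Sum>i\<in>?T a D. \<Sum>j\<in>?T b D'. of_int (crossing_sign E (h i) * crossing_sign E (h' j)) *
      \<phi> (index E (h i)) (index E (h' j)) (linking E (h i) (h' j))) = chord_sum a D \<mu> * chord_sum b
          D' \<nu>"
    unfolding chord_sum_def sum_product by (intro sum.cong refl) (simp add: s sg ix lk \<phi> ac_simps)
  have 4: "(\<Sum>i\<in>?T a D'. \<Sum>j\<in>?T b D. of_int (crossing_sign E (h' i) * crossing_sign E (h j)) *
      \<phi> (index E (h' i)) (index E (h j)) (linking E (h' i) (h j))) = chord_sum a D' \<mu> * chord_sum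
          b D \<nu>"
    unfolding chord_sum_def sum_product by (intro sum.cong refl) (simp add: s sg ix lk \<phi> ac_simps)
  show ?thesis
    unfolding chord_pair_sum_def[of a b E] split sum.distrib 1 2 3 4 by (simp add: ac_simps)
qed

section \<open>Cycles near the arcs of a move\<close>

text \<open>
  A cycle changes its multiplicity only at the points of \<open>S\<close>, the ends of chords.
\<close>

definition flat :: "real set \<Rightarrow> (side \<Rightarrow> real \<Rightarrow> int) \<Rightarrow> bool" where
  "flat S v \<longleftrightarrow> (\<forall>t. t \<notin> S \<longrightarrow> v Before t = v After t) \<and>
     (\<forall>s t. s < t \<and> S \<inter> {s<..<t} = {} \<longrightarrow> v After s = v Before t)"

definition ends :: "(real \<times> real) set \<Rightarrow> real set" where
  "ends C = fst ` C \<union> snd ` C"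

text \<open>
  All cycles that occur are integral combinations of the whole knot and the loops of chords. The
  moves use only these two properties of them.
\<close>

definition cycle_on :: "(real \<times> real) set \<Rightarrow> (side \<Rightarrow> real \<Rightarrow> int) \<Rightarrow> bool" where
  "cycle_on C v \<longleftrightarrow> conserved C v \<and> flat (ends C) v"

lemma flat_loop:
  assumes "fst c \<in> S" "snd c \<in> S" shows "flat S (loop c)"
  unfolding flat_def
proof (intro conjI allI impI)
  fix t assume "t \<notin> S"
  then show "loop c Before t = loop c After t" using assms by (intro loop_constant) auto
next
  fix s t assume A: "s < t \<and> S \<inter> {s<..<t} = {}"
  then have "\<not> (s < fst c \<and> fst c < t)" "\<not> (s < snd c \<and> snd c < t)" using assms by auto
  then show "loop c After s = loop c Before t"
    using A by (auto simp: loop_def)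
qed

lemma cycle_on_loop:
  assumes "chord_diagram C" "c \<in> C" shows "cycle_on C (loop c)"
  unfolding cycle_on_def using assms by (auto intro!: flat_loop conserved_loop simp: ends_def)

lemma cycle_on_whole: "cycle_on C whole"
  by (simp add: cycle_on_def conserved_whole flat_def)

lemma cycle_on_diff: "cycle_on C v \<Longrightarrow> cycle_on C w \<Longrightarrow> cycle_on C (\<lambda>\<delta> t. v \<delta> t - w \<delta> t)"
  by (simp add: cycle_on_def conserved_def flat_def algebra_simps)

lemma cycle_on_conserved:
  "cycle_on C v \<Longrightarrow> (p, q) \<in> C \<or> (q, p) \<in> C \<Longrightarrow> v Before p + v Before q = v After p + v After q"
  unfolding cycle_on_def conserved_def by fastforce

lemma chord_term_swap:
  assumes "e \<in> {1, - 1}" shows "chord_term e (q, p) v w = chord_term (- e) (p, q) v w"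
  using assms by (auto simp: chord_term_def)

text \<open>
  An arc meets the ends \<open>p\<close> and \<open>q\<close> of chords, in this order if it is run through forwards; \<open>F\<close>,
  \<open>M\<close> and \<open>G\<close> are the values of a cycle before, between and after the two ends.
\<close>

definition two_nodes :: "bool \<Rightarrow> int \<Rightarrow> int \<Rightarrow> int \<Rightarrow> (side \<Rightarrow> real \<Rightarrow> int) \<Rightarrow> real \<Rightarrow> real \<Rightarrow> bool" where
  "two_nodes fw F M G v p q \<longleftrightarrow>
     v Before p = (if fw then F else M) \<and> v After p = (if fw then M else G) \<and>
     v Before q = (if fw then M else F) \<and> v After q = (if fw then G else M)"

lemma two_nodesI:
  assumes v: "flat S v" and S: "S \<inter> {m - 1..m + 1} \<subseteq> {m + \<sigma> * x, m + \<sigma> * y}"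
    and "\<sigma> \<in> {1, - 1}" "- 1 < x" "x < y" "y < 1"
  obtains M where
    "two_nodes (\<sigma> = 1) (v After (m - 1)) M (v Before (m + 1)) v (m + \<sigma> * x) (m + \<sigma> * y)"
proof -
  have gap: "v After s = v Before t"
    if "s < t" "m - 1 \<le> s" "t \<le> m + 1" "m + \<sigma> * x \<le> s \<or> t \<le> m + \<sigma> * x" "m + \<sigma> * y \<le> s \<or> t \<le> m + \<sigma>
        * y" for s t
  proof -
    have "S \<inter> {s<..<t} = {}"
    proof (rule ccontr)
      assume "S \<inter> {s<..<t} \<noteq> {}"
      then obtain r where r: "r \<in> S" "s < r" "r < t" by auto
      then have "r \<in> {m + \<sigma> * x, m + \<sigma> * y}" using S that(2,3) by (intro subsetD[OF S]) auto
      then show False using r that(4,5) by auto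
    qed
    then show ?thesis using v that(1) by (simp add: flat_def)
  qed
  from assms(3) consider "\<sigma> = 1" | "\<sigma> = - 1" by auto
  then show ?thesis
  proof cases
    case 1
    then show ?thesis
      using gap[of "m - 1" "m + x"] gap[of "m + x" "m + y"] gap[of "m + y" "m + 1"] assms(4-6)
      by (intro that[of "v After (m + x)"]) (simp add: two_nodes_def)
  next
    case 2
    then show ?thesis
      using gap[of "m - 1" "m - y"] gap[of "m - y" "m - x"] gap[of "m - x" "m + 1"] assms(4-6)
      by (intro that[of "v After (m - y)"]) (simp add: two_nodes_def)
  qed
qed

lemma no_node:
  assumes v: "flat S v" and S: "S \<inter> {m - 1<..<m + 1} = {}"
  shows "v After (m - 1) = v Before (m + 1)"
  using assms by (simp add: flat_def)

lemma one_node: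
  assumes v: "flat S v" and S: "S \<inter> {m - 1..m + 1} \<subseteq> {p}" and "m - 1 < p" "p < m + 1"
  shows "v Before p = v After (m - 1)" "v After p = v Before (m + 1)"
proof -
  have "S \<inter> {m - 1<..<p} = {}" "S \<inter> {p<..<m + 1} = {}" using S assms(3,4) by force+
  then show "v Before p = v After (m - 1)" "v After p = v Before (m + 1)"
    using v assms(3,4) by (simp_all add: flat_def)
qed

definition chord_conserved :: "(side \<Rightarrow> real \<Rightarrow> int) \<Rightarrow> real \<Rightarrow> real \<Rightarrow> bool" where
  "chord_conserved v p q \<longleftrightarrow> v Before p + v Before q = v After p + v After q"

text \<open>
  Two arcs cross twice, with opposite signs. A cycle that enters and leaves each arc with the same
  multiplicity can be deformed to avoid the bigon; so the two crossings do not contribute to the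
  pairing of two such cycles.
\<close>

lemma bigon_terms_agree:
  assumes e: "e = 1 \<or> e = - 1"
    and v: "two_nodes f F M F v p q" "two_nodes g F' M' F' v p' q'"
    and w: "two_nodes f H L H w p q" "two_nodes g H' L' H' w p' q'"
    and c: "chord_conserved v p p'" "chord_conserved v q q'" "chord_conserved w p p'"
        "chord_conserved w q q'"
  shows "chord_term e (p, p') v w + chord_term (- e) (q, q') v w = 0"
proof -
  note n = v[unfolded two_nodes_def] w[unfolded two_nodes_def]
  have "chord_term 1 (p, p') v w + chord_term (- 1) (q, q') v w = 0"
    "chord_term (- 1) (p, p') v w + chord_term 1 (q, q') v w = 0"
    using c unfolding chord_conserved_def
    by (cases f; cases g; simp add: n chord_term_def; algebra)+
  then show ?thesis using e by auto
qed

text \<open>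
  If \<open>v\<close> does not leave the bigon, it is a multiple of its boundary, so it is homologous to \<open>0\<close>
  and pairs to \<open>0\<close> with every cycle.
\<close>

lemma bigon_terms_inside:
  assumes e: "e = 1 \<or> e = - 1"
    and v: "two_nodes f 0 M 0 v p q" "two_nodes g 0 M' 0 v p' q'"
    and w: "two_nodes f H L K w p q" "two_nodes g H' L' K' w p' q'"
    and c: "chord_conserved v p p'" "chord_conserved v q q'" "chord_conserved w p p'"
        "chord_conserved w q q'"
  shows "chord_term e (p, p') v w + chord_term (- e) (q, q') v w = 0"
    "chord_term e (p, p') w v + chord_term (- e) (q, q') w v = 0"
proof -
  note n = v[unfolded two_nodes_def] w[unfolded two_nodes_def]
  \<comment> \<open>what remains is the product of \<open>M\<close> and a linear consequence of the conservation of \<open>w\<close>\<close>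
  have 1: "chord_term 1 (p, p') v w + chord_term (- 1) (q, q') v w = 0"
    by (insert c[unfolded chord_conserved_def],
      (cases f; cases g; simp add: n chord_term_def del: mult_cancel_left mult_cancel_right
          mult_eq_0_iff),
      (algebra
       | (simp only: right_diff_distrib[symmetric] distrib_left[symmetric] mult_eq_0_iff,
         rule disjI2, linarith)
       | (simp only: left_diff_distrib[symmetric] distrib_right[symmetric] mult_eq_0_iff,
         rule disjI1, linarith))+)
  have 2: "chord_term (- 1) (p, p') v w + chord_term 1 (q, q') v w = 0"
    by (insert c[unfolded chord_conserved_def],
      (cases f; cases g; simp add: n chord_term_def del: mult_cancel_left mult_cancel_right
          mult_eq_0_iff),
      (algebra
       | (simp only: right_diff_distrib[symmetric] distrib_left[symmetric] mult_eq_0_iff,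
         rule disjI2, linarith)
       | (simp only: left_diff_distrib[symmetric] distrib_right[symmetric] mult_eq_0_iff,
         rule disjI1, linarith))+)
  have 3: "chord_term 1 (p, p') w v + chord_term (- 1) (q, q') w v = 0"
    by (insert c[unfolded chord_conserved_def],
      (cases f; cases g; simp add: n chord_term_def del: mult_cancel_left mult_cancel_right
          mult_eq_0_iff),
      (algebra
       | (simp only: right_diff_distrib[symmetric] distrib_left[symmetric] mult_eq_0_iff,
         rule disjI2, linarith)
       | (simp only: left_diff_distrib[symmetric] distrib_right[symmetric] mult_eq_0_iff,
         rule disjI1, linarith))+)
  have 4: "chord_term (- 1) (p, p') w v + chord_term 1 (q, q') w v = 0"
    by (insert c[unfolded chord_conserved_def],
      (cases f; cases g; simp add: n chord_term_def del: mult_cancel_left mult_cancel_right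
          mult_eq_0_iff),
      (algebra
       | (simp only: right_diff_distrib[symmetric] distrib_left[symmetric] mult_eq_0_iff,
         rule disjI2, linarith)
       | (simp only: left_diff_distrib[symmetric] distrib_right[symmetric] mult_eq_0_iff,
         rule disjI1, linarith))+)
  show "chord_term e (p, p') v w + chord_term (- e) (q, q') v w = 0"
    "chord_term e (p, p') w v + chord_term (- e) (q, q') w v = 0" using e 1 2 3 4 by auto
qed

text \<open>
  The contribution of a triangle to the pairing of two cycles is determined by the values \<open>F\<close> and
  \<open>G\<close> with which they enter and leave the arcs. For by conservation the inner values \<open>M\<close> are
  determined by one of them, and changing this one adds a multiple of the boundary of the
  triangle, which pairs to \<open>0\<close>. The first cycles live on the diagram before the move, the primed
  ones on the diagram after it, where each arc meets the other two in the opposite order.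
\<close>

lemma triangle_terms_agree:
  assumes v: "two_nodes f0 F0 M0 G0 v p02 p01" "two_nodes f1 F1 M1 G1 v p12 p10"
      "two_nodes f2 F2 M2 G2 v p20 p21"
    and v': "two_nodes f0 F0 M0' G0 v' q01 q02" "two_nodes f1 F1 M1' G1 v' q10 q12"
      "two_nodes f2 F2 M2' G2 v' q21 q20"
    and w: "two_nodes f0 H0 L0 K0 w p02 p01" "two_nodes f1 H1 L1 K1 w p12 p10"
      "two_nodes f2 H2 L2 K2 w p20 p21"
    and w': "two_nodes f0 H0 L0' K0 w' q01 q02" "two_nodes f1 H1 L1' K1 w' q10 q12"
      "two_nodes f2 H2 L2' K2 w' q21 q20"
    and cv: "chord_conserved v p01 p10" "chord_conserved v p02 p20" "chord_conserved v p12 p21"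
      "chord_conserved v' q01 q10" "chord_conserved v' q02 q20" "chord_conserved v' q12 q21"
    and cw: "chord_conserved w p01 p10" "chord_conserved w p02 p20" "chord_conserved w p12 p21"
      "chord_conserved w' q01 q10" "chord_conserved w' q02 q20" "chord_conserved w' q12 q21"
    and e: "e01 = (if f0 = f1 then 1 else - 1)" "e02 = (if f0 = f2 then - 1 else 1)"
      "e12 = (if f1 = f2 then - 1 else 1)"
  shows "chord_term e01 (p01, p10) v w + chord_term e02 (p02, p20) v w + chord_term e12 (p12, p21)
      v w =
    chord_term e01 (q01, q10) v' w' + chord_term e02 (q02, q20) v' w' + chord_term e12 (q12, q21)
        v' w'"
proof -
  note n = v[unfolded two_nodes_def] w[unfolded two_nodes_def]
    v'[unfolded two_nodes_def] w'[unfolded two_nodes_def]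
  show ?thesis
    using cv cw unfolding chord_conserved_def e
    by (cases f0; cases f1; cases f2; simp add: n chord_term_def; algebra)
qed

section \<open>The effect of the moves on Gauss diagrams\<close>

lemma pairing_union:
  assumes "finite Out" "finite I" "Out \<inter> I = {}"
  shows "pairing (Out \<union> I) e v w = pairing Out e v w + pairing I e v w"
  unfolding pairing_def by (rule sum.union_disjoint[OF assms])

lemma pairing_cong:
  assumes "\<And>c. c \<in> C \<Longrightarrow> e c = e' c"
    "\<And>c \<delta> t. c \<in> C \<Longrightarrow> t \<in> {fst c, snd c} \<Longrightarrow> v \<delta> t = v' \<delta> t"
    "\<And>c \<delta> t. c \<in> C \<Longrightarrow> t \<in> {fst c, snd c} \<Longrightarrow> w \<delta> t = w' \<delta> t"
  shows "pairing C e v w = pairing C e' v' w'"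
  unfolding pairing_def
proof (rule sum.cong[OF refl])
  fix c assume c: "c \<in> C"
  show "chord_term (e c) c v w = chord_term (e' c) c v' w'"
    unfolding assms(1)[OF c]
    by (rule chord_term_cong) (rule assms(2)[OF c] assms(3)[OF c], assumption)+
qed

lemma loop_agree:
  assumes "fst c < t \<longleftrightarrow> fst d < t" "snd c < t \<longleftrightarrow> snd d < t" "t < fst c \<longleftrightarrow> t < fst d" "t < snd c \<longleftrightarrow> t <
      snd d"
  shows "loop c \<delta> t = loop d \<delta> t"
proof -
  have "t \<le> fst c \<longleftrightarrow> t \<le> fst d" "t \<le> snd c \<longleftrightarrow> t \<le> snd d" "fst c \<le> t \<longleftrightarrow> fst d \<le> t" "snd c \<le> t \<longleftrightarrow> snd d
      \<le> t"
    using assms by (simp_all add: linorder_not_less[symmetric])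
  then show ?thesis using assms by (cases \<delta>) (simp_all add: loop_def)
qed

text \<open>
  The arcs of a move, parametrized by disjoint intervals of radius \<open>1\<close>. Crossings that are not
  affected by the move lie \<open>outside\<close>; the values of cycles can also be compared at the boundary
  points of the intervals, which are no ends of chords.
\<close>

locale disjoint_arcs =
  fixes k :: nat and m \<sigma> :: "nat \<Rightarrow> real"
  assumes \<sigma>: "\<And>i. i < k \<Longrightarrow> \<sigma> i = 1 \<or> \<sigma> i = - 1"
    and m: "\<And>i j. i < k \<Longrightarrow> j < k \<Longrightarrow> i \<noteq> j \<Longrightarrow> 2 < \<bar>m i - m j\<bar>"
begin

definition outside :: "real \<Rightarrow> bool" where
  "outside t \<longleftrightarrow> (\<forall>i<k. 1 < \<bar>t - m i\<bar>)"

definition weakly_outside :: "real \<Rightarrow> bool" where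
  "weakly_outside t \<longleftrightarrow> (\<forall>i<k. 1 \<le> \<bar>t - m i\<bar>)"

lemma outside_weakly: "outside t \<Longrightarrow> weakly_outside t"
  unfolding outside_def weakly_outside_def by (meson less_imp_le)

lemma boundary_weakly_outside:
  assumes "i < k" "t = m i - 1 \<or> t = m i + 1"
  shows "weakly_outside t"
  unfolding weakly_outside_def
proof (intro allI impI)
  fix j assume "j < k"
  then show "1 \<le> \<bar>t - m j\<bar>"
    using m[OF assms(1), of j] assms(2) by (cases "i = j") auto
qed

definition node :: "nat \<Rightarrow> real \<Rightarrow> real" where
  "node i x = m i + \<sigma> i * x"

lemma node_dist: "i < k \<Longrightarrow> \<bar>node i x - m i\<bar> = \<bar>x\<bar>"
  using \<sigma>[of i] by (auto simp: node_def)

lemma node_interval: "i < k \<Longrightarrow> \<bar>x\<bar> < 1 \<Longrightarrow> m i - 1 < node i x \<and> node i x < m i + 1"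
  using \<sigma>[of i] by (auto simp: node_def)

lemma node_other: "i < k \<Longrightarrow> j < k \<Longrightarrow> i \<noteq> j \<Longrightarrow> \<bar>x\<bar> < 1 \<Longrightarrow> node i x \<notin> {m j - 1..m j + 1}"
  using node_dist[of i x] m[of i j] by auto

lemma node_inj: "i < k \<Longrightarrow> j < k \<Longrightarrow> \<bar>x\<bar> < 1 \<Longrightarrow> \<bar>y\<bar> < 1 \<Longrightarrow> node i x = node j y \<Longrightarrow> i = j \<and> x = y"
  using node_other[of i j x] node_interval[of j y] \<sigma>[of i] by (cases "i = j") (auto simp: node_def)

lemma node_less:
  assumes "i < k" "\<bar>x\<bar> < 1" "\<bar>y\<bar> < 1" "weakly_outside t"
  shows "node i x < t \<longleftrightarrow> node i y < t" "t < node i x \<longleftrightarrow> t < node i y"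
proof -
  have "1 \<le> \<bar>t - m i\<bar>" using assms by (simp add: weakly_outside_def)
  then show "node i x < t \<longleftrightarrow> node i y < t" "t < node i x \<longleftrightarrow> t < node i y"
    using node_interval[of i x] node_interval[of i y] assms by auto
qed

lemma outside_interval: "outside t \<Longrightarrow> i < k \<Longrightarrow> t \<notin> {m i - 1..m i + 1}"
  unfolding outside_def by (force simp: abs_if split: if_splits)

lemma node_order: "i < k \<Longrightarrow> j < k \<Longrightarrow> i \<noteq> j \<Longrightarrow> \<bar>x\<bar> < 1 \<Longrightarrow> \<bar>y\<bar> < 1 \<Longrightarrow> node i x < node j y \<longleftrightarrow> m i < m j"
  using node_interval[of i x] node_interval[of j y] m[of i j] by auto

lemma node_not_outside: "i < k \<Longrightarrow> \<bar>x\<bar> < 1 \<Longrightarrow> \<not> outside (node i x)"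
  using node_dist[of i x] by (auto simp: outside_def)

end

text \<open>
  The three arcs of the third move are graphs, so two of them cross at the same coordinate \<open>x\<close> on
  both. The arcs 0 and 1 cross at \<open>a\<close>, the arcs 0 and 2 at \<open>-a\<close> and the arcs 1 and 2 at \<open>0\<close>; after
  the move these coordinates change their signs. The argument \<open>z\<close> of \<open>pt\<close> is \<open>1\<close> before and \<open>-1\<close>
  after the move.
\<close>

locale three_arcs = disjoint_arcs 3 m \<sigma> for m \<sigma> +
  fixes a :: real
  assumes a: "0 < a" "a < 1"
begin

text \<open>
  The sum \<open>i + j\<close> distinguishes the three unordered pairs of arcs.
\<close>

definition \<xi> :: "nat \<Rightarrow> nat \<Rightarrow> real" where
  "\<xi> i j = (if i + j = 1 then a else if i + j = 2 then - a else 0)"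

definition pt :: "real \<Rightarrow> nat \<times> nat \<Rightarrow> real \<times> real" where
  "pt z p = (node (fst p) (z * \<xi> (fst p) (snd p)), node (snd p) (z * \<xi> (fst p) (snd p)))"

text \<open>
  The sign of the crossing of the arcs \<open>i\<close> and \<open>j\<close> if \<open>i\<close> lies over \<open>j\<close>. If all arcs run from left
  to right, it is \<open>1\<close> iff the arc \<open>j\<close> has the larger slope.
\<close>

definition sg :: "nat \<Rightarrow> nat \<Rightarrow> int" where
  "sg i j = (if 0 < \<sigma> i * \<sigma> j * (if (i, j) \<in> {(0, 1), (2, 0), (2, 1)} then 1 else - 1) then 1 else
      - 1)"

lemma abs_xi: "z \<in> {1, - 1} \<Longrightarrow> \<bar>z * \<xi> i j\<bar> < 1"
  using a by (auto simp: \<xi>_def)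

lemma xi_sym: "\<xi> i j = \<xi> j i"
  by (simp add: \<xi>_def add.commute)

end

locale triangle_move = three_arcs m \<sigma> a for m \<sigma> a +
  fixes D E :: lv_diagram and Out :: "(real \<times> real) set" and ov :: "(nat \<times> nat) set"
  assumes layering: "layering_III ov"
    and crossings_D: "crossings D = Out \<union> pt 1 ` ov"
    and crossings_E: "crossings E = Out \<union> pt (- 1) ` ov"
    and Out: "\<And>c. c \<in> Out \<Longrightarrow> outside (fst c) \<and> outside (snd c)"
    and sign_Out: "\<And>c. c \<in> Out \<Longrightarrow> crossing_sign E c = crossing_sign D c"
    and sign_D: "\<And>i j. (i, j) \<in> ov \<Longrightarrow> crossing_sign D (pt 1 (i, j)) = sg i j"
    and sign_E: "\<And>i j. (i, j) \<in> ov \<Longrightarrow> crossing_sign E (pt (- 1) (i, j)) = sg i j"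
    and chords_D: "chord_diagram (crossings D)" and chords_E: "chord_diagram (crossings E)"
begin

lemma ov_less: "(i, j) \<in> ov \<Longrightarrow> i < 3 \<and> j < 3 \<and> i \<noteq> j"
  using layering unfolding layering_III_def by auto

lemma pt_inj: assumes z: "z \<in> {1, - 1}" shows "inj_on (pt z) ov"
proof (rule inj_onI)
  fix x y assume x: "x \<in> ov" "y \<in> ov" "pt z x = pt z y"
  have "fst x < 3" "snd x < 3" "fst y < 3" "snd y < 3"
    using ov_less[of "fst x" "snd x"] ov_less[of "fst y" "snd y"] x by auto
  then have "fst x = fst y" "snd x = snd y"
    using x(3) node_inj abs_xi[OF z] unfolding pt_def by (metis prod.inject)+
  then show "x = y" by (rule prod_eqI)
qed

lemma pt_disjoint: assumes z: "z \<in> {1, - 1}" shows "Out \<inter> pt z ` ov = {}"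
proof (rule ccontr)
  assume "Out \<inter> pt z ` ov \<noteq> {}"
  then obtain x where x: "x \<in> ov" "pt z x \<in> Out" by blast
  then have "outside (node (fst x) (z * \<xi> (fst x) (snd x)))" using Out[of "pt z x"] by (simp add:
      pt_def)
  moreover have "fst x < 3" using ov_less[of "fst x" "snd x"] x by simp
  ultimately show False using node_not_outside abs_xi[OF z] by blast
qed

lemma finite_ov: "finite ov"
  by (rule finite_subset[of _ "{..<3} \<times> {..<3}"]) (use ov_less in auto)

lemma finite_Out: "finite Out"
  using chords_D by (simp add: chord_diagram_def crossings_D)

lemma ends_arc:
  assumes z: "z \<in> {1, - 1}" and i: "i < 3"
  shows "ends (Out \<union> pt z ` ov) \<inter> {m i - 1..m i + 1} \<subseteq> {node i (z * \<xi> i j) | j. (i, j) \<in> ov \<or> (j,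
      i) \<in> ov}"
proof
  fix t assume t: "t \<in> ends (Out \<union> pt z ` ov) \<inter> {m i - 1..m i + 1}"
  then obtain c where c: "c \<in> Out \<union> pt z ` ov" "t = fst c \<or> t = snd c" by (auto simp: ends_def)
  have "c \<notin> Out" using Out[of c] outside_interval[OF _ i] c(2) t by blast
  then obtain p where p: "p \<in> ov" "c = pt z p" using c(1) by blast
  obtain q r where qr: "p = (q, r)" by fastforce
  have l: "q < 3" "r < 3" using ov_less p qr by auto
  show "t \<in> {node i (z * \<xi> i j) | j. (i, j) \<in> ov \<or> (j, i) \<in> ov}"
    using c(2)
  proof
    assume "t = fst c"
    then have e: "t = node q (z * \<xi> q r)" using p qr by (simp add: pt_def)
    then have "q = i" using node_other[OF l(1) i _ abs_xi[OF z, of q r]] t by blast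
    then show ?thesis using e p qr by blast
  next
    assume "t = snd c"
    then have e: "t = node r (z * \<xi> r q)" using p qr xi_sym by (simp add: pt_def)
    then have "r = i" using node_other[OF l(2) i _ abs_xi[OF z, of r q]] t by blast
    then show ?thesis using e p qr by blast
  qed
qed

lemma sg_swap:
  assumes "i < 3" "j < 3" "i \<noteq> j"
  shows "sg j i = - sg i j"
proof -
  have "(i, j) \<in> {(0, 1), (0, 2), (1, 0), (1, 2), (2, 0), (2, 1)}" using assms by auto
  then have t: "(if (j, i) \<in> {(0, 1), (2, 0), (2, 1)} then 1 else - 1 :: real) =
      - (if (i, j) \<in> {(0, 1), (2, 0), (2, 1)} then 1 else - 1)"
    by auto
  have "\<sigma> i * \<sigma> j = 1 \<or> \<sigma> i * \<sigma> j = - 1"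
    using \<sigma>[OF assms(1)] \<sigma>[OF assms(2)] by (elim disjE) simp_all
  then show ?thesis
    unfolding sg_def t mult.commute[of "\<sigma> j" "\<sigma> i"]
    by (elim disjE) (simp_all only:, simp_all)
qed

lemma chord_term_pt_swap:
  assumes "i < 3" "j < 3" "i \<noteq> j"
  shows "chord_term (sg j i) (pt z (j, i)) v w = chord_term (sg i j) (pt z (i, j)) v w"
proof -
  have "sg j i \<in> {1, - 1}" by (simp add: sg_def)
  then show ?thesis
    using chord_term_swap[of "sg j i" "node j (z * \<xi> i j)" "node i (z * \<xi> i j)" v w] sg_swap[OF
        assms]
    by (simp add: pt_def xi_sym[of j i])
qed

text \<open>
  If there is more than one real crossing, all three are real, since the arcs lie at three
  different heights.
\<close>

lemma layering_cases:
  obtains "ov = {}" | i j where "i < 3" "j < 3" "i \<noteq> j" "ov = {(i, j)}"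
  | x y z where "x = (0, 1) \<or> x = (1, 0)" "y = (0, 2) \<or> y = (2, 0)" "z = (1, 2) \<or> z = (2, 1)" "ov
      = {x, y, z}"
  using layering unfolding layering_III_def
proof (elim disjE)
  assume "\<exists>h::nat \<Rightarrow> nat. inj_on h {..<3} \<and> ov = {(i, j). i < 3 \<and> j < 3 \<and> h j < h i}"
  then obtain h :: "nat \<Rightarrow> nat" where h: "inj_on h {..<3}" "ov = {(i, j). i < 3 \<and> j < 3 \<and> h j < h
      i}" by blast
  have ne: "h 0 \<noteq> h 1" "h 0 \<noteq> h 2" "h 1 \<noteq> h 2" 
    using inj_onD[OF h(1), of 0 1] inj_onD[OF h(1), of 0 2] inj_onD[OF h(1), of 1 2] by auto
  have l: "i < 3 \<longleftrightarrow> i = 0 \<or> i = 1 \<or> i = 2" for i :: nat by auto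
  have "ov = {if h 1 < h 0 then (0, 1) else (1, 0), if h 2 < h 0 then (0, 2) else (2, 0),
      if h 2 < h 1 then (1, 2) else (2, 1)}"
    unfolding h(2) l using ne by (auto split: if_splits)
  then show thesis by (rule that(3)[rotated 3]) auto
qed (use that in blast)+

text \<open>
  What becomes of a cycle \<open>v\<close> of \<open>D\<close> under the move is determined up to multiples of the boundary
  of the triangle by its values outside the three arcs.
\<close>

definition corresponding :: "(side \<Rightarrow> real \<Rightarrow> int) \<Rightarrow> (side \<Rightarrow> real \<Rightarrow> int) \<Rightarrow> bool" where
  "corresponding v v' \<longleftrightarrow> cycle_on (crossings D) v \<and> cycle_on (crossings E) v' \<and>
     (\<forall>\<delta> t. weakly_outside t \<longrightarrow> v \<delta> t = v' \<delta> t)"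

text \<open>
  With a single real crossing nothing happens to the Gauss diagram but a shift of the ends of a
  chord. In the classical move all three crossings count.
\<close>

lemma triangle_contribution:
  assumes v: "corresponding v v'" and w: "corresponding w w'"
  shows "(\<Sum>p\<in>ov. chord_term (sg (fst p) (snd p)) (pt 1 p) v w) =
    (\<Sum>p\<in>ov. chord_term (sg (fst p) (snd p)) (pt (- 1) p) v' w')"
proof -
  have bd: "u After (m i - 1) = u' After (m i - 1)" "u Before (m i + 1) = u' Before (m i + 1)"
    if "corresponding u u'" "i < 3" for u u' i
    using that boundary_weakly_outside[OF that(2)] by (simp_all add: corresponding_def)
  have fl: "flat (ends (Out \<union> pt 1 ` ov)) u" "flat (ends (Out \<union> pt (- 1) ` ov)) u'"
    if "corresponding u u'" for u u'
    using that crossings_D crossings_E by (simp_all add: corresponding_def cycle_on_def)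
  let ?N = "\<lambda>i u M u' x y.
    two_nodes (\<sigma> i = 1) (u After (m i - 1)) M (u Before (m i + 1)) u' (node i x) (node i y)"
  show ?thesis
  proof (rule layering_cases)
    assume "ov = {}" then show ?thesis by simp
  next
    fix i j :: nat assume ij: "i < 3" "j < 3" "i \<noteq> j" and ov: "ov = {(i, j)}"
    have sub: "ends (Out \<union> pt z ` ov) \<inter> {m l - 1..m l + 1} \<subseteq> {node l (z * \<xi> i j)}"
      if "l = i \<or> l = j" "z \<in> {1, - 1}" for l z
    proof -
      have "l < 3" using that(1) ij by auto
      moreover have "{node l (z * \<xi> l j') | j'. (l, j') \<in> ov \<or> (j', l) \<in> ov} \<subseteq> {node l (z * \<xi> i j)}"
        using that(1) xi_sym[of i j] unfolding ov by auto
      ultimately show ?thesis using ends_arc[OF that(2)] by (meson subset_trans)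
    qed
    have eq: "u \<delta> (node l (1 * \<xi> i j)) = u' \<delta> (node l (- 1 * \<xi> i j))"
      if "l = i \<or> l = j" "corresponding u u'" for l u u' \<delta>
    proof -
      have l: "l < 3" using that ij by auto
      have "m l - 1 < node l (z * \<xi> i j)" "node l (z * \<xi> i j) < m l + 1" if "z \<in> {1, - 1}" for z
        using node_interval[OF l abs_xi[OF that]] by blast+
      from this[of 1] this[of "- 1"] show ?thesis
        using one_node[OF fl(1)[OF that(2)] sub[OF that(1), of 1]] one_node[OF fl(2)[OF that(2)]
            sub[OF that(1), of "- 1"]]
          bd[OF that(2) l] by (cases \<delta>) simp_all
    qed
    show ?thesis
      unfolding ov using eq[OF _ v] eq[OF _ w] by (simp add: pt_def chord_term_def)
  next
    fix x y z assume x: "x = (0, 1) \<or> x = (1, 0)" and y: "y = (0, 2) \<or> y = (2, 0)"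
      and z: "z = (1, 2) \<or> z = (2 :: nat, 1 :: nat)" and ov: "ov = {x, y, z}"
    have sum: "(\<Sum>p\<in>ov. chord_term (sg (fst p) (snd p)) (pt s p) u u') =
        chord_term (sg 0 1) (pt s (0, 1)) u u' + chord_term (sg 0 2) (pt s (0, 2)) u u'
          + chord_term (sg 1 2) (pt s (1, 2)) u u'" for s u u'
    proof -
      have "x \<noteq> y" "x \<noteq> z" "y \<noteq> z" using x y z by auto
      then have "(\<Sum>p\<in>ov. chord_term (sg (fst p) (snd p)) (pt s p) u u') =
        chord_term (sg (fst x) (snd x)) (pt s x) u u' + chord_term (sg (fst y) (snd y)) (pt s y) u
            u'
          + chord_term (sg (fst z) (snd z)) (pt s z) u u'"
        unfolding ov by (simp add: add.assoc)
      also have "chord_term (sg (fst x) (snd x)) (pt s x) u u' = chord_term (sg 0 1) (pt s (0, 1))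
          u u'"
        using x chord_term_pt_swap[of 0 1 s u u'] by auto
      also have "chord_term (sg (fst y) (snd y)) (pt s y) u u' = chord_term (sg 0 2) (pt s (0, 2))
          u u'"
        using y chord_term_pt_swap[of 0 2 s u u'] by auto
      also have "chord_term (sg (fst z) (snd z)) (pt s z) u u' = chord_term (sg 1 2) (pt s (1, 2))
          u u'"
        using z chord_term_pt_swap[of 1 2 s u u'] by auto
      finally show ?thesis .
    qed
    have arc: "ends (Out \<union> pt s ` ov) \<inter> {m i - 1..m i + 1} \<subseteq> {node i (s * \<xi> i j), node i (s * \<xi> i
        l)}"
      if "s \<in> {1, - 1}" "{i, j, l} = {0, 1, 2}" for s i j l
    proof -
      have "i \<in> {0, 1, 2}" unfolding that(2)[symmetric] by simp
      then have i: "i < 3" by auto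
      have "j' = j \<or> j' = l" if "(i, j') \<in> ov \<or> (j', i) \<in> ov" for j'
      proof -
        have "j' < 3" "j' \<noteq> i" using ov_less that by blast+
        then have "j' \<in> {0, 1, 2}" by auto
        then have "j' \<in> {i, j, l}" unfolding \<open>{i, j, l} = {0, 1, 2}\<close> .
        then show ?thesis using \<open>j' \<noteq> i\<close> by simp
      qed
      then show ?thesis using ends_arc[OF that(1) i] by blast
    qed
    have sub: "ends (Out \<union> pt s ` ov) \<inter> {m 0 - 1..m 0 + 1} \<subseteq> {m 0 + \<sigma> 0 * - a, m 0 + \<sigma> 0 * a}"
      "s = 1 \<Longrightarrow> ends (Out \<union> pt s ` ov) \<inter> {m 1 - 1..m 1 + 1} \<subseteq> {m 1 + \<sigma> 1 * 0, m 1 + \<sigma> 1 * a}"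
      "s = - 1 \<Longrightarrow> ends (Out \<union> pt s ` ov) \<inter> {m 1 - 1..m 1 + 1} \<subseteq> {m 1 + \<sigma> 1 * - a, m 1 + \<sigma> 1 * 0}"
      "s = 1 \<Longrightarrow> ends (Out \<union> pt s ` ov) \<inter> {m 2 - 1..m 2 + 1} \<subseteq> {m 2 + \<sigma> 2 * - a, m 2 + \<sigma> 2 * 0}"
      "s = - 1 \<Longrightarrow> ends (Out \<union> pt s ` ov) \<inter> {m 2 - 1..m 2 + 1} \<subseteq> {m 2 + \<sigma> 2 * 0, m 2 + \<sigma> 2 * a}"
      if "s \<in> {1, - 1}" for s
    proof -
      have x: "\<xi> 0 1 = a" "\<xi> 0 2 = - a" "\<xi> 1 0 = a" "\<xi> 1 2 = 0" "\<xi> 2 0 = - a" "\<xi> 2 1 = 0"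
        by (simp_all add: \<xi>_def)
      have t: "{0, 1, 2} = {0, 1, 2 :: nat}" "{1, 0, 2} = {0, 1, 2 :: nat}" "{2, 0, 1} = {0, 1, 2
          :: nat}" by auto
      note A = arc[OF that t(1), unfolded node_def x] arc[OF that t(2), unfolded node_def x]
        arc[OF that t(3), unfolded node_def x]
      show "ends (Out \<union> pt s ` ov) \<inter> {m 0 - 1..m 0 + 1} \<subseteq> {m 0 + \<sigma> 0 * - a, m 0 + \<sigma> 0 * a}"
        by (rule subset_trans[OF A(1)]) (use that in auto)
      show "ends (Out \<union> pt s ` ov) \<inter> {m 1 - 1..m 1 + 1} \<subseteq> {m 1 + \<sigma> 1 * 0, m 1 + \<sigma> 1 * a}" if "s = 1"
        by (rule subset_trans[OF A(2)]) (use that in auto)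
      show "ends (Out \<union> pt s ` ov) \<inter> {m 1 - 1..m 1 + 1} \<subseteq> {m 1 + \<sigma> 1 * - a, m 1 + \<sigma> 1 * 0}" if "s
          = - 1"
        by (rule subset_trans[OF A(2)]) (use that in auto)
      show "ends (Out \<union> pt s ` ov) \<inter> {m 2 - 1..m 2 + 1} \<subseteq> {m 2 + \<sigma> 2 * - a, m 2 + \<sigma> 2 * 0}" if "s
          = 1"
        by (rule subset_trans[OF A(3)]) (use that in auto)
      show "ends (Out \<union> pt s ` ov) \<inter> {m 2 - 1..m 2 + 1} \<subseteq> {m 2 + \<sigma> 2 * 0, m 2 + \<sigma> 2 * a}" if "s =
          - 1"
        by (rule subset_trans[OF A(3)]) (use that in auto)
    qed
    have nodes: "\<exists>M0 M1 M2 M0' M1' M2'.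
      ?N 0 u M0 u (- a) a \<and>
      ?N 1 u M1 u 0 a \<and>
      ?N 2 u M2 u (- a) 0 \<and>
      ?N 0 u M0' u' (- a) a \<and>
      ?N 1 u M1' u' (- a) 0 \<and>
      ?N 2 u M2' u' 0 a"
      if c: "corresponding u u'" for u u'
    proof -
      have s: "\<sigma> 0 \<in> {1, - 1}" "\<sigma> 1 \<in> {1, - 1}" "\<sigma> 2 \<in> {1, - 1}" using \<sigma> by auto
      have b: "- 1 < - a" "- a < a" "a < 1" "- 1 < (0 :: real)" "0 < a" "- a < 0" "(0 :: real) <
          1" using a by auto
      obtain M0 where 1: "?N 0 u M0 u (- a) a"
        unfolding node_def by (rule two_nodesI[OF fl(1)[OF c] sub(1) s(1) b(1,2,3)]) simp
      obtain M1 where 2: "?N 1 u M1 u 0 a"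
        unfolding node_def by (rule two_nodesI[OF fl(1)[OF c] sub(2) s(2) b(4,5,3)]) simp_all
      obtain M2 where 3: "?N 2 u M2 u (- a) 0"
        unfolding node_def by (rule two_nodesI[OF fl(1)[OF c] sub(4) s(3) b(1,6,7)]) simp_all
      obtain M0' where 4: "?N 0 u' M0' u' (- a) a"
        unfolding node_def by (rule two_nodesI[OF fl(2)[OF c] sub(1) s(1) b(1,2,3)]) simp
      obtain M1' where 5: "?N 1 u' M1' u' (- a) 0"
        unfolding node_def by (rule two_nodesI[OF fl(2)[OF c] sub(3) s(2) b(1,6,7)]) simp_all
      obtain M2' where 6: "?N 2 u' M2' u' 0 a"
        unfolding node_def by (rule two_nodesI[OF fl(2)[OF c] sub(5) s(3) b(4,5,3)]) simp_all
      have l: "(0 :: nat) < 3" "(1 :: nat) < 3" "(2 :: nat) < 3" by simp_all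
      note bc = bd[OF c l(1)] bd[OF c l(2)] bd[OF c l(3)]
      show ?thesis
        by (rule exI[of _ M0], rule exI[of _ M1], rule exI[of _ M2], rule exI[of _ M0'], rule
            exI[of _ M1'],
          rule exI[of _ M2'], intro conjI 1 2 3 4[folded bc] 5[folded bc] 6[folded bc])
    qed
    have cons: "chord_conserved u (node i (\<xi> i j)) (node j (\<xi> i j))"
        "chord_conserved u' (node i (- \<xi> i j)) (node j (- \<xi> i j))"
      if c: "corresponding u u'" "(i, j) \<in> ov \<or> (j, i) \<in> ov" for u u' i j
    proof -
      have "(node i (s * \<xi> i j), node j (s * \<xi> i j)) \<in> pt s ` ov \<or> (node j (s * \<xi> i j), node i (s
          * \<xi> i j)) \<in> pt s ` ov" for s
        using c(2) xi_sym[of i j] by (force simp: pt_def)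
      from this[of 1] this[of "- 1"] show "chord_conserved u (node i (\<xi> i j)) (node j (\<xi> i j))"
        "chord_conserved u' (node i (- \<xi> i j)) (node j (- \<xi> i j))"
        using c(1) cycle_on_conserved[of "crossings D" u] cycle_on_conserved[of "crossings E" u']
        unfolding corresponding_def chord_conserved_def crossings_D crossings_E by auto
    qed
    have in_ov: "(0, 1) \<in> ov \<or> (1, 0) \<in> ov" "(0, 2) \<in> ov \<or> (2, 0) \<in> ov" "(1, 2) \<in> ov \<or> (2, 1) \<in> ov"
      using x y z ov by auto
    have xi: "\<xi> 0 1 = a" "\<xi> 0 2 = - a" "\<xi> 1 2 = 0" by (simp_all add: \<xi>_def)
    have sgs: "sg 0 1 = (if (\<sigma> 0 = 1) = (\<sigma> 1 = 1) then 1 else - 1)"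
      "sg 0 2 = (if (\<sigma> 0 = 1) = (\<sigma> 2 = 1) then - 1 else 1)"
      "sg 1 2 = (if (\<sigma> 1 = 1) = (\<sigma> 2 = 1) then - 1 else 1)"
      using \<sigma>[of 0] \<sigma>[of 1] \<sigma>[of 2] by (auto simp: sg_def)
    obtain M0 M1 M2 M0' M1' M2' where nv:
      "?N 0 v M0 v (- a) a" "?N 1 v M1 v 0 a" "?N 2 v M2 v (- a) 0"
      "?N 0 v M0' v' (- a) a" "?N 1 v M1' v' (- a) 0" "?N 2 v M2' v' 0 a"
      using nodes[OF v] by (elim exE conjE)
    obtain L0 L1 L2 L0' L1' L2' where nw:
      "?N 0 w L0 w (- a) a" "?N 1 w L1 w 0 a" "?N 2 w L2 w (- a) 0"
      "?N 0 w L0' w' (- a) a" "?N 1 w L1' w' (- a) 0" "?N 2 w L2' w' 0 a"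
      using nodes[OF w] by (elim exE conjE)
    note xs = xi mult_1 mult_minus1 minus_minus minus_zero mult_zero_right
    note cs = cons[OF v in_ov(1), unfolded xs] cons[OF v in_ov(2), unfolded xs] cons[OF v
        in_ov(3), unfolded xs]
      cons[OF w in_ov(1), unfolded xs] cons[OF w in_ov(2), unfolded xs] cons[OF w in_ov(3),
          unfolded xs]
    show ?thesis
      unfolding sum unfolding pt_def fst_conv snd_conv xs
      by (rule triangle_terms_agree[OF nv nw cs(1,3,5,2,4,6) cs(7,9,11,8,10,12) sgs])
  qed
qed

lemma pairing_corresponding:
  assumes v: "corresponding v v'" and w: "corresponding w w'"
  shows "diagram_pairing D v w = diagram_pairing E v' w'"
proof -
  have inner: "pairing (pt z ` ov) (crossing_sign X) u u' =
      (\<Sum>p\<in>ov. chord_term (sg (fst p) (snd p)) (pt z p) u u')"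
    if "z \<in> {1, - 1}" "\<And>i j. (i, j) \<in> ov \<Longrightarrow> crossing_sign X (pt z (i, j)) = sg i j" for z X u u'
  proof -
    have "crossing_sign X (pt z p) = sg (fst p) (snd p)" if "p \<in> ov" for p
      using \<open>\<And>i j. (i, j) \<in> ov \<Longrightarrow> crossing_sign X (pt z (i, j)) = sg i j\<close>[of "fst p" "snd p"] that
          by simp
    then show ?thesis
      unfolding pairing_def sum.reindex[OF pt_inj[OF that(1)]] comp_def by (intro sum.cong refl)
          simp
  qed
  have "pairing Out (crossing_sign D) v w = pairing Out (crossing_sign E) v' w'"
  proof (rule pairing_cong)
    fix c \<delta> t assume "c \<in> Out" "t \<in> {fst c, snd c}"
    then have "weakly_outside t" using Out[of c] outside_weakly by auto
    then show "v \<delta> t = v' \<delta> t" "w \<delta> t = w' \<delta> t" using v w by (simp_all add: corresponding_def)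
  qed (simp add: sign_Out)
  moreover have z: "(1 :: real) \<in> {1, - 1}" "(- 1 :: real) \<in> {1, - 1}" by auto
  ultimately show ?thesis
    unfolding crossings_D crossings_E
    by (simp only: pairing_union[OF finite_Out finite_imageI[OF finite_ov] pt_disjoint[OF z(1)]]
        pairing_union[OF finite_Out finite_imageI[OF finite_ov] pt_disjoint[OF z(2)]]
        inner[OF z(1) sign_D] inner[OF z(2) sign_E] triangle_contribution[OF v w])
qed

definition transport :: "real \<times> real \<Rightarrow> real \<times> real" where
  "transport c = (if c \<in> Out then c else pt (- 1) (inv_into ov (pt 1) c))"

lemma transport_pt: "p \<in> ov \<Longrightarrow> transport (pt 1 p) = pt (- 1) p"
  using pt_disjoint[of 1] by (auto simp: transport_def inv_into_f_f[OF pt_inj])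

lemma transport_Out: "c \<in> Out \<Longrightarrow> transport c = c"
  by (simp add: transport_def)

lemma transport_bij: "bij_betw transport (crossings D) (crossings E)"
  unfolding crossings_D crossings_E
proof (rule bij_betw_combine)
  show "bij_betw transport Out Out" by (simp add: bij_betw_cong[of Out transport id] transport_Out)
  have "bij_betw (pt (- 1) \<circ> inv_into ov (pt 1)) (pt 1 ` ov) (pt (- 1) ` ov)"
    by (rule bij_betw_trans[OF bij_betw_inv_into]) (auto simp: bij_betw_def pt_inj)
  then show "bij_betw transport (pt 1 ` ov) (pt (- 1) ` ov)"
    by (rule bij_betw_cong[THEN iffD1, rotated]) (auto simp: transport_pt inv_into_f_f[OF pt_inj])
  show "Out \<inter> pt (- 1) ` ov = {}" by (rule pt_disjoint) simp
qed

lemma corresponding_loop: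
  assumes c: "c \<in> crossings D" shows "corresponding (loop c) (loop (transport c))"
  unfolding corresponding_def
proof (intro conjI allI impI)
  show "cycle_on (crossings D) (loop c)" by (rule cycle_on_loop[OF chords_D c])
  show "cycle_on (crossings E) (loop (transport c))"
    by (rule cycle_on_loop[OF chords_E]) (use c transport_bij in \<open>auto simp: bij_betw_def\<close>)
  fix \<delta> t assume t: "weakly_outside t"
  show "loop c \<delta> t = loop (transport c) \<delta> t"
  proof (cases "c \<in> Out")
    case True then show ?thesis by (simp add: transport_Out)
  next
    case False
    then obtain p where p: "p \<in> ov" "c = pt 1 p" using c crossings_D by blast
    have l: "fst p < 3" "snd p < 3" using ov_less[of "fst p" "snd p"] p by auto
    have z: "\<bar>1 * \<xi> (fst p) (snd p)\<bar> < 1" "\<bar>- 1 * \<xi> (fst p) (snd p)\<bar> < 1" by (rule abs_xi; simp)+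
    show ?thesis
      unfolding p(2) transport_pt[OF p(1)]
      by (rule loop_agree) (simp_all only: pt_def fst_conv snd_conv node_less[OF l(1) z t]
          node_less[OF l(2) z t])
  qed
qed

lemma corresponding_whole: "corresponding whole whole"
  by (simp add: corresponding_def cycle_on_whole)

lemma triangle_same_chord_sums: "same_chord_sums D E"
proof (rule same_chord_sums_bij[OF transport_bij])
  fix c assume c: "c \<in> crossings D"
  show "index E (transport c) = index D c"
    unfolding index_def by (rule pairing_corresponding[OF corresponding_loop[OF c]
        corresponding_whole, symmetric])
  show "linking E (transport c) (transport d) = linking D c d" if "d \<in> crossings D" for d
    unfolding linking_def
    by (rule pairing_corresponding[OF corresponding_loop[OF c] corresponding_loop[OF that],
        symmetric])
  have "crossing_type (transport c) = crossing_type c \<and> crossing_sign E (transport c) =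
      crossing_sign D c"
  proof (cases "c \<in> Out")
    case True then show ?thesis by (simp add: transport_Out sign_Out)
  next
    case False
    then obtain p where p: "p \<in> ov" "c = pt 1 p" using c crossings_D by blast
    have l: "fst p < 3" "snd p < 3" "fst p \<noteq> snd p" using ov_less[of "fst p" "snd p"] p by auto
    have z: "\<bar>1 * \<xi> (fst p) (snd p)\<bar> < 1" "\<bar>- 1 * \<xi> (fst p) (snd p)\<bar> < 1" by (rule abs_xi; simp)+
    have "crossing_type (pt 1 p) = crossing_type (pt (- 1) p)"
      unfolding crossing_type_def pt_def fst_conv snd_conv node_order[OF l z(1) z(1)]
          node_order[OF l z(2) z(2)] ..
    moreover have "crossing_sign E (pt (- 1) p) = crossing_sign D (pt 1 p)"
      using sign_D[of "fst p" "snd p"] sign_E[of "fst p" "snd p"] p(1) by simp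
    ultimately show ?thesis unfolding p(2) transport_pt[OF p(1)] by simp
  qed
  then show "crossing_type (transport c) = crossing_type c" "crossing_sign E (transport c) =
      crossing_sign D c"
    by auto
qed

end

text \<open>
  The diagram \<open>D\<close> has two further crossings, of the arcs \<open>i\<close> and \<open>j\<close> at the coordinates \<open>-b\<close> and
  \<open>b\<close>, with the arc \<open>i\<close> over the arc \<open>j\<close>.
\<close>

locale bigon_move = disjoint_arcs 2 m \<sigma> for m \<sigma> +
  fixes D E :: lv_diagram and b :: real and i j :: nat and p q p' q' :: real
  defines p: "p \<equiv> node i (- b)" and q: "q \<equiv> node i b"
    and p': "p' \<equiv> node j (- b)" and q': "q' \<equiv> node j b"
  assumes b: "0 < b" "b < 1"
    and ij: "(i, j) = (0, 1) \<or> (i, j) = (1, 0)"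
    and crossings_D: "crossings D = crossings E \<union> {(p, p'), (q, q')}"
    and Out: "\<And>c. c \<in> crossings E \<Longrightarrow> outside (fst c) \<and> outside (snd c)"
    and sign_E: "\<And>c. c \<in> crossings E \<Longrightarrow> crossing_sign E c = crossing_sign D c"
    and sign_D: "crossing_sign D (q, q') = - crossing_sign D (p, p')"
    and chords_D: "chord_diagram (crossings D)" and chords_E: "chord_diagram (crossings E)"
begin

lemma ij_less: "i < 2" "j < 2" "i \<noteq> j"
  using ij by auto

lemma p_neq_q: "p \<noteq> q" "(p, p') \<noteq> (q, q')"
  using node_inj[OF ij_less(1) ij_less(1), of "- b" b] b by (auto simp: p q)

lemma inner_disjoint: "crossings E \<inter> {(p, p'), (q, q')} = {}"
proof -
  have "\<not> outside p" "\<not> outside q" using node_not_outside[OF ij_less(1)] b by (auto simp: p q)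
  then show ?thesis using Out by fastforce
qed

lemma finite_E: "finite (crossings E)"
  using chords_E by (simp add: chord_diagram_def)

lemma pairing_split: "diagram_pairing D v w =
    pairing (crossings E) (crossing_sign D) v w
    + (chord_term (crossing_sign D (p, p')) (p, p') v w + chord_term (- crossing_sign D (p, p'))
        (q, q') v w)"
proof -
  have "pairing {(p, p'), (q, q')} (crossing_sign D) v w =
      chord_term (crossing_sign D (p, p')) (p, p') v w + chord_term (- crossing_sign D (p, p'))
          (q, q') v w"
    using p_neq_q sign_D by (simp add: pairing_def)
  moreover have "diagram_pairing D v w =
      pairing (crossings E) (crossing_sign D) v w + pairing {(p, p'), (q, q')} (crossing_sign D) v
          w"
    unfolding crossings_D by (rule pairing_union[OF finite_E _ inner_disjoint]) simp
  ultimately show ?thesis by simp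
qed

lemma ends_arc: "ends (crossings D) \<inter> {m i - 1..m i + 1} \<subseteq> {m i + \<sigma> i * - b, m i + \<sigma> i * b}"
    "ends (crossings D) \<inter> {m j - 1..m j + 1} \<subseteq> {m j + \<sigma> j * - b, m j + \<sigma> j * b}"
    "l < 2 \<Longrightarrow> ends (crossings E) \<inter> {m l - 1<..<m l + 1} = {}"
proof -
  have E: "t \<notin> {m l - 1..m l + 1}" if "t \<in> ends (crossings E)" "l < 2" for t l
    using that Out outside_interval by (auto simp: ends_def)
  have other: "node l x \<notin> {m k - 1..m k + 1}" if "x \<in> {b, - b}" "l < 2" "k < 2" "l \<noteq> k" for x l k
    using node_other[OF that(2-4), of x] that(1) b by auto
  have D: "ends (crossings D) = ends (crossings E) \<union> {p, q, p', q'}"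
    unfolding crossings_D by (auto simp: ends_def)
  show "ends (crossings D) \<inter> {m i - 1..m i + 1} \<subseteq> {m i + \<sigma> i * - b, m i + \<sigma> i * b}"
    unfolding D using E[OF _ ij_less(1)] other[of b j i] other[of "- b" j i] ij_less
    by (auto simp: p q p' q' node_def[of i])
  show "ends (crossings D) \<inter> {m j - 1..m j + 1} \<subseteq> {m j + \<sigma> j * - b, m j + \<sigma> j * b}"
    unfolding D using E[OF _ ij_less(2)] other[of b i j] other[of "- b" i j] ij_less
    by (auto simp: p q p' q' node_def[of j])
  show "ends (crossings E) \<inter> {m l - 1<..<m l + 1} = {}" if "l < 2"
    using E that by force
qed

lemma nodes:
  assumes "cycle_on (crossings D) v"
  obtains M M' where
    "two_nodes (\<sigma> i = 1) (v After (m i - 1)) M (v Before (m i + 1)) v p q"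
    "two_nodes (\<sigma> j = 1) (v After (m j - 1)) M' (v Before (m j + 1)) v p' q'"
proof -
  have f: "flat (ends (crossings D)) v" using assms by (simp add: cycle_on_def)
  have s: "\<sigma> i \<in> {1, - 1}" "\<sigma> j \<in> {1, - 1}" using \<sigma> ij_less by auto
  have bb: "- 1 < - b" "- b < b" "b < 1" using b by auto
  obtain M where 1: "two_nodes (\<sigma> i = 1) (v After (m i - 1)) M (v Before (m i + 1)) v p q"
    unfolding p q node_def by (rule two_nodesI[OF f ends_arc(1) s(1) bb])
  obtain M' where 2: "two_nodes (\<sigma> j = 1) (v After (m j - 1)) M' (v Before (m j + 1)) v p' q'"
    unfolding p' q' node_def by (rule two_nodesI[OF f ends_arc(2) s(2) bb])
  show thesis by (rule that[OF 1 2])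
qed

lemma conserved_nodes:
  assumes "cycle_on (crossings D) v"
  shows "chord_conserved v p p'" "chord_conserved v q q'"
  using cycle_on_conserved[OF assms] unfolding chord_conserved_def crossings_D by blast+

lemma sign_cases: "crossing_sign D (p, p') = 1 \<or> crossing_sign D (p, p') = - 1"
  by (rule crossing_sign_cases)

lemma pairing_agree:
  assumes v: "cycle_on (crossings D) v" "cycle_on (crossings E) v"
    and w: "cycle_on (crossings D) w" "cycle_on (crossings E) w"
  shows "diagram_pairing D v w = diagram_pairing E v w"
proof -
  have eq: "u After (m l - 1) = u Before (m l + 1)" if "cycle_on (crossings E) u" "l < 2" for u l
    by (rule no_node[OF _ ends_arc(3)[OF that(2)]]) (use that(1) in \<open>simp add: cycle_on_def\<close>)
  obtain M M' where 1: "two_nodes (\<sigma> i = 1) (v After (m i - 1)) M (v Before (m i + 1)) v p q"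
    "two_nodes (\<sigma> j = 1) (v After (m j - 1)) M' (v Before (m j + 1)) v p' q'" by (rule nodes[OF
        v(1)])
  obtain L L' where 2: "two_nodes (\<sigma> i = 1) (w After (m i - 1)) L (w Before (m i + 1)) w p q"
    "two_nodes (\<sigma> j = 1) (w After (m j - 1)) L' (w Before (m j + 1)) w p' q'" by (rule nodes[OF
        w(1)])
  have "chord_term (crossing_sign D (p, p')) (p, p') v w + chord_term (- crossing_sign D (p, p'))
      (q, q') v w = 0"
    by (rule bigon_terms_agree[OF sign_cases 1[unfolded eq[OF v(2) ij_less(1)] eq[OF v(2)
        ij_less(2)]]
        2[unfolded eq[OF w(2) ij_less(1)] eq[OF w(2) ij_less(2)]] conserved_nodes[OF v(1)]
            conserved_nodes[OF w(1)]])
  moreover have "pairing (crossings E) (crossing_sign D) v w = diagram_pairing E v w"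
    by (rule pairing_cong) (simp_all add: sign_E)
  ultimately show ?thesis unfolding pairing_split by simp
qed

lemma pairing_inside:
  assumes v: "cycle_on (crossings D) v" "\<And>\<delta> t. weakly_outside t \<Longrightarrow> v \<delta> t = 0"
    and w: "cycle_on (crossings D) w"
  shows "diagram_pairing D v w = 0" "diagram_pairing D w v = 0"
proof -
  have eq: "v After (m l - 1) = 0" "v Before (m l + 1) = 0" if "l < 2" for l
    using v(2) boundary_weakly_outside[OF that] by simp_all
  obtain M M' where 1: "two_nodes (\<sigma> i = 1) (v After (m i - 1)) M (v Before (m i + 1)) v p q"
    "two_nodes (\<sigma> j = 1) (v After (m j - 1)) M' (v Before (m j + 1)) v p' q'" by (rule nodes[OF
        v(1)])
  obtain L L' where 2: "two_nodes (\<sigma> i = 1) (w After (m i - 1)) L (w Before (m i + 1)) w p q"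
    "two_nodes (\<sigma> j = 1) (w After (m j - 1)) L' (w Before (m j + 1)) w p' q'" by (rule nodes[OF
        w(1)])
  note I = bigon_terms_inside[OF sign_cases 1[unfolded eq[OF ij_less(1)] eq[OF ij_less(2)]]
      2 conserved_nodes[OF v(1)] conserved_nodes[OF w(1)]]
  have z: "v \<delta> (fst c) = 0" "v \<delta> (snd c) = 0" if "c \<in> crossings E" for c \<delta>
    using v(2) Out[OF that] outside_weakly by blast+
  have "pairing (crossings E) (crossing_sign D) v w = 0" "pairing (crossings E) (crossing_sign D)
      w v = 0"
    unfolding pairing_def by (rule sum.neutral, simp add: z chord_term_def case_prod_beta)+
  then show "diagram_pairing D v w = 0" "diagram_pairing D w v = 0"
    unfolding pairing_split using I by simp_all
qed

lemma cycle_on_loop_E: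
  assumes "c \<in> crossings E" shows "cycle_on (crossings D) (loop c)" "cycle_on (crossings E) (loop
      c)"
  using assms cycle_on_loop[OF chords_D] cycle_on_loop[OF chords_E] crossings_D by auto

text \<open>
  The loops of the two chords differ by a cycle that does not leave the bigon, so the chords have
  the same index and the same linking numbers. As their signs are opposite, they cancel.
\<close>

lemma bigon_same_chord_sums: "same_chord_sums D E"
proof (rule same_chord_sums_drop[OF _ crossings_D inner_disjoint sign_E])
  show "finite (crossings D)" using chords_D by (simp add: chord_diagram_def)
  show "index E c = index D c" if "c \<in> crossings E" for c
    unfolding index_def
    by (rule pairing_agree[OF cycle_on_loop_E[OF that] cycle_on_whole cycle_on_whole, symmetric])
  show "linking E c d = linking D c d" if "c \<in> crossings E" "d \<in> crossings E" for c d
    unfolding linking_def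
    by (rule pairing_agree[OF cycle_on_loop_E[OF that(1)] cycle_on_loop_E[OF that(2)], symmetric])
  define v where "v \<delta> t = loop (p, p') \<delta> t - loop (q, q') \<delta> t" for \<delta> t
  have in_D: "(p, p') \<in> crossings D" "(q, q') \<in> crossings D" by (simp_all add: crossings_D)
  have v: "cycle_on (crossings D) v"
    unfolding v_def[abs_def] by (intro cycle_on_diff cycle_on_loop[OF chords_D] in_D)
  have bb: "\<bar>- b\<bar> < 1" "\<bar>b\<bar> < 1" using b by auto
  have v0: "v \<delta> t = 0" if "weakly_outside t" for \<delta> t
  proof -
    have "loop (p, p') \<delta> t = loop (q, q') \<delta> t"
      by (rule loop_agree) (simp_all only: p q p' q' fst_conv snd_conv
          node_less[OF ij_less(1) bb that] node_less[OF ij_less(2) bb that])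
    then show ?thesis by (simp add: v_def)
  qed
  have d: "diagram_pairing D (loop (p, p')) w = diagram_pairing D (loop (q, q')) w"
    "diagram_pairing D w (loop (p, p')) = diagram_pairing D w (loop (q, q'))"
    if w: "cycle_on (crossings D) w" for w
    using pairing_inside[OF v v0 w] unfolding v_def[abs_def] pairing_diff_left pairing_diff_right
        by simp_all
  have "crossing_type (p, p') = crossing_type (q, q')"
    unfolding crossing_type_def fst_conv snd_conv p q p' q' node_order[OF ij_less bb(1) bb(1)]
        node_order[OF ij_less bb(2) bb(2)] ..
  then show "(\<exists>x. {(p, p'), (q, q')} = {x} \<and> index D x = 0 \<and> (\<forall>d\<in>crossings D. linking D x d = 0 \<and>
      linking D d x = 0)) \<or>
      (\<exists>x y. {(p, p'), (q, q')} = {x, y} \<and> x \<noteq> y \<and> crossing_type x = crossing_type y \<and>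
        crossing_sign D x = - crossing_sign D y \<and> index D x = index D y \<and>
        (\<forall>d\<in>crossings D. linking D x d = linking D y d \<and> linking D d x = linking D d y))"
    using p_neq_q(2) sign_D d cycle_on_whole cycle_on_loop[OF chords_D]
    by (intro disjI2 exI[of _ "(p, p')"] exI[of _ "(q, q')"]) (simp add: index_def linking_def)
qed

end

text \<open>
  The diagram \<open>D\<close> has one further crossing, of a single arc with itself.
\<close>

locale kink_move = disjoint_arcs 1 m \<sigma> for m \<sigma> +
  fixes D E :: lv_diagram and x y :: real
  assumes xy: "\<bar>x\<bar> < 1" "\<bar>y\<bar> < 1" "x \<noteq> y"
    and crossings_D: "crossings D = crossings E \<union> {(node 0 x, node 0 y)}"
    and Out: "\<And>c. c \<in> crossings E \<Longrightarrow> outside (fst c) \<and> outside (snd c)"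
    and sign_E: "\<And>c. c \<in> crossings E \<Longrightarrow> crossing_sign E c = crossing_sign D c"
    and chords_D: "chord_diagram (crossings D)" and chords_E: "chord_diagram (crossings E)"
begin

definition kink :: "real \<times> real" where
  "kink = (node 0 x, node 0 y)"

lemma kink_neq: "fst kink \<noteq> snd kink"
  using node_inj[of 0 0 x y] xy by (auto simp: kink_def)

lemma inner_disjoint: "crossings E \<inter> {kink} = {}"
  using node_not_outside[of 0 x] xy Out[of kink] by (auto simp: kink_def)

lemma finite_E: "finite (crossings E)"
  using chords_E by (simp add: chord_diagram_def)

lemma pairing_split: "diagram_pairing D v w =
    diagram_pairing E v w + chord_term (crossing_sign D kink) kink v w"
proof -
  have "pairing (crossings E) (crossing_sign D) v w = diagram_pairing E v w"
    by (rule pairing_cong) (simp_all add: sign_E)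
  moreover have "diagram_pairing D v w =
      pairing (crossings E) (crossing_sign D) v w + pairing {kink} (crossing_sign D) v w"
    unfolding crossings_D kink_def[symmetric] by (rule pairing_union[OF finite_E _
        inner_disjoint]) simp
  ultimately show ?thesis by (simp add: pairing_def)
qed

text \<open>
  No chord of \<open>E\<close> ends inside the kink.
\<close>

lemma constant_at_kink:
  assumes v: "cycle_on (crossings E) v"
  shows "\<exists>k. \<forall>\<delta>. v \<delta> (fst kink) = k \<and> v \<delta> (snd kink) = k"
proof -
  have E: "t \<notin> {m 0 - 1..m 0 + 1}" if "t \<in> ends (crossings E)" for t
    using that Out outside_interval[of _ 0] by (auto simp: ends_def)
  have f: "flat (ends (crossings E)) v" using v by (simp add: cycle_on_def)
  have i: "m 0 - 1 < s \<and> s < m 0 + 1" if "s \<in> {fst kink, snd kink}" for s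
    using that node_interval[of 0] xy by (auto simp: kink_def)
  have "v \<delta> s = v After (m 0 - 1)" if "s \<in> {fst kink, snd kink}" for \<delta> s
  proof -
    have "s \<notin> ends (crossings E)" "ends (crossings E) \<inter> {m 0 - 1<..<s} = {}"
      using i[OF that] E by force+
    then have "v Before s = v After s" "v After (m 0 - 1) = v Before s"
      using f i[OF that] unfolding flat_def by blast+
    then show ?thesis by (cases \<delta>) simp_all
  qed
  then show ?thesis by blast
qed

lemma pairing_agree:
  assumes v: "cycle_on (crossings E) v" and w: "cycle_on (crossings E) w"
  shows "diagram_pairing D v w = diagram_pairing E v w"
proof -
  obtain k where "\<forall>\<delta>. v \<delta> (fst kink) = k \<and> v \<delta> (snd kink) = k" using constant_at_kink[OF v] by blast
  moreover obtain l where "\<forall>\<delta>. w \<delta> (fst kink) = l \<and> w \<delta> (snd kink) = l" using constant_at_kink[OF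
      w] by blast
  ultimately show ?thesis unfolding pairing_split by (simp add: chord_term_def case_prod_beta)
qed

lemma pairing_kink:
  assumes w: "cycle_on (crossings E) w"
  shows "diagram_pairing D (loop kink) w = 0"
    "diagram_pairing D w (loop kink) = 0"
proof -
  obtain k where "\<forall>\<delta>. w \<delta> (fst kink) = k \<and> w \<delta> (snd kink) = k" using constant_at_kink[OF w] by blast
  then have k: "w \<delta> (fst kink) = k" "w \<delta> (snd kink) = k" for \<delta> by simp_all
  have i: "m 0 - 1 < s \<and> s < m 0 + 1" if "s \<in> {fst kink, snd kink}" for s
    using that node_interval[of 0] xy by (auto simp: kink_def)
  have z: "loop kink \<delta> t = 0" if "outside t" for \<delta> t
  proof -
    have "t < m 0 - 1 \<or> m 0 + 1 < t" using outside_interval[OF that, of 0] by auto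
    then show ?thesis using i[of "fst kink"] i[of "snd kink"] by (cases \<delta>) (auto simp: loop_def)
  qed
  have "diagram_pairing E (loop kink) w = 0"
    "diagram_pairing E w (loop kink) = 0"
    unfolding pairing_def
    by (rule sum.neutral, rule ballI, drule Out, simp add: z chord_term_def case_prod_beta)+
  moreover have "chord_term e kink (loop kink) w = 0" "chord_term e kink w (loop kink) = 0" for e
    using kink_neq by (auto simp: chord_term_def case_prod_beta k loop_def)
  ultimately show "diagram_pairing D (loop kink) w = 0"
    "diagram_pairing D w (loop kink) = 0"
    unfolding pairing_split by simp_all
qed

lemma kink_same_chord_sums: "same_chord_sums D E"
proof (rule same_chord_sums_drop[OF _ crossings_D[folded kink_def] inner_disjoint sign_E])
  show "finite (crossings D)" using chords_D by (simp add: chord_diagram_def)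
  note loop_E = cycle_on_loop[OF chords_E]
  show "index E c = index D c" if "c \<in> crossings E" for c
    unfolding index_def by (rule pairing_agree[OF loop_E[OF that] cycle_on_whole, symmetric])
  show "linking E c d = linking D c d" if "c \<in> crossings E" "d \<in> crossings E" for c d
    unfolding linking_def by (rule pairing_agree[OF loop_E[OF that(1)] loop_E[OF that(2)],
        symmetric])
  have in_D: "kink \<in> crossings D" by (simp add: crossings_D kink_def)
  have "linking D kink d = 0 \<and> linking D d kink = 0" if "d \<in> crossings D" for d
  proof (cases "d = kink")
    case True then show ?thesis unfolding linking_def True using pairing_loop_self[OF chords_D
        in_D] by simp
  next
    case False
    then have "d \<in> crossings E" using that crossings_D kink_def by auto
    then show ?thesis unfolding linking_def using pairing_kink[OF loop_E] by blast
  qed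
  moreover have "index D kink = 0" unfolding index_def by (rule pairing_kink(1)[OF cycle_on_whole])
  ultimately show "(\<exists>x. {kink} = {x} \<and> index D x = 0 \<and> (\<forall>d\<in>crossings D. linking D x d = 0 \<and>
      linking D d x = 0)) \<or>
      (\<exists>x y. {kink} = {x, y} \<and> x \<noteq> y \<and> crossing_type x = crossing_type y \<and>
        crossing_sign D x = - crossing_sign D y \<and> index D x = index D y \<and>
        (\<forall>d\<in>crossings D. linking D x d = linking D y d \<and> linking D d x = linking D d y))"
    by (intro disjI1 exI[of _ kink]) simp
qed

end

section \<open>Geometry of diagrams\<close>

lemma crossing_points:
  assumes "long_virtual_knot_diagram D" "c \<in> crossings D"
  shows "fst c \<noteq> snd c" "curve D (fst c) = curve D (snd c)" "(snd c, fst c) \<notin> crossings D"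
proof -
  have *: "\<forall>(s, u) \<in> crossings D. s \<noteq> u \<and> curve D s = curve D u \<and> (u, s) \<notin> crossings D"
    using assms(1) unfolding long_virtual_knot_diagram_def by blast
  from bspec[OF * assms(2)]
  show "fst c \<noteq> snd c" "curve D (fst c) = curve D (snd c)" "(snd c, fst c) \<notin> crossings D"
    by (simp_all add: case_prod_beta)
qed

lemma no_triple_point:
  assumes D: "long_virtual_knot_diagram D" and "curve D r = curve D s" "curve D r = curve D t"
    and "r \<noteq> s" "r \<noteq> t"
  shows "s = t"
proof (rule ccontr)
  assume "s \<noteq> t"
  have T: "\<not> (curve D x = curve D y \<and> curve D y = curve D z)" if "x < y" "y < z" for x y z
    using D that unfolding long_virtual_knot_diagram_def by blast
  have "r < s \<or> s < r" "r < t \<or> t < r" "s < t \<or> t < s" using assms(4,5) \<open>s \<noteq> t\<close> by auto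
  then show False
    using T[of r s t] T[of r t s] T[of s r t] T[of s t r] T[of t r s] T[of t s r] assms(2,3) by argo
qed

lemma chord_diagram_crossings:
  assumes D: "long_virtual_knot_diagram D"
  shows "chord_diagram (crossings D)"
  unfolding chord_diagram_def
proof (intro conjI ballI impI)
  define S where "S = {(s, t). s < t \<and> curve D s = curve D t}"
  have "finite S" using D unfolding long_virtual_knot_diagram_def S_def by blast
  moreover have "crossings D \<subseteq> S \<union> prod.swap ` S"
  proof
    fix c assume c: "c \<in> crossings D"
    note p = crossing_points[OF D c]
    have "c \<in> S \<or> prod.swap c \<in> S" using p by (cases c) (auto simp: S_def)
    then show "c \<in> S \<union> prod.swap ` S" by (metis UnI1 UnI2 image_eqI swap_swap)
  qed
  ultimately show "finite (crossings D)" by (meson finite_UnI finite_imageI finite_subset)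
  show "fst c \<noteq> snd c" if "c \<in> crossings D" for c using crossing_points[OF D that] by blast
  fix c d assume c: "c \<in> crossings D" and d: "d \<in> crossings D" and "c \<noteq> d"
  obtain s u where cs: "c = (s, u)" by fastforce
  obtain s' u' where ds: "d = (s', u')" by fastforce
  have C: "s \<noteq> u" "curve D s = curve D u" "(u, s) \<notin> crossings D"
    using crossing_points[OF D c] by (simp_all add: cs)
  have D': "s' \<noteq> u'" "curve D s' = curve D u'" "(u', s') \<notin> crossings D"
    using crossing_points[OF D d] by (simp_all add: ds)
  have "s \<noteq> s'" using no_triple_point[OF D, of s u u'] C D' \<open>c \<noteq> d\<close> cs ds by auto
  moreover have "u \<noteq> u'" using no_triple_point[OF D, of u s s'] C D' \<open>c \<noteq> d\<close> cs ds by auto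
  moreover have "s \<noteq> u'" using no_triple_point[OF D, of s u s'] C D' c d cs ds by auto
  moreover have "u \<noteq> s'" using no_triple_point[OF D, of u s u'] C D' c d cs ds by auto
  ultimately show "{fst c, snd c} \<inter> {fst d, snd d} = {}" by (simp add: cs ds)
qed

lemma velocity_local:
  assumes "open U" "t \<in> U" "\<And>s. s \<in> U \<Longrightarrow> curve D s = curve E s"
  shows "velocity D t = velocity E t"
proof -
  have "(curve D has_vector_derivative d) (at t) \<longleftrightarrow> (curve E has_vector_derivative d) (at t)" for d
    using has_vector_derivative_transform_within_open[OF _ assms(1,2), of "curve D" d "curve E"]
      has_vector_derivative_transform_within_open[OF _ assms(1,2), of "curve E" d "curve D"]
          assms(3) by auto
  then show ?thesis by (simp add: velocity_def vector_derivative_def)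
qed

text \<open>
  The content of the geometric description of a move, for arcs that stay inside the square. A
  parameter is outside iff its point is not in the square, so crossings inside the square are
  crossings of arcs.
\<close>

locale replaced_arcs = disjoint_arcs k m \<sigma> for k m \<sigma> +
  fixes P Q :: "nat \<Rightarrow> real \<Rightarrow> complex" and D E :: lv_diagram
  assumes arcs: "\<And>i x. i < k \<Longrightarrow> \<bar>x\<bar> \<le> 1 \<Longrightarrow> curve D (m i + \<sigma> i * x) = P i x \<and> curve E (m i + \<sigma> i * x)
      = Q i x"
    and outside_arcs: "\<And>t. (\<forall>i<k. 1 < \<bar>t - m i\<bar>) \<Longrightarrow> curve D t = curve E t \<and> curve D t \<notin> move_square"
    and outer: "\<And>s u. curve D s \<notin> move_square \<Longrightarrow> (s, u) \<in> crossings D \<longleftrightarrow> (s, u) \<in> crossings E"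
    and square: "\<And>i x. i < k \<Longrightarrow> \<bar>x\<bar> \<le> 1 \<Longrightarrow> P i x \<in> move_square \<and> Q i x \<in> move_square"
    and diagrams: "long_virtual_knot_diagram D" "long_virtual_knot_diagram E"
begin

lemma inside_node: assumes "\<not> outside t" obtains i x where "i < k" "\<bar>x\<bar> \<le> 1" "t = node i x"
proof -
  obtain i where i: "i < k" "\<bar>t - m i\<bar> \<le> 1" using assms by (auto simp: outside_def not_less)
  have "t = node i (\<sigma> i * (t - m i))" "\<bar>\<sigma> i * (t - m i)\<bar> \<le> 1"
    using \<sigma>[OF i(1)] i(2) by (auto simp: node_def)
  then show thesis using that i(1) by blast
qed

lemma outside_iff: "outside t \<longleftrightarrow> curve D t \<notin> move_square" "outside t \<longleftrightarrow> curve E t \<notin> move_square"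
proof -
  have "curve D t \<in> move_square \<and> curve E t \<in> move_square" if "\<not> outside t"
  proof -
    obtain i x where i: "i < k" "\<bar>x\<bar> \<le> 1" "t = node i x" by (rule inside_node[OF \<open>\<not> outside t\<close>])
    show ?thesis using arcs[OF i(1,2)] square[OF i(1,2)] i(3) by (simp add: node_def)
  qed
  moreover have "curve D t \<notin> move_square \<and> curve E t \<notin> move_square" if "outside t"
    using outside_arcs[of t] that unfolding outside_def by metis
  ultimately show "outside t \<longleftrightarrow> curve D t \<notin> move_square" "outside t \<longleftrightarrow> curve E t \<notin> move_square" by
      blast+
qed

lemma swapped: "replaced_arcs k m \<sigma> Q P E D"
proof
  show "curve E (m i + \<sigma> i * x) = Q i x \<and> curve D (m i + \<sigma> i * x) = P i x" if "i < k" "\<bar>x\<bar> \<le> 1"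
      for i x
    using arcs[OF that] by blast
  show "curve E t = curve D t \<and> curve E t \<notin> move_square" if "\<forall>i<k. 1 < \<bar>t - m i\<bar>" for t
    using outside_arcs[OF that] by metis
  show "(s, u) \<in> crossings E \<longleftrightarrow> (s, u) \<in> crossings D" if "curve E s \<notin> move_square" for s u
    using outer[of s u] that outside_iff by blast
  show "Q i x \<in> move_square \<and> P i x \<in> move_square" if "i < k" "\<bar>x\<bar> \<le> 1" for i x
    using square[OF that] by blast
qed (rule diagrams)+

lemma open_outside: "open {t. outside t}"
proof -
  have "open {t. 1 < \<bar>t - m i\<bar>}" for i by (intro open_Collect_less continuous_intros)
  moreover have "{t. outside t} = (\<Inter>i\<in>{..<k}. {t. 1 < \<bar>t - m i\<bar>})" by (auto simp: outside_def)
  ultimately show ?thesis by (simp add: open_INT)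
qed

lemma velocity_outside: "outside t \<Longrightarrow> velocity D t = velocity E t"
  by (rule velocity_local[OF open_outside]) (use outside_arcs in \<open>auto simp: outside_def\<close>)

lemma crossing_outside:
  assumes "c \<in> crossings D" shows "outside (fst c) \<longleftrightarrow> outside (snd c)"
  using crossing_points(2)[OF diagrams(1) assms] by (simp add: outside_iff(1))

definition outer_crossings :: "(real \<times> real) set" where
  "outer_crossings = {c \<in> crossings D. outside (fst c)}"

lemma outer_crossings_E: "outer_crossings = {c \<in> crossings E. outside (fst c)}"
  unfolding outer_crossings_def using outer outside_iff(1) by auto

lemma outer_crossings_outside: "c \<in> outer_crossings \<Longrightarrow> outside (fst c) \<and> outside (snd c)"
  unfolding outer_crossings_def using crossing_outside by blast

lemma outer_crossings_sign: "c \<in> outer_crossings \<Longrightarrow> crossing_sign E c = crossing_sign D c"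
  using outer_crossings_outside[of c] by (simp add: crossing_sign_def velocity_outside)

lemma inner_crossing:
  assumes "c \<in> crossings D" "c \<notin> outer_crossings"
  obtains i j x y where "i < k" "j < k" "\<bar>x\<bar> \<le> 1" "\<bar>y\<bar> \<le> 1" "c = (node i x, node j y)" "P i x = P
      j y"
    "(i, x) \<noteq> (j, y)"
proof -
  have no: "\<not> outside (fst c)" "\<not> outside (snd c)"
    using assms crossing_outside by (auto simp: outer_crossings_def)
  obtain i x where i: "i < k" "\<bar>x\<bar> \<le> 1" "fst c = node i x" by (rule inside_node[OF no(1)])
  obtain j y where j: "j < k" "\<bar>y\<bar> \<le> 1" "snd c = node j y" by (rule inside_node[OF no(2)])
  note cp = crossing_points[OF diagrams(1) assms(1)]
  have "P i x = P j y" using cp(2) arcs[OF i(1,2)] arcs[OF j(1,2)] i(3) j(3) by (simp add: node_def)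
  moreover have "(i, x) \<noteq> (j, y)" using cp(1) i(3) j(3) by auto
  moreover have "c = (node i x, node j y)" using i(3) j(3) by (simp add: prod_eq_iff)
  ultimately show thesis using that i(1,2) j(1,2) by blast
qed

lemma velocity_node:
  assumes i: "i < k" and x: "\<bar>x\<bar> < 1" and P: "(P i has_vector_derivative d) (at x)"
  shows "velocity D (node i x) = \<sigma> i *\<^sub>R d"
proof -
  have eq: "\<sigma> i * (node i y - m i) = y" for y using \<sigma>[OF i] by (auto simp: node_def)
  have "((\<lambda>t. \<sigma> i * (t - m i)) has_vector_derivative \<sigma> i) (at (node i x))"
    by (auto intro!: derivative_eq_intros)
  moreover have "(P i has_vector_derivative d) (at (\<sigma> i * (node i x - m i)))" using P by (simp
      add: eq)
  ultimately have "((P i \<circ> (\<lambda>t. \<sigma> i * (t - m i))) has_vector_derivative \<sigma> i *\<^sub>R d) (at (node i x))"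
    by (rule vector_diff_chain_at)
  moreover have "(P i \<circ> (\<lambda>t. \<sigma> i * (t - m i))) s = curve D s" if "s \<in> {m i - 1<..<m i + 1}" for s
  proof -
    have s: "\<bar>\<sigma> i * (s - m i)\<bar> \<le> 1" "m i + \<sigma> i * (\<sigma> i * (s - m i)) = s" using \<sigma>[OF i] that by auto
    show ?thesis using arcs[OF i s(1)] s(2) by simp
  qed
  ultimately have "(curve D has_vector_derivative \<sigma> i *\<^sub>R d) (at (node i x))"
    using has_vector_derivative_transform_within_open[of _ _ "node i x" "{m i - 1<..<m i + 1}"]
      node_interval[OF i x] by (metis greaterThanLessThan_iff open_greaterThanLessThan)
  then show ?thesis unfolding velocity_def by (rule vector_derivative_at)
qed

lemma outer_crossings_swapped: "replaced_arcs.outer_crossings k m E = outer_crossings"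
  unfolding outer_crossings_E replaced_arcs.outer_crossings_def[OF swapped] ..

lemma all_crossings_outer:
  assumes "\<And>i j x y. i < k \<Longrightarrow> j < k \<Longrightarrow> Q i x = Q j y \<Longrightarrow> (i, x) = (j, y)"
  shows "crossings E = outer_crossings"
proof -
  interpret sw: replaced_arcs k m \<sigma> Q P E D by (rule swapped)
  have "c \<in> sw.outer_crossings" if c: "c \<in> crossings E" for c
  proof (rule ccontr)
    assume "c \<notin> sw.outer_crossings"
    then show False using sw.inner_crossing[OF c] assms by metis
  qed
  then show ?thesis unfolding outer_crossings_swapped using outer_crossings_E by blast
qed

end

lemma replaced_arcsI:
  assumes R: "replace_arcs k P Q m \<sigma> D E"
    and sq: "\<And>i x. i < k \<Longrightarrow> \<bar>x\<bar> \<le> 1 \<Longrightarrow> P i x \<in> move_square \<and> Q i x \<in> move_square"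
    and D: "long_virtual_knot_diagram D" "long_virtual_knot_diagram E"
  shows "replaced_arcs k m \<sigma> P Q D E"
proof -
  have R1: "\<forall>i<k. \<sigma> i \<in> {1, - 1}"
    and R2: "\<forall>i<k. \<forall>j<k. i \<noteq> j \<longrightarrow> 2 < \<bar>m i - m j\<bar>"
    and R3: "\<forall>i<k. \<forall>x\<in>{-1..1}. curve D (m i + \<sigma> i * x) = P i x \<and> curve E (m i + \<sigma> i * x) = Q i x"
    and R4: "\<forall>t. (\<forall>i<k. 1 < \<bar>t - m i\<bar>) \<longrightarrow> curve D t = curve E t \<and> curve D t \<notin> move_square"
    and R5: "\<forall>s u. curve D s \<notin> move_square \<longrightarrow> ((s, u) \<in> crossings D \<longleftrightarrow> (s, u) \<in> crossings E)"
    using R unfolding replace_arcs_def by blast+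
  show ?thesis
  proof
    show "\<sigma> i = 1 \<or> \<sigma> i = - 1" if "i < k" for i using R1 that by simp
    show "curve D (m i + \<sigma> i * x) = P i x \<and> curve E (m i + \<sigma> i * x) = Q i x" if "i < k" "\<bar>x\<bar> \<le> 1"
        for i x
      using R3 that by (simp add: abs_le_iff)
  qed (use R2 R4 R5 sq D in blast)+
qed

section \<open>The Reidemeister moves\<close>

lemma bump_deriv: "(bump has_real_derivative - 4 * x * (1 - x\<^sup>2)) (at x)"
  unfolding bump_def[abs_def] by (auto intro!: derivative_eq_intros simp: algebra_simps
      power2_eq_square)

lemma bump_bounds: "\<bar>x\<bar> \<le> 1 \<Longrightarrow> 0 \<le> bump x \<and> bump x \<le> 1"
proof -
  assume "\<bar>x\<bar> \<le> 1"
  then have "x\<^sup>2 \<le> 1" by (simp add: abs_square_le_1)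
  then show ?thesis by (auto simp: bump_def intro!: power_le_one)
qed

lemma bump_minus: "bump (- x) = bump x"
  by (simp add: bump_def)

lemma one_minus_square_pos: "\<bar>x\<bar> < 1 \<Longrightarrow> 0 < 1 - (x :: real)\<^sup>2"
  by (simp add: abs_square_less_1)

text \<open>
  The function \<open>bump\<close> is even and decreases from \<open>1\<close> to \<open>0\<close> on the unit interval.
\<close>

lemma bump_half:
  "\<exists>b. 0 < b \<and> b < 1 \<and> (\<forall>x. \<bar>x\<bar> \<le> 1 \<longrightarrow> (bump x = 1 / 2 \<longleftrightarrow> x = b \<or> x = - b))"
proof -
  define s where "s = sqrt (1 / 2)"
  have s: "0 < s" "s < 1" "s\<^sup>2 = 1 / 2" by (simp_all add: s_def)
  define b where "b = sqrt (1 - s)"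
  have b: "0 < b" "b < 1" "b\<^sup>2 = 1 - s" using s by (simp_all add: b_def)
  have "bump x = 1 / 2 \<longleftrightarrow> x = b \<or> x = - b" if "\<bar>x\<bar> \<le> 1" for x
  proof -
    have "0 \<le> 1 - x\<^sup>2" using that by (simp add: abs_square_le_1)
    then have "bump x = 1 / 2 \<longleftrightarrow> 1 - x\<^sup>2 = s"
      unfolding bump_def s(3)[symmetric] using s(1) power2_eq_iff_nonneg[of "1 - x\<^sup>2" s] by simp
    also have "\<dots> \<longleftrightarrow> x\<^sup>2 = b\<^sup>2" using b(3) by auto
    finally show ?thesis by (simp add: power2_eq_iff)
  qed
  then show ?thesis using b(1,2) by blast
qed

text \<open>
  A root exists by the intermediate value theorem. It is unique because \<open>bump\<close> decreases on the
  unit interval and is not negative, so that there is no root to the left of \<open>0\<close>.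
\<close>

lemma bump_slope_root:
  "\<exists>a. 0 < a \<and> a < 1 \<and> (\<forall>x. \<bar>x\<bar> \<le> 1 \<longrightarrow> (bump x = 2 * x \<longleftrightarrow> x = a))"
proof -
  have c: "continuous_on {0..1} (\<lambda>x. 2 * x - bump x)"
    unfolding bump_def by (intro continuous_intros)
  have "\<exists>x\<ge>0. x \<le> 1 \<and> 2 * x - bump x = 0"
    by (rule IVT'[OF _ _ _ c]) (simp_all add: bump_def)
  then obtain a where a: "0 \<le> a" "a \<le> 1" "bump a = 2 * a" by auto
  have a': "0 < a" "a < 1" using a by (auto simp: bump_def order_less_le)
  have mono: "bump y \<le> bump x" if "0 \<le> x" "x \<le> y" "y \<le> 1" for x y
  proof -
    have "x\<^sup>2 \<le> y\<^sup>2" "y\<^sup>2 \<le> 1" using that by (auto intro: power_mono power_le_one)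
    then show ?thesis unfolding bump_def by (intro power_mono) auto
  qed
  have "bump x = 2 * x \<longleftrightarrow> x = a" if "\<bar>x\<bar> \<le> 1" for x
  proof
    assume x: "bump x = 2 * x"
    then have "0 \<le> x" using bump_bounds[OF that] by simp
    then show "x = a" using mono[of x a] mono[of a x] x a that by linarith
  qed (use a in simp)
  then show ?thesis using a' by blast
qed

lemma cross_graphs: "cross (s *\<^sub>R Complex 1 g) (t *\<^sub>R Complex 1 h) = s * t * (h - g)"
  by (simp add: cross_def algebra_simps)

lemma same_chord_sums_same:
  assumes C: "crossings D = crossings E"
    and sg: "\<And>c. c \<in> crossings E \<Longrightarrow> crossing_sign E c = crossing_sign D c"
  shows "same_chord_sums D E"
proof -
  have eq: "diagram_pairing E v w = diagram_pairing D v w" for v w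
    unfolding C by (rule pairing_cong) (simp_all add: sg)
  show ?thesis
    by (rule same_chord_sums_bij[of id]) (simp_all add: C sg index_def linking_def eq[unfolded C])
qed

text \<open>
  At a double point of the kink \<open>x\<close> and \<open>y\<close> have the same \<open>bump\<close>, and then the equality of the
  first coordinates forces \<open>bump x = 1 / 2\<close>.
\<close>

lemma move_I_same_chord_sums:
  assumes D: "long_virtual_knot_diagram D" "long_virtual_knot_diagram E" and M: "move_I D E"
  shows "same_chord_sums D E"
proof -
  define P where "P = (\<lambda>(_ :: nat) x. Complex (x - 2 * x * bump x) (bump x / 2))"
  define Q where "Q = (\<lambda>(_ :: nat) x. Complex x 0)"
  obtain m \<sigma> where R: "replace_arcs 1 P Q m \<sigma> D E" using M unfolding move_I_def P_def Q_def by blast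
  have sq: "P i x \<in> move_square \<and> Q i x \<in> move_square" if "\<bar>x\<bar> \<le> 1" for i x
  proof -
    have "\<bar>x * (1 - 2 * bump x)\<bar> \<le> 1 * 1"
      unfolding abs_mult using bump_bounds[OF that] that by (intro mult_mono) auto
    then have "\<bar>x - 2 * x * bump x\<bar> \<le> 1" by (simp add: algebra_simps)
    then show ?thesis using bump_bounds[OF that] that by (simp add: P_def Q_def move_square_def)
  qed
  interpret replaced_arcs 1 m \<sigma> P Q D E by (rule replaced_arcsI[OF R sq D])
  obtain b where b01: "0 < b" "b < 1" and b2: "\<forall>x. \<bar>x\<bar> \<le> 1 \<longrightarrow> (bump x = 1 / 2 \<longleftrightarrow> x = b \<or> x = - b)"
    using bump_half by blast
  note b = b01 b2[rule_format]
  have E: "crossings E = outer_crossings"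
    by (rule all_crossings_outer) (auto simp: Q_def split: if_splits)
  have inner: "c = (node 0 b, node 0 (- b)) \<or> c = (node 0 (- b), node 0 b)"
    if c: "c \<in> crossings D" "c \<notin> outer_crossings" for c
  proof -
    obtain i j x y where ij: "i < (1 :: nat)" "j < (1 :: nat)" "\<bar>x\<bar> \<le> 1" "\<bar>y\<bar> \<le> 1" "c = (node i x,
        node j y)"
      "P i x = P j y" "(i, x) \<noteq> (j, y)" by (rule inner_crossing[OF c])
    have e: "x - 2 * x * bump x = y - 2 * y * bump y \<and> bump x / 2 = bump y / 2"
      using ij(6) unfolding P_def complex.inject .
    have eq: "bump y = bump x" "x \<noteq> y" using e ij(1,2,7) by simp_all
    have "x - 2 * x * bump x = y - 2 * y * bump x" using conjunct1[OF e] unfolding eq(1) .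
    then have "(x - y) * (1 - 2 * bump x) = 0" by (simp add: algebra_simps)
    then have h: "bump x = 1 / 2" "bump y = 1 / 2" using eq by auto
    then show ?thesis using b(3)[OF ij(3)] b(3)[OF ij(4)] eq(2) ij by auto
  qed
  show ?thesis
  proof (cases "crossings D = outer_crossings")
    case True
    then show ?thesis using E outer_crossings_sign by (intro same_chord_sums_same) auto
  next
    case False
    then obtain c where c: "c \<in> crossings D" "c \<notin> outer_crossings"
      unfolding outer_crossings_def by blast
    obtain x where x: "x = b \<or> x = - b" "c = (node 0 x, node 0 (- x))" using inner[OF c] by
        fastforce
    have u: "d = c" if d: "d \<in> crossings D" "d \<notin> outer_crossings" for d
    proof (rule ccontr)
      assume "d \<noteq> c"
      then have "d = (snd c, fst c)" using inner[OF d] inner[OF c] by auto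
      then show False using crossing_points(3)[OF D(1) c(1)] d(1) by simp
    qed
    have "outer_crossings \<subseteq> crossings D" unfolding outer_crossings_def by blast
    then have C: "crossings D = crossings E \<union> {(node 0 x, node 0 (- x))}"
      unfolding E x(2)[symmetric] using c u by blast
    have x': "\<bar>x\<bar> < 1" "\<bar>- x\<bar> < 1" "x \<noteq> - x" using x(1) b(1,2) by auto
    have "kink_move m \<sigma> D E x (- x)"
    proof unfold_locales
      show "outside (fst c) \<and> outside (snd c)" "crossing_sign E c = crossing_sign D c"
        if "c \<in> crossings E" for c
        using outer_crossings_outside outer_crossings_sign that unfolding E by blast+
    qed (rule x' C chord_diagram_crossings[OF D(1)] chord_diagram_crossings[OF D(2)])+
    then show ?thesis by (rule kink_move.kink_same_chord_sums)
  qed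
qed

lemma sign_opposite:
  assumes "cross (velocity D s) (velocity D u) = - cross (velocity D s') (velocity D u')"
    "cross (velocity D s) (velocity D u) \<noteq> 0"
  shows "crossing_sign D (s, u) = - crossing_sign D (s', u')"
  using assms by (auto simp: crossing_sign_def)

text \<open>
  The derivative of \<open>bump\<close> is odd, so the two crossings, at \<open>b\<close> and \<open>-b\<close>, have opposite signs.
\<close>

lemma move_II_same_chord_sums:
  assumes D: "long_virtual_knot_diagram D" "long_virtual_knot_diagram E" and M: "move_II D E"
  shows "same_chord_sums D E"
proof -
  obtain m \<sigma> ov where ov: "ov \<in> {{}, {(0, 1)}, {(1, 0)}}"
    and R: "replace_arcs 2 arcs_II arcs_II' m \<sigma> D E" and O: "over_under ov 2 arcs_II m \<sigma> D"
    using M unfolding move_II_def by blast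
  have sq: "arcs_II i x \<in> move_square \<and> arcs_II' i x \<in> move_square" if "\<bar>x\<bar> \<le> 1" for i x
    using bump_bounds[OF that] that by (auto simp: arcs_II_def arcs_II'_def move_square_def)
  interpret replaced_arcs 2 m \<sigma> arcs_II arcs_II' D E by (rule replaced_arcsI[OF R sq D])
  obtain b where b01: "0 < b" "b < 1" and b2: "\<forall>x. \<bar>x\<bar> \<le> 1 \<longrightarrow> (bump x = 1 / 2 \<longleftrightarrow> x = b \<or> x = - b)"
    using bump_half by blast
  note b = b01 b2[rule_format]
  have E: "crossings E = outer_crossings"
    by (rule all_crossings_outer) (auto simp: arcs_II'_def split: if_splits)
  have over: "(node i x, node j y) \<in> crossings D \<longleftrightarrow> (i, j) \<in> ov"
    if "i < 2" "j < 2" "\<bar>x\<bar> \<le> 1" "\<bar>y\<bar> \<le> 1" "i \<noteq> j" "arcs_II i x = arcs_II j y" for i j x y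
    using O that unfolding over_under_def node_def by (auto simp: abs_le_iff)
  have inner: "\<exists>i j. (i, j) \<in> ov \<and> (c = (node i (- b), node j (- b)) \<or> c = (node i b, node j b))"
    if c: "c \<in> crossings D" "c \<notin> outer_crossings" for c
  proof -
    obtain i j x y where ij: "i < (2 :: nat)" "j < (2 :: nat)" "\<bar>x\<bar> \<le> 1" "\<bar>y\<bar> \<le> 1" "c = (node i x,
        node j y)"
      "arcs_II i x = arcs_II j y" "(i, x) \<noteq> (j, y)" by (rule inner_crossing[OF c])
    have "x = y" using ij(6) by (auto simp: arcs_II_def split: if_splits)
    then have "i \<noteq> j" using ij(7) by simp
    then have "bump x = 1 / 2" using ij(1,2,6) \<open>x = y\<close> by (auto simp: arcs_II_def split: if_splits)
    then have "x = b \<or> x = - b" using b(3)[OF ij(3)] by simp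
    moreover have "(i, j) \<in> ov" using over[OF ij(1-4) \<open>i \<noteq> j\<close> ij(6)] c(1) ij(5) by simp
    ultimately show ?thesis using ij(5) \<open>x = y\<close> by blast
  qed
  show ?thesis
  proof (cases "ov = {}")
    case True
    then have "crossings D = outer_crossings" using inner by (auto simp: outer_crossings_def)
    then show ?thesis using E outer_crossings_sign by (intro same_chord_sums_same) auto
  next
    case False
    then obtain i j where ij: "(i, j) = (0, 1) \<or> (i, j) = (1, 0)" and ov1: "ov = {(i, j)}" using
        ov by auto
    have l: "i < 2" "j < 2" "i \<noteq> j" using ij by auto
    have ab: "\<bar>- b\<bar> < 1" "\<bar>b\<bar> < 1" using b by auto
    have meet: "arcs_II i x = arcs_II j x" if "x = b \<or> x = - b" for x
      using that b(3)[of x] b(1,2) ij by (auto simp: arcs_II_def)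
    have mem: "(node i x, node j x) \<in> crossings D" if "x = b \<or> x = - b" for x
      using over[OF l(1,2) _ _ l(3) meet[OF that]] that b ov1 by auto
    have C: "crossings D = crossings E \<union> {(node i (- b), node j (- b)), (node i b, node j b)}"
    proof
      show "crossings D \<subseteq> crossings E \<union> {(node i (- b), node j (- b)), (node i b, node j b)}"
        using inner unfolding E ov1 by blast
      show "crossings E \<union> {(node i (- b), node j (- b)), (node i b, node j b)} \<subseteq> crossings D"
        using mem[of b] mem[of "- b"] unfolding E outer_crossings_def by auto
    qed
    have vel: "velocity D (node k x) = \<sigma> k *\<^sub>R Complex 1 (if k = 0 then 0 else 4 * x * (1 - x\<^sup>2))"
      if "k < 2" "\<bar>x\<bar> < 1" for k x
    proof (rule velocity_node[OF that])
      show "(arcs_II k has_vector_derivative Complex 1 (if k = 0 then 0 else 4 * x * (1 - x\<^sup>2)))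
          (at x)"
        unfolding has_vector_derivative_complex_iff arcs_II_def
        by (auto intro!: derivative_eq_intros bump_deriv)
    qed
    have cr: "cross (velocity D (node i x)) (velocity D (node j x)) =
        \<sigma> i * \<sigma> j * (if i = 0 then 4 * x * (1 - x\<^sup>2) else - (4 * x * (1 - x\<^sup>2)))" if "\<bar>x\<bar> < 1" for x
      unfolding vel[OF l(1) that] vel[OF l(2) that] cross_graphs using ij by auto
    have s: "crossing_sign D (node i b, node j b) = - crossing_sign D (node i (- b), node j (- b))"
    proof (rule sign_opposite)
      show "cross (velocity D (node i b)) (velocity D (node j b)) =
          - cross (velocity D (node i (- b))) (velocity D (node j (- b)))"
        unfolding cr[OF ab(1)] cr[OF ab(2)] by simp
      show "cross (velocity D (node i b)) (velocity D (node j b)) \<noteq> 0"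
        unfolding cr[OF ab(2)] using \<sigma>[OF l(1)] \<sigma>[OF l(2)] one_minus_square_pos[OF ab(2)] b(1) by
            auto
    qed
    have "bigon_move m \<sigma> D E b i j"
    proof unfold_locales
      show "outside (fst c) \<and> outside (snd c)" "crossing_sign E c = crossing_sign D c"
        if "c \<in> crossings E" for c
        using outer_crossings_outside outer_crossings_sign that unfolding E by blast+
    qed (rule b(1) b(2) ij C s chord_diagram_crossings[OF D(1)] chord_diagram_crossings[OF D(2)])+
    then show ?thesis by (rule bigon_move.bigon_same_chord_sums)
  qed
qed

text \<open>
  The equation \<open>z * bump x / 2 = x\<close> for the crossing of the arcs 0 and 1 becomes \<open>bump y = 2 * y\<close>
  for \<open>y = z * x\<close>, and the one for the arcs 0 and 2 becomes the same equation for \<open>y = - z * x\<close>.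
\<close>

lemma triangle_arcs_meet:
  assumes a: "\<And>x. \<bar>x\<bar> \<le> 1 \<Longrightarrow> bump x = 2 * x \<longleftrightarrow> x = a"
    and z: "z = 1 \<or> z = - 1" and ij: "i < 3" "j < 3" "i \<noteq> j" and x: "\<bar>x\<bar> \<le> 1"
  shows "arcs_III z i x = arcs_III z j y \<longleftrightarrow>
    x = y \<and> x = z * (if i + j = 1 then a else if i + j = 2 then - a else 0)"
proof -
  have zx: "\<bar>z * x\<bar> \<le> 1" "\<bar>- (z * x)\<bar> \<le> 1" "bump (z * x) = bump x" "bump (- (z * x)) = bump x"
    using z x by (auto simp: bump_minus)
  have 1: "z * bump x / 2 = x \<longleftrightarrow> x = z * a"
    using a[OF zx(1)] z zx(3) by auto
  have 2: "z * bump x / 2 = - x \<longleftrightarrow> x = z * - a"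
    using a[OF zx(2)] z zx(4) by auto
  have "i = 0 \<and> j = 1 \<or> i = 1 \<and> j = 0 \<or> i = 0 \<and> j = 2 \<or> i = 2 \<and> j = 0 \<or> i = 1 \<and> j = 2 \<or> i = 2 \<and> j
      = 1"
    using ij by auto
  then show ?thesis
    by (elim disjE conjE) (use 1 2 z in \<open>auto simp: arcs_III_def\<close>)
qed

lemma move_III_same_chord_sums:
  assumes D: "long_virtual_knot_diagram D" "long_virtual_knot_diagram E" and M: "move_III D E"
  shows "same_chord_sums D E"
proof -
  obtain m \<sigma> ov where lay: "layering_III ov"
    and R: "replace_arcs 3 (arcs_III 1) (arcs_III (- 1)) m \<sigma> D E"
    and O: "over_under ov 3 (arcs_III 1) m \<sigma> D" "over_under ov 3 (arcs_III (- 1)) m \<sigma> E"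
    using M unfolding move_III_def by blast
  have sq: "arcs_III 1 i x \<in> move_square \<and> arcs_III (- 1) i x \<in> move_square" if "\<bar>x\<bar> \<le> 1" for i x
    using bump_bounds[OF that] that by (auto simp: arcs_III_def move_square_def)
  interpret replaced_arcs 3 m \<sigma> "arcs_III 1" "arcs_III (- 1)" D E by (rule replaced_arcsI[OF R sq
      D])
  interpret sw: replaced_arcs 3 m \<sigma> "arcs_III (- 1)" "arcs_III 1" E D by (rule swapped)
  obtain a where a: "0 < a" "a < 1" and a2: "\<forall>x. \<bar>x\<bar> \<le> 1 \<longrightarrow> (bump x = 2 * x \<longleftrightarrow> x = a)"
    using bump_slope_root by blast
  note meet = triangle_arcs_meet[OF a2[rule_format]]
  interpret three_arcs m \<sigma> a by unfold_locales (rule a)+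
  have ov3: "i < 3 \<and> j < 3 \<and> i \<noteq> j" if "(i, j) \<in> ov" for i j
    using that lay unfolding layering_III_def by auto
  have xi: "\<bar>z * \<xi> i j\<bar> < 1" if "z = 1 \<or> z = - 1" for z i j
    by (rule abs_xi) (use that in simp)
  have inner: "crossings X = outer_crossings \<union> pt z ` ov"
    if z: "z = 1 \<or> z = - 1" and X: "replaced_arcs 3 m \<sigma> (arcs_III z) P X Y"
      and O: "over_under ov 3 (arcs_III z) m \<sigma> X" and out: "replaced_arcs.outer_crossings 3 m X =
          outer_crossings"
    for z X Y P
  proof -
    interpret X: replaced_arcs 3 m \<sigma> "arcs_III z" P X Y by (rule X)
    have over: "(node i x, node j y) \<in> crossings X \<longleftrightarrow> (i, j) \<in> ov"
      if "i < 3" "j < 3" "\<bar>x\<bar> \<le> 1" "\<bar>y\<bar> \<le> 1" "i \<noteq> j" "arcs_III z i x = arcs_III z j y" for i j x y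
      using O that unfolding over_under_def node_def by (auto simp: abs_le_iff)
    have sub: "c \<in> pt z ` ov" if c: "c \<in> crossings X" "c \<notin> outer_crossings" for c
    proof -
      have c': "c \<notin> X.outer_crossings" using c(2) out by simp
      obtain i j x y where ij: "i < (3 :: nat)" "j < (3 :: nat)" "\<bar>x\<bar> \<le> 1" "\<bar>y\<bar> \<le> 1" "c = (node i
          x, node j y)"
        "arcs_III z i x = arcs_III z j y" "(i, x) \<noteq> (j, y)" by (rule X.inner_crossing[OF c(1) c'])
      have "x = y" using ij(6) by (auto simp: arcs_III_def split: if_splits)
      then have ne: "i \<noteq> j" using ij(7) by simp
      have "x = z * \<xi> i j" using meet[OF _ z ij(1,2) ne ij(3), of y] ij(6) by (simp add: \<xi>_def)
      then have "c = pt z (i, j)" using ij(5) \<open>x = y\<close> by (simp add: pt_def)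
      moreover have "(i, j) \<in> ov" using over[OF ij(1-4) ne ij(6)] c(1) ij(5) by simp
      ultimately show ?thesis by (rule image_eqI)
    qed
    have mem: "pt z p \<in> crossings X" if "p \<in> ov" for p
    proof -
      obtain i j where p: "p = (i, j)" by fastforce
      have l: "i < 3" "j < 3" "i \<noteq> j" using ov3[of i j] that p by auto
      have x: "\<bar>z * \<xi> i j\<bar> \<le> 1" using xi[OF z, of i j] by simp
      have "arcs_III z i (z * \<xi> i j) = arcs_III z j (z * \<xi> i j)"
        using meet[OF _ z l x, of "z * \<xi> i j"] by (simp add: \<xi>_def)
      then show ?thesis using over[OF l(1,2) x x l(3)] that p by (simp add: pt_def)
    qed
    have "X.outer_crossings \<subseteq> crossings X" by (auto simp: X.outer_crossings_def)
    then show ?thesis using sub mem out by auto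
  qed
  have sign: "crossing_sign X (pt z (i, j)) = sg i j"
    if z: "z = 1 \<or> z = - 1" and X: "replaced_arcs 3 m \<sigma> (arcs_III z) P X Y" and ij: "(i, j) \<in> ov"
        for z X Y P i j
  proof -
    interpret X: replaced_arcs 3 m \<sigma> "arcs_III z" P X Y by (rule X)
    have l: "i < 3" "j < 3" "i \<noteq> j" using ov3[OF ij] by auto
    define x where "x = z * \<xi> i j"
    have x: "\<bar>x\<bar> < 1" unfolding x_def by (rule xi[OF z])
    define g where "g k = (if k = 0 then z * (- 4 * x * (1 - x\<^sup>2)) / 2 else if k = (1 :: nat) then
        1 else - 1)" for k
    have vel: "velocity X (node k x) = \<sigma> k *\<^sub>R Complex 1 (g k)" if "k < 3" for k
    proof (rule X.velocity_node[OF that x])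
      show "(arcs_III z k has_vector_derivative Complex 1 (g k)) (at x)"
        unfolding has_vector_derivative_complex_iff arcs_III_def g_def
        by (auto intro!: derivative_eq_intros bump_deriv)
    qed
    have sq: "0 < 1 - x\<^sup>2" by (rule one_minus_square_pos[OF x])
    have "0 < (g j - g i) * (if (i, j) \<in> {(0, 1), (2, 0), (2, 1)} then 1 else - 1)"
    proof -
      have "i = 0 \<and> j = 1 \<or> i = 1 \<and> j = 0 \<or> i = 0 \<and> j = 2 \<or> i = 2 \<and> j = 0 \<or> i = 1 \<and> j = 2 \<or> i = 2
          \<and> j = 1"
        using l by auto
      moreover define c where "c = a * (1 - a\<^sup>2)"
      moreover have "0 < c" unfolding c_def using a one_minus_square_pos[of a] by simp
      moreover have "g 0 = - 2 * c" if "i + j = 1"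
        using that z by (auto simp: g_def x_def \<xi>_def c_def field_simps)
      moreover have "g 0 = 2 * c" if "i + j = 2"
        using that z by (auto simp: g_def x_def \<xi>_def c_def field_simps)
      moreover have "g 1 = 1" "g 2 = - 1" by (simp_all add: g_def)
      ultimately show ?thesis by (elim disjE conjE) simp_all
    qed
    then have "0 < \<sigma> i * \<sigma> j * (g j - g i) \<longleftrightarrow>
        0 < \<sigma> i * \<sigma> j * (if (i, j) \<in> {(0, 1), (2, 0), (2, 1)} then 1 else - 1)"
      by (auto simp: zero_less_mult_iff mult_less_0_iff split: if_splits)
    then show ?thesis
      unfolding crossing_sign_def pt_def fst_conv snd_conv x_def[symmetric] vel[OF l(1)] vel[OF
          l(2)] cross_graphs sg_def
      by simp
  qed
  note Oe = outer_crossings_swapped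
  have "triangle_move m \<sigma> a D E outer_crossings ov"
  proof unfold_locales
    show "crossings D = outer_crossings \<union> pt 1 ` ov"
      by (rule inner[OF disjI1[OF refl] replaced_arcs_axioms O(1) refl])
    show "crossings E = outer_crossings \<union> pt (- 1) ` ov"
      by (rule inner[OF disjI2[OF refl] sw.replaced_arcs_axioms O(2) Oe])
    show "crossing_sign D (pt 1 (i, j)) = sg i j" "crossing_sign E (pt (- 1) (i, j)) = sg i j"
      if "(i, j) \<in> ov" for i j
      using sign[OF disjI1[OF refl] replaced_arcs_axioms that]
        sign[OF disjI2[OF refl] sw.replaced_arcs_axioms that] by blast+
    show "outside (fst c) \<and> outside (snd c)" "crossing_sign E c = crossing_sign D c"
      if "c \<in> outer_crossings" for c
      using outer_crossings_outside outer_crossings_sign that by blast+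
  qed (rule lay chord_diagram_crossings[OF D(1)] chord_diagram_crossings[OF D(2)])+
  then show ?thesis by (rule triangle_move.triangle_same_chord_sums)
qed

section \<open>Isotopies\<close>

lemma has_velocity:
  assumes "long_virtual_knot_diagram D"
  shows "(curve D has_vector_derivative velocity D t) (at t)"
proof -
  have "curve D C1_differentiable_on UNIV" using assms by (simp add: long_virtual_knot_diagram_def)
  then obtain f where "(curve D has_vector_derivative f t) (at t)"
    unfolding C1_differentiable_on_def by blast
  then show ?thesis unfolding velocity_def by (simp add: vector_derivative_at)
qed

lemma cross_linear:
  assumes "linear A"
  shows "cross (A v) (A w) = cross (A 1) (A \<i>) * cross v w"
proof -
  have A: "A z = Re z *\<^sub>R A 1 + Im z *\<^sub>R A \<i>" for z
  proof -
    have "z = Re z *\<^sub>R 1 + Im z *\<^sub>R \<i>" by (simp add: complex_eq_iff)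
    then have "A z = A (Re z *\<^sub>R 1 + Im z *\<^sub>R \<i>)" by simp
    also have "\<dots> = Re z *\<^sub>R A 1 + Im z *\<^sub>R A \<i>"
      using assms by (simp add: linear_add linear_scale)
    finally show ?thesis .
  qed
  show ?thesis unfolding A[of v] A[of w] by (simp add: cross_def algebra_simps)
qed

text \<open>
  By the chain rule the two velocities at a crossing are transformed by the derivative of \<open>\<Phi>\<close> at
  the double point, which has positive determinant, and by positive factors, so the sign is
  preserved. The reparametrization preserves the order of the ends of chords.
\<close>

lemma isotopic_same_chord_sums:
  assumes D: "long_virtual_knot_diagram D" "long_virtual_knot_diagram E" and I: "isotopic D E"
  shows "same_chord_sums D E"
proof -
  obtain \<Phi> \<rho> \<rho>' where \<Phi>: "orientation_preserving_diffeo \<Phi>"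
    and \<rho>0: "\<forall>t. (\<rho> has_real_derivative \<rho>' t) (at t) \<and> 0 < \<rho>' t"
    and cE0: "\<forall>t. curve E (\<rho> t) = \<Phi> (curve D t)"
    and XE: "crossings E = map_prod \<rho> \<rho> ` crossings D"
    using I unfolding isotopic_def by (elim exE conjE) (rule that)
  have \<rho>: "(\<rho> has_real_derivative \<rho>' t) (at t)" "0 < \<rho>' t" and cE: "curve E (\<rho> t) = \<Phi> (curve D t)"
      for t
    using \<rho>0 cE0 by blast+
  obtain A where A0: "\<forall>z. (\<Phi> has_derivative A z) (at z)" "\<forall>z. 0 < cross (A z 1) (A z \<i>)"
    using \<Phi> unfolding orientation_preserving_diffeo_def by (elim exE conjE) (rule that)
  have A: "(\<Phi> has_derivative A z) (at z)" "0 < cross (A z 1) (A z \<i>)" for z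
    using A0 by blast+
  have sm: "strict_mono \<rho>"
  proof (rule strict_monoI)
    fix s t :: real assume "s < t"
    then show "\<rho> s < \<rho> t" by (rule DERIV_pos_imp_increasing) (use \<rho> in blast)
  qed
  then have smo: "strict_mono_on X \<rho>" for X by (auto simp: strict_mono_on_def strict_mono_def)
  have vel: "A (curve D t) (velocity D t) = \<rho>' t *\<^sub>R velocity E (\<rho> t)" for t
  proof -
    have "((\<Phi> \<circ> curve D) has_vector_derivative A (curve D t) (velocity D t)) (at t)"
      by (rule vector_derivative_diff_chain_within[OF has_velocity[OF D(1)]
          has_derivative_at_withinI[OF A(1)]])
    moreover have "((curve E \<circ> \<rho>) has_vector_derivative \<rho>' t *\<^sub>R velocity E (\<rho> t)) (at t)"
      using \<rho>(1) has_velocity[OF D(2)] by (intro vector_diff_chain_at) (simp_all add: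
          has_real_derivative_iff_has_vector_derivative)
    moreover have "curve E \<circ> \<rho> = \<Phi> \<circ> curve D" by (simp add: fun_eq_iff cE)
    ultimately show ?thesis using vector_derivative_unique_at by metis
  qed
  have sg: "crossing_sign E (map_prod \<rho> \<rho> c) = crossing_sign D c" if c: "c \<in> crossings D" for c
  proof -
    define B where "B = A (curve D (fst c))"
    have "linear B" unfolding B_def using A(1) has_derivative_linear by blast
    have B: "B (velocity D (fst c)) = \<rho>' (fst c) *\<^sub>R velocity E (\<rho> (fst c))"
      "B (velocity D (snd c)) = \<rho>' (snd c) *\<^sub>R velocity E (\<rho> (snd c))"
      using vel[of "fst c"] vel[of "snd c"] crossing_points(2)[OF D(1) c] by (simp_all add: B_def)
    have "cross (B 1) (B \<i>) * cross (velocity D (fst c)) (velocity D (snd c)) =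
        \<rho>' (fst c) * \<rho>' (snd c) * cross (velocity E (\<rho> (fst c))) (velocity E (\<rho> (snd c)))"
      unfolding cross_linear[OF \<open>linear B\<close>, symmetric] B by (simp add: cross_def algebra_simps)
    moreover have "0 < cross (B 1) (B \<i>)" "0 < \<rho>' (fst c) * \<rho>' (snd c)" using A(2) \<rho>(2) by
        (simp_all add: B_def)
    ultimately have "0 < cross (velocity E (\<rho> (fst c))) (velocity E (\<rho> (snd c))) \<longleftrightarrow>
        0 < cross (velocity D (fst c)) (velocity D (snd c))"
      by (metis zero_less_mult_pos mult_pos_pos)
    then show ?thesis by (simp add: crossing_sign_def)
  qed
  have inj: "inj_on (map_prod \<rho> \<rho>) (crossings D)" by (rule strict_mono_on_inj_prod[OF smo])
  have lp: "loop (map_prod \<rho> \<rho> c) \<delta> (\<rho> t) = loop c \<delta> t" for c \<delta> t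
    by (rule loop_strict_mono[OF smo[of UNIV]]) simp_all
  show ?thesis
  proof (rule same_chord_sums_bij)
    show "bij_betw (map_prod \<rho> \<rho>) (crossings D) (crossings E)" using inj XE by (simp add:
        bij_betw_def)
    show "crossing_type (map_prod \<rho> \<rho> c) = crossing_type c" for c
      using strict_mono_less[OF sm] by (simp add: crossing_type_def)
    show "crossing_sign E (map_prod \<rho> \<rho> c) = crossing_sign D c" if "c \<in> crossings D" for c by
        (rule sg[OF that])
    show "index E (map_prod \<rho> \<rho> c) = index D c" for c
      unfolding index_def XE by (rule pairing_map[OF inj]) (simp_all add: lp sg)
    show "linking E (map_prod \<rho> \<rho> c) (map_prod \<rho> \<rho> d) = linking D c d" for c d
      unfolding linking_def XE by (rule pairing_map[OF inj]) (simp_all add: lp sg)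
  qed
qed

section \<open>Invariance\<close>

lemma reidemeister_step_polynomials:
  assumes "reidemeister_step D E"
  shows "W_diagram a D = W_diagram a E" "F_diagram a b D = F_diagram a b E"
    "G_diagram a b D = G_diagram a b E" "H_diagram a b D = H_diagram a b E"
proof -
  have D: "long_virtual_knot_diagram D" "long_virtual_knot_diagram E"
    and m: "isotopic D E \<or> move_I D E \<or> move_II D E \<or> move_III D E"
    using assms by (auto simp: reidemeister_step_def)
  have "same_chord_sums D E"
    using m isotopic_same_chord_sums[OF D] move_I_same_chord_sums[OF D] move_II_same_chord_sums[OF
        D]
      move_III_same_chord_sums[OF D] by blast
  then show "W_diagram a D = W_diagram a E" "F_diagram a b D = F_diagram a b E"
    "G_diagram a b D = G_diagram a b E" "H_diagram a b D = H_diagram a b E"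
    by (rule same_chord_sums_polynomials[OF chord_diagram_crossings[OF D(1)]
        chord_diagram_crossings[OF D(2)]])+
qed

lemma diagram_equiv_polynomials:
  assumes "(D, E) \<in> diagram_equiv"
  shows "W_diagram a D = W_diagram a E" "F_diagram a b D = F_diagram a b E"
    "G_diagram a b D = G_diagram a b E" "H_diagram a b D = H_diagram a b E"
proof -
  have "equivclp reidemeister_step D E" using assms by (simp add: diagram_equiv_def)
  then have "W_diagram a D = W_diagram a E \<and> F_diagram a b D = F_diagram a b E \<and>
    G_diagram a b D = G_diagram a b E \<and> H_diagram a b D = H_diagram a b E"
  proof (induction rule: equivclp_induct)
    case base then show ?case by simp
  next
    case (step y z) then show ?case using reidemeister_step_polynomials by metis
  qed
  then show "W_diagram a D = W_diagram a E" "F_diagram a b D = F_diagram a b E"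
    "G_diagram a b D = G_diagram a b E" "H_diagram a b D = H_diagram a b E" by auto
qed

lemma the_common_value:
  assumes "D \<in> K" "\<And>E. E \<in> K \<Longrightarrow> f E = x"
  shows "(THE p. \<forall>E\<in>K. f E = p) = x"
  using assms by (intro the_equality) auto

lemma knot_diagram_equiv:
  assumes "K \<in> long_virtual_knots"
  obtains D where "D \<in> K" "long_virtual_knot_diagram D"
    "\<And>E. E \<in> K \<Longrightarrow> (D, E) \<in> diagram_equiv \<and> long_virtual_knot_diagram E"
proof -
  obtain D where D: "long_virtual_knot_diagram D" "K = diagram_equiv `` {D}"
    using assms unfolding long_virtual_knots_def quotient_def by blast
  have "equivclp reidemeister_step D D" by simp
  then have "D \<in> K" using D by (simp add: diagram_equiv_def)
  moreover have "(D, E) \<in> diagram_equiv \<and> long_virtual_knot_diagram E" if "E \<in> K" for E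
    using that D(2) by (auto simp: diagram_equiv_def)
  ultimately show thesis using that D(1) by blast
qed

lemma knot_polynomials:
  assumes "K \<in> long_virtual_knots" "D \<in> K"
  shows "W_poly a K = W_diagram a D" "F_poly a b K = F_diagram a b D"
    "G_poly a b K = G_diagram a b D" "H_poly a b K = H_diagram a b D"
proof -
  obtain D0 where D0: "\<And>E. E \<in> K \<Longrightarrow> (D0, E) \<in> diagram_equiv \<and> long_virtual_knot_diagram E"
    using knot_diagram_equiv[OF assms(1)] by blast
  have e: "(D0, D) \<in> diagram_equiv" using D0[OF assms(2)] by blast
  have same: "W_diagram a E = W_diagram a D" "F_diagram a b E = F_diagram a b D"
    "G_diagram a b E = G_diagram a b D" "H_diagram a b E = H_diagram a b D" if E: "E \<in> K" for E
  proof -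
    have e': "(D0, E) \<in> diagram_equiv" using D0[OF E] by blast
    show "W_diagram a E = W_diagram a D" "F_diagram a b E = F_diagram a b D"
      "G_diagram a b E = G_diagram a b D" "H_diagram a b E = H_diagram a b D"
      by (rule trans[OF diagram_equiv_polynomials(1)[OF e', symmetric]
          diagram_equiv_polynomials(1)[OF e]]
          trans[OF diagram_equiv_polynomials(2)[OF e', symmetric] diagram_equiv_polynomials(2)[OF
              e]]
          trans[OF diagram_equiv_polynomials(3)[OF e', symmetric] diagram_equiv_polynomials(3)[OF
              e]]
          trans[OF diagram_equiv_polynomials(4)[OF e', symmetric] diagram_equiv_polynomials(4)[OF
              e]])+
  qed
  show "W_poly a K = W_diagram a D" "F_poly a b K = F_diagram a b D"
    "G_poly a b K = G_diagram a b D" "H_poly a b K = H_diagram a b D"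
    unfolding W_poly_def F_poly_def G_poly_def H_poly_def
    by (rule the_common_value[OF assms(2)], rule same, assumption)+
qed

section \<open>Concatenation of diagrams\<close>

text \<open>
  Every radius is suitable that exceeds both the parameters and the absolute values on the
  nontrivial part of the curve.
\<close>

lemma standard_outside_exists:
  assumes D: "long_virtual_knot_diagram D"
  shows "\<exists>R. standard_outside R D"
proof -
  obtain R0 where R0: "\<And>t. R0 \<le> \<bar>t\<bar> \<Longrightarrow> curve D t = of_real t"
    using D unfolding long_virtual_knot_diagram_def by blast
  have "continuous_on {- \<bar>R0\<bar>..\<bar>R0\<bar>} (curve D)"
    using has_velocity[OF D] has_vector_derivative_continuous by (intro
        continuous_at_imp_continuous_on) blast
  then have "bounded (curve D ` {- \<bar>R0\<bar>..\<bar>R0\<bar>})"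
    by (intro compact_imp_bounded compact_continuous_image) auto
  then obtain B where B: "\<And>t. t \<in> {- \<bar>R0\<bar>..\<bar>R0\<bar>} \<Longrightarrow> cmod (curve D t) \<le> B"
    unfolding bounded_iff by blast
  define R where "R = \<bar>R0\<bar> + \<bar>B\<bar> + 1"
  have "cmod (curve D t) < R" if "\<bar>t\<bar> < R" for t
  proof (cases "\<bar>t\<bar> \<le> \<bar>R0\<bar>")
    case True
    then have "cmod (curve D t) \<le> B" by (intro B) (auto simp: abs_le_iff)
    then show ?thesis using abs_ge_self[of B] abs_ge_zero[of R0] by (simp add: R_def)
  next
    case False then show ?thesis using R0[of t] that by simp
  qed
  then have "standard_outside R D"
    using R0 by (auto simp: standard_outside_def R_def)
  then show ?thesis ..
qed

text \<open>
  The derivative at the end of the nontrivial part can be computed on the straight side.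
\<close>

lemma velocity_at_ends:
  assumes D: "long_virtual_knot_diagram D" and R: "standard_outside R D"
  shows "velocity D R = 1" "velocity D (- R) = 1"
proof -
  have eq: "velocity D x = 1" if S: "at x within S \<noteq> bot" "x \<in> S" "\<And>t. t \<in> S \<Longrightarrow> curve D t = of_real
      t" for x S
  proof (rule vector_derivative_unique_within[OF S(1)])
    show "(curve D has_vector_derivative velocity D x) (at x within S)"
      by (rule has_vector_derivative_at_within[OF has_velocity[OF D]])
    have "((of_real :: real \<Rightarrow> complex) has_vector_derivative 1) (at x within S)"
      using has_vector_derivative_of_real[OF DERIV_ident[of "at x within S"]] by simp
    then show "(curve D has_vector_derivative 1) (at x within S)"
      by (rule has_vector_derivative_transform[OF S(2), rotated]) (use S(3) in auto)
  qed
  have s: "curve D t = of_real t" if "R \<le> \<bar>t\<bar>" for t using R that by (simp add: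
      standard_outside_def)
  have "0 < R" using R by (simp add: standard_outside_def)
  show "velocity D R = 1"
    by (rule eq[of R "{R..}"]) (use s \<open>0 < R\<close> in \<open>auto simp: at_within_Ici_at_right\<close>)
  show "velocity D (- R) = 1"
    by (rule eq[of "- R" "{..- R}"]) (use s \<open>0 < R\<close> in \<open>auto simp: at_within_Iic_at_left\<close>)
qed

lemma continuous_velocity:
  assumes "long_virtual_knot_diagram D" shows "continuous_on UNIV (velocity D)"
  using assms unfolding long_virtual_knot_diagram_def C1_differentiable_on_eq
      velocity_def[abs_def] by blast

lemma double_point_inside:
  assumes R: "standard_outside R D" and st: "curve D s = curve D t" "s \<noteq> t"
  shows "\<bar>s\<bar> < R"
proof (rule ccontr)
  assume "\<not> \<bar>s\<bar> < R"
  then have s: "curve D s = of_real s" using R by (simp add: standard_outside_def)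
  show False
  proof (cases "\<bar>t\<bar> < R")
    case True
    then have "cmod (curve D t) < R" using R by (simp add: standard_outside_def)
    then show False using s st(1) \<open>\<not> \<bar>s\<bar> < R\<close> by (metis norm_of_real)
  next
    case False
    then have "curve D t = of_real t" using R by (simp add: standard_outside_def)
    then show False using s st by simp
  qed
qed

text \<open>
  The nontrivial part of \<open>D\<close> comes to lie in the left half-plane and is run through at negative
  times, that of \<open>D'\<close> in the right half-plane and at positive times. At time \<open>0\<close> both pieces pass
  the origin with velocity \<open>1\<close>. So there are no double points but those of \<open>D\<close> and \<open>D'\<close>, and the
  chords of the two factors do not interleave.
\<close>

locale concatenation =
  fixes D D' :: lv_diagram and R R' :: real and E :: lv_diagram
  defines E_def: "E \<equiv> concat_diagrams R R' D D'"
  assumes D: "long_virtual_knot_diagram D" and D': "long_virtual_knot_diagram D'"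
    and R: "standard_outside R D" and R': "standard_outside R' D'"
begin

abbreviation "left \<equiv> \<lambda>t :: real. t - R"
abbreviation "right \<equiv> \<lambda>t :: real. t + R'"

lemma R_pos: "0 < R" "0 < R'"
  using R R' by (simp_all add: standard_outside_def)

lemma curve_E: "curve E t = (if t \<le> 0 then curve D (t + R) - of_real R else curve D' (t - R') +
    of_real R')"
  by (simp add: E_def concat_diagrams_def)

lemma crossings_E: "crossings E = map_prod left left ` crossings D \<union> map_prod right right `
    crossings D'"
  by (simp add: E_def concat_diagrams_def map_prod_def)

lemma Re_left: "t < 0 \<Longrightarrow> Re (curve E t) < 0"
proof -
  assume t: "t < 0"
  show ?thesis
  proof (cases "\<bar>t + R\<bar> < R")
    case True
    then have "Re (curve D (t + R)) < R"
      using R complex_Re_le_cmod[of "curve D (t + R)"] by (auto simp: standard_outside_def intro: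
          le_less_trans)
    then show ?thesis using t by (simp add: curve_E)
  next
    case False
    then have "curve D (t + R) = of_real (t + R)" using R by (simp add: standard_outside_def)
    then show ?thesis using t by (simp add: curve_E)
  qed
qed

lemma Re_right: "0 < t \<Longrightarrow> 0 < Re (curve E t)"
proof -
  assume t: "0 < t"
  show ?thesis
  proof (cases "\<bar>t - R'\<bar> < R'")
    case True
    then have "cmod (curve D' (t - R')) < R'" using R' by (simp add: standard_outside_def)
    then have "- R' < Re (curve D' (t - R'))" using abs_Re_le_cmod[of "curve D' (t - R')"] by
        linarith
    then show ?thesis using t by (simp add: curve_E)
  next
    case False
    then have "curve D' (t - R') = of_real (t - R')" using R' by (simp add: standard_outside_def)
    then show ?thesis using t by (simp add: curve_E)
  qed
qed

lemma curve_0: "curve E 0 = 0" "curve D' (- R') + of_real R' = 0"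
  using R R' by (simp_all add: curve_E standard_outside_def)

lemma same_half: "curve E s = curve E t \<Longrightarrow> s \<le> 0 \<longleftrightarrow> t \<le> 0"
  using Re_left[of s] Re_left[of t] Re_right[of s] Re_right[of t] curve_0(1)
  by (cases s "0 :: real" rule: linorder_cases; cases t "0 :: real" rule: linorder_cases) auto

lemma has_velocity_E:
  "(curve E has_vector_derivative (if t \<le> 0 then velocity D (t + R) else velocity D' (t - R')))
      (at t)"
proof -
  define f where "f t = curve D (t + R) - of_real R" for t
  define g where "g t = curve D' (t - R') + of_real R'" for t
  have f: "(f has_vector_derivative velocity D (t + R)) (at t)" for t
  proof -
    have "((curve D \<circ> (\<lambda>t. t + R)) has_vector_derivative 1 *\<^sub>R velocity D (t + R)) (at t)"
      by (rule vector_diff_chain_at) (auto intro!: derivative_eq_intros has_velocity[OF D])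
    then show ?thesis unfolding f_def by (auto intro!: derivative_eq_intros simp: comp_def)
  qed
  have g: "(g has_vector_derivative velocity D' (t - R')) (at t)" for t
  proof -
    have "((curve D' \<circ> (\<lambda>t. t - R')) has_vector_derivative 1 *\<^sub>R velocity D' (t - R')) (at t)"
      by (rule vector_diff_chain_at) (auto intro!: derivative_eq_intros has_velocity[OF D'])
    then show ?thesis unfolding g_def by (auto intro!: derivative_eq_intros simp: comp_def)
  qed
  have "((\<lambda>t. if t \<in> {..0} then f t else g t) has_vector_derivative
      (if t \<in> {..0} then velocity D (t + R) else velocity D' (t - R'))) (at t within UNIV)"
  proof (rule has_vector_derivative_If_within_closures[where T = "{0<..}" and f' = "\<lambda>t. velocity D
      (t + R)"
        and g' = "\<lambda>t. velocity D' (t - R')"])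
    show "(f has_vector_derivative velocity D (t + R)) (at t within A)"
      "(g has_vector_derivative velocity D' (t - R')) (at t within A)" for A
      by (rule has_vector_derivative_at_within[OF f] has_vector_derivative_at_within[OF g])+
    assume "t \<in> closure {..0}" "t \<in> closure {0<..}"
    then have "t = 0" by simp
    then show "f t = g t" "velocity D (t + R) = velocity D' (t - R')"
      using curve_0 velocity_at_ends(1)[OF D R] velocity_at_ends(2)[OF D' R'] by (simp_all add:
          f_def g_def curve_E)
  qed auto
  moreover have "curve E = (\<lambda>t. if t \<in> {..0} then f t else g t)"
    by (simp add: fun_eq_iff curve_E f_def g_def)
  ultimately show ?thesis by (simp only: atMost_iff)
qed

lemma velocity_E: "velocity E t = (if t \<le> 0 then velocity D (t + R) else velocity D' (t - R'))"
  unfolding velocity_def[of E] by (rule vector_derivative_at[OF has_velocity_E])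

lemma left_ends: "c \<in> crossings D \<Longrightarrow> t \<in> {fst c, snd c} \<Longrightarrow> left t < 0"
  using double_point_inside[OF R, of "fst c" "snd c"] double_point_inside[OF R, of "snd c" "fst c"]
    crossing_points(1,2)[OF D, of c] by auto

lemma right_ends: "c \<in> crossings D' \<Longrightarrow> t \<in> {fst c, snd c} \<Longrightarrow> 0 < right t"
  using double_point_inside[OF R', of "fst c" "snd c"] double_point_inside[OF R', of "snd c" "fst
      c"]
    crossing_points(1,2)[OF D', of c] by auto

lemma lvk_parts:
  assumes "long_virtual_knot_diagram X"
  shows "velocity X t \<noteq> 0" "finite {(s, t). s < t \<and> curve X s = curve X t}"
    "s < t \<Longrightarrow> curve X s = curve X t \<Longrightarrow> cross (velocity X s) (velocity X t) \<noteq> 0"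
  using assms unfolding long_virtual_knot_diagram_def by blast+

lemma half_points:
  assumes "curve E s = curve E t"
  shows "s \<le> 0 \<and> t \<le> 0 \<and> curve D (s + R) = curve D (t + R) \<or>
    0 < s \<and> 0 < t \<and> curve D' (s - R') = curve D' (t - R')"
  using same_half[OF assms] assms by (auto simp: curve_E split: if_splits)

lemma concatenation_diagram: "long_virtual_knot_diagram E"
  unfolding long_virtual_knot_diagram_def
proof (intro conjI)
  have "continuous_on ({..0} \<union> {0..}) (\<lambda>t. if t \<le> 0 then velocity D (t + R) else velocity D' (t -
      R'))"
  proof (rule continuous_on_If)
    show "continuous_on {..0} (\<lambda>t. velocity D (t + R))" "continuous_on {0..} (\<lambda>t. velocity D' (t -
        R'))"
      by (auto intro!: continuous_intros continuous_on_compose2[OF continuous_velocity[OF D]]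
          continuous_on_compose2[OF continuous_velocity[OF D']])
  qed (use velocity_at_ends(1)[OF D R] velocity_at_ends(2)[OF D' R'] in auto)
  moreover have "{..0} \<union> {0..} = (UNIV :: real set)" by auto
  ultimately show "curve E C1_differentiable_on UNIV"
    unfolding C1_differentiable_on_def using has_velocity_E
    by (intro exI[of _ "\<lambda>t. if t \<le> 0 then velocity D (t + R) else velocity D' (t - R')"]) simp
  show "\<forall>t. velocity E t \<noteq> 0" using lvk_parts(1)[OF D] lvk_parts(1)[OF D'] by (simp add: velocity_E)
  have "curve E t = of_real t" if "2 * R + 2 * R' \<le> \<bar>t\<bar>" for t
  proof (cases "t \<le> 0")
    case True
    then have "R \<le> \<bar>t + R\<bar>" using that R_pos by linarith
    then show ?thesis using True R by (simp add: curve_E standard_outside_def)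
  next
    case False
    then have "R' \<le> \<bar>t - R'\<bar>" using that R_pos by linarith
    then show ?thesis using False R' by (simp add: curve_E standard_outside_def)
  qed
  then show "\<exists>R. \<forall>t. R \<le> \<bar>t\<bar> \<longrightarrow> curve E t = of_real t" by blast
  let ?S = "\<lambda>X. {(s, t). s < t \<and> curve X s = curve X t}"
  have "?S E \<subseteq> map_prod left left ` ?S D \<union> map_prod right right ` ?S D'"
  proof
    fix x assume "x \<in> ?S E"
    then obtain s t where x: "x = (s, t)" "s < t" "curve E s = curve E t" by auto
    from half_points[OF x(3)] show "x \<in> map_prod left left ` ?S D \<union> map_prod right right ` ?S D'"
    proof (elim disjE conjE)
      assume "curve D (s + R) = curve D (t + R)"
      then show ?thesis using x(1,2) by (intro UnI1 image_eqI[of _ _ "(s + R, t + R)"]) auto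
    next
      assume "curve D' (s - R') = curve D' (t - R')"
      then show ?thesis using x(1,2) by (intro UnI2 image_eqI[of _ _ "(s - R', t - R')"]) auto
    qed
  qed
  then show "finite (?S E)"
    by (rule finite_subset) (intro finite_UnI finite_imageI lvk_parts(2)[OF D] lvk_parts(2)[OF D'])
  show "\<forall>r s t. r < s \<and> s < t \<longrightarrow> \<not> (curve E r = curve E s \<and> curve E s = curve E t)"
  proof (intro allI impI notI)
    fix r s t assume o: "r < s \<and> s < t" and e: "curve E r = curve E s \<and> curve E s = curve E t"
    have "curve E r = curve E t" using e by simp
    from half_points[OF conjunct1[OF e]] half_points[OF this] show False
      using no_triple_point[OF D, of "r + R" "s + R" "t + R"] no_triple_point[OF D', of "r - R'"
          "s - R'" "t - R'"] o
      by auto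
  qed
  show "\<forall>s t. s < t \<and> curve E s = curve E t \<longrightarrow> cross (velocity E s) (velocity E t) \<noteq> 0"
  proof (intro allI impI)
    fix s t assume st: "s < t \<and> curve E s = curve E t"
    from half_points[OF conjunct2[OF st]] show "cross (velocity E s) (velocity E t) \<noteq> 0"
      using lvk_parts(3)[OF D, of "s + R" "t + R"] lvk_parts(3)[OF D', of "s - R'" "t - R'"] st
      by (auto simp: velocity_E)
  qed
  show "\<forall>(s, u)\<in>crossings E. s \<noteq> u \<and> curve E s = curve E u \<and> (u, s) \<notin> crossings E"
  proof
    fix x assume "x \<in> crossings E"
    then consider c where "c \<in> crossings D" "x = map_prod left left c"
      | c where "c \<in> crossings D'" "x = map_prod right right c" unfolding crossings_E by (elim UnE
          imageE) blast+
    then show "case x of (s, u) \<Rightarrow> s \<noteq> u \<and> curve E s = curve E u \<and> (u, s) \<notin> crossings E"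
    proof cases
      case 1
      obtain s u where c: "c = (s, u)" by fastforce
      have n: "s - R < 0" "u - R < 0" using left_ends[OF 1(1)] by (simp_all add: c)
      have "(u - R, s - R) \<notin> crossings E"
      proof
        assume "(u - R, s - R) \<in> crossings E"
        then consider d where "d \<in> crossings D" "(u - R, s - R) = map_prod left left d"
          | d where "d \<in> crossings D'" "(u - R, s - R) = map_prod right right d" unfolding
              crossings_E by (elim UnE imageE) blast+
        then show False
        proof cases
          case 1
          then have "d = (u, s)" by (cases d) auto
          then show False using crossing_points(3)[OF D \<open>c \<in> crossings D\<close>] 1 c by simp
        next
          case 2
          then have "u - R = right (fst d)" by (cases d) auto
          then show False using right_ends[OF 2(1), of "fst d"] n by auto
        qed
      qed
      then show ?thesis using 1(2) crossing_points(1,2)[OF D 1(1)] n by (simp add: c curve_E)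
    next
      case 2
      obtain s u where c: "c = (s, u)" by fastforce
      have n: "0 < s + R'" "0 < u + R'" using right_ends[OF 2(1)] by (simp_all add: c)
      have "(u + R', s + R') \<notin> crossings E"
      proof
        assume "(u + R', s + R') \<in> crossings E"
        then consider d where "d \<in> crossings D" "(u + R', s + R') = map_prod left left d"
          | d where "d \<in> crossings D'" "(u + R', s + R') = map_prod right right d" unfolding
              crossings_E by (elim UnE imageE) blast+
        then show False
        proof cases
          case 1
          then have "u + R' = left (fst d)" by (cases d) auto
          then show False using left_ends[OF 1(1), of "fst d"] n by auto
        next
          case 2
          then have "d = (u, s)" by (cases d) auto
          then show False using crossing_points(3)[OF D' \<open>c \<in> crossings D'\<close>] 2 c by simp
        qed
      qed
      then show ?thesis using 2(2) crossing_points(1,2)[OF D' 2(1)] n by (simp add: c curve_E)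
    qed
  qed
qed

lemma crossing_type_shift: "crossing_type (map_prod left left c) = crossing_type c"
    "crossing_type (map_prod right right c) = crossing_type c"
  by (simp_all add: crossing_type_def)

lemma sign_left: "c \<in> crossings D \<Longrightarrow> crossing_sign E (map_prod left left c) = crossing_sign D c"
  using left_ends[of c "fst c"] left_ends[of c "snd c"] by (simp add: crossing_sign_def velocity_E)

lemma sign_right: "c \<in> crossings D' \<Longrightarrow> crossing_sign E (map_prod right right c) = crossing_sign D' c"
  using right_ends[of c "fst c"] right_ends[of c "snd c"] by (simp add: crossing_sign_def
      velocity_E)

lemma inj_shift: "inj_on (map_prod left left) C" "inj_on (map_prod right right) C'"
  by (auto simp: inj_on_def)

lemma halves_disjoint: "map_prod left left ` crossings D \<inter> map_prod right right ` crossings D' = {}"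
proof (rule ccontr)
  assume "map_prod left left ` crossings D \<inter> map_prod right right ` crossings D' \<noteq> {}"
  then obtain x where x: "x \<in> map_prod left left ` crossings D" "x \<in> map_prod right right `
      crossings D'"
    by (meson disjoint_iff)
  obtain c where c1: "x = map_prod left left c" "c \<in> crossings D" using x(1) by (rule imageE)
  obtain d where d1: "x = map_prod right right d" "d \<in> crossings D'" using x(2) by (rule imageE)
  have "left (fst c) = right (fst d)" using c1(1) d1(1) by (metis fst_map_prod)
  then show False using left_ends[OF c1(2), of "fst c"] right_ends[OF d1(2), of "fst d"] by simp
qed

lemma loop_left_left: "loop (map_prod left left c) \<delta> (left t) = loop c \<delta> t"
  by (rule loop_strict_mono[of UNIV]) (simp_all add: strict_mono_on_def)

lemma loop_right_right: "loop (map_prod right right c) \<delta> (right t) = loop c \<delta> t"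
  by (rule loop_strict_mono[of UNIV]) (simp_all add: strict_mono_on_def)

lemma loop_left_right: "c \<in> crossings D \<Longrightarrow> 0 < t \<Longrightarrow> loop (map_prod left left c) \<delta> t = 0"
  using left_ends[of c "fst c"] left_ends[of c "snd c"] by (cases \<delta>) (auto simp: loop_def)

lemma loop_right_left: "c \<in> crossings D' \<Longrightarrow> t < 0 \<Longrightarrow> loop (map_prod right right c) \<delta> t = 0"
  using right_ends[of c "fst c"] right_ends[of c "snd c"] by (cases \<delta>) (auto simp: loop_def)

text \<open>
  A cycle on the product restricts to cycles \<open>v1\<close> and \<open>v2\<close> on the factors; the loop of a chord of
  one factor restricts to \<open>0\<close> on the other factor.
\<close>

lemma pairing_E:
  assumes "\<And>\<delta> t c. c \<in> crossings D \<Longrightarrow> t \<in> {fst c, snd c} \<Longrightarrow> v \<delta> (left t) = v1 \<delta> t"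
    "\<And>\<delta> t c. c \<in> crossings D \<Longrightarrow> t \<in> {fst c, snd c} \<Longrightarrow> w \<delta> (left t) = w1 \<delta> t"
    "\<And>\<delta> t c. c \<in> crossings D' \<Longrightarrow> t \<in> {fst c, snd c} \<Longrightarrow> v \<delta> (right t) = v2 \<delta> t"
    "\<And>\<delta> t c. c \<in> crossings D' \<Longrightarrow> t \<in> {fst c, snd c} \<Longrightarrow> w \<delta> (right t) = w2 \<delta> t"
  shows "diagram_pairing E v w =
    diagram_pairing D v1 w1 + diagram_pairing D' v2 w2"
proof -
  have fin: "finite (crossings D)" "finite (crossings D')"
    using chord_diagram_crossings[OF D] chord_diagram_crossings[OF D'] by (simp_all add:
        chord_diagram_def)
  have "diagram_pairing E v w =
      pairing (map_prod left left ` crossings D) (crossing_sign E) v w +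
      pairing (map_prod right right ` crossings D') (crossing_sign E) v w"
    unfolding crossings_E using fin by (intro pairing_union halves_disjoint) simp_all
  also have "pairing (map_prod left left ` crossings D) (crossing_sign E) v w = diagram_pairing D
      v1 w1"
    by (rule pairing_map[OF inj_shift(1)]) (rule sign_left assms; assumption)+
  also have "pairing (map_prod right right ` crossings D') (crossing_sign E) v w = diagram_pairing
      D' v2 w2"
    by (rule pairing_map[OF inj_shift(2)]) (rule sign_right assms; assumption)+
  finally show ?thesis .
qed

lemma pairing_zero: "pairing C e (\<lambda>_ _. 0) w = 0" "pairing C e v (\<lambda>_ _. 0) = 0"
  by (simp_all add: pairing_def chord_term_def case_prod_beta)

lemma index_left: "c \<in> crossings D \<Longrightarrow> index E (map_prod left left c) = index D c"
  unfolding index_def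
  by (subst pairing_E[where ?v1.0 = "loop c" and ?w1.0 = whole and ?v2.0 = "\<lambda>_ _. 0" and ?w2.0 =
      whole])
    (simp_all only: loop_left_left loop_left_right right_ends pairing_zero add_0_right)

lemma index_right: "c \<in> crossings D' \<Longrightarrow> index E (map_prod right right c) = index D' c"
  unfolding index_def
  by (subst pairing_E[where ?v1.0 = "\<lambda>_ _. 0" and ?w1.0 = whole and ?v2.0 = "loop c" and ?w2.0 =
      whole])
    (simp_all only: loop_right_right loop_right_left left_ends pairing_zero add_0_left)

lemma linking_left: "c \<in> crossings D \<Longrightarrow> d \<in> crossings D \<Longrightarrow>
    linking E (map_prod left left c) (map_prod left left d) = linking D c d"
  unfolding linking_def
  by (subst pairing_E[where ?v1.0 = "loop c" and ?w1.0 = "loop d" and ?v2.0 = "\<lambda>_ _. 0" and ?w2.0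
      = "\<lambda>_ _. 0"])
    (simp_all only: loop_left_left loop_left_right right_ends pairing_zero add_0_right)

lemma linking_right: "c \<in> crossings D' \<Longrightarrow> d \<in> crossings D' \<Longrightarrow>
    linking E (map_prod right right c) (map_prod right right d) = linking D' c d"
  unfolding linking_def
  by (subst pairing_E[where ?v1.0 = "\<lambda>_ _. 0" and ?w1.0 = "\<lambda>_ _. 0" and ?v2.0 = "loop c" and ?w2.0
      = "loop d"])
    (simp_all only: loop_right_right loop_right_left left_ends pairing_zero add_0_left)

lemma linking_mixed:
  assumes "c \<in> crossings D" "d \<in> crossings D'"
  shows "linking E (map_prod left left c) (map_prod right right d) = 0"
    "linking E (map_prod right right d) (map_prod left left c) = 0"
proof -
  show "linking E (map_prod left left c) (map_prod right right d) = 0"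
    unfolding linking_def
    by (subst pairing_E[where ?v1.0 = "loop c" and ?w1.0 = "\<lambda>_ _. 0" and ?v2.0 = "\<lambda>_ _. 0" and
        ?w2.0 = "loop d"])
      (simp_all only: assms loop_right_right loop_right_left loop_left_left loop_left_right
          left_ends right_ends
        pairing_zero add_0_left)
  show "linking E (map_prod right right d) (map_prod left left c) = 0"
    unfolding linking_def
    by (subst pairing_E[where ?v1.0 = "\<lambda>_ _. 0" and ?w1.0 = "loop c" and ?v2.0 = "loop d" and
        ?w2.0 = "\<lambda>_ _. 0"])
      (simp_all only: assms loop_right_right loop_right_left loop_left_left loop_left_right
          left_ends right_ends
        pairing_zero add_0_left)
qed

lemma chord_pair_sum_concatenation:
  assumes "\<And>m n. \<phi> m n 0 = \<mu> m * \<nu> n"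
  shows "chord_pair_sum a b E \<phi> = chord_pair_sum a b D \<phi> + chord_pair_sum a b D' \<phi>
      + chord_sum a D \<mu> * chord_sum b D' \<nu> + chord_sum a D' \<mu> * chord_sum b D \<nu>"
proof (rule chord_sum_union[OF _ _ crossings_E halves_disjoint inj_shift])
  show "finite (crossings D)" "finite (crossings D')"
    using chord_diagram_crossings[OF D] chord_diagram_crossings[OF D'] by (simp_all add:
        chord_diagram_def)
qed (simp_all only: assms sign_left sign_right index_left index_right linking_left linking_right
    linking_mixed
    crossing_type_shift)

lemma polynomials_concatenation:
  "F_diagram a b E = F_diagram a b D + F_diagram a b D'"
  "G_diagram a b E = G_diagram a b D + G_diagram a b D'"
  "H_diagram a b E = H_diagram a b D + H_diagram a b D'
    + invert_t (W_diagram a D) * W_diagram b D' + invert_t (W_diagram a D') * W_diagram b D"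
proof -
  note C = chord_diagram_crossings[OF concatenation_diagram] chord_diagram_crossings[OF D]
      chord_diagram_crossings[OF D']
  have 0: "chord_sum a X (\<lambda>_. 0) = 0" for a X by (simp add: chord_sum_def)
  show "F_diagram a b E = F_diagram a b D + F_diagram a b D'"
    unfolding F_diagram_chord_pair_sum[OF C(1)] F_diagram_chord_pair_sum[OF C(2)]
        F_diagram_chord_pair_sum[OF C(3)]
    by (subst chord_pair_sum_concatenation[where \<mu> = "\<lambda>_. 0" and \<nu> = "\<lambda>_. 0"]) (simp_all add:
        tpow_0 0)
  show "G_diagram a b E = G_diagram a b D + G_diagram a b D'"
    unfolding G_diagram_chord_pair_sum[OF C(1)] G_diagram_chord_pair_sum[OF C(2)]
        G_diagram_chord_pair_sum[OF C(3)]
    by (subst chord_pair_sum_concatenation[where \<mu> = "\<lambda>_. 0" and \<nu> = "\<lambda>_. 0"]) (simp_all add: 0)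
  have prod: "tpow (0 - m + n) - tpow n - tpow (- m) + 1 = (tpow (- m) - 1) * (tpow n - 1)" for m n
    using tpow_add[of "- m" n] by (simp add: algebra_simps)
  show "H_diagram a b E = H_diagram a b D + H_diagram a b D'
    + invert_t (W_diagram a D) * W_diagram b D' + invert_t (W_diagram a D') * W_diagram b D"
    unfolding H_diagram_chord_pair_sum[OF C(1)] H_diagram_chord_pair_sum[OF C(2)]
        H_diagram_chord_pair_sum[OF C(3)]
      W_diagram_chord_sum[OF C(2)] W_diagram_chord_sum[OF C(3)] invert_t_chord_sum
    by (rule chord_pair_sum_concatenation) (rule prod)
qed

end

theorem theorem6p2:
  fixes K K' :: "lv_diagram set" and a b :: nat
  assumes "K \<in> long_virtual_knots" and "K' \<in> long_virtual_knots"
    and "a \<in> {0, 1}" and "b \<in> {0, 1}"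
  shows "F_poly a b (K \<circ>\<^sub>K K') = F_poly a b K + F_poly a b K' \<and>
    G_poly a b (K \<circ>\<^sub>K K') = G_poly a b K + G_poly a b K' \<and>
    H_poly a b (K \<circ>\<^sub>K K') = H_poly a b K + H_poly a b K'
      + invert_t (W_poly a K) * W_poly b K' + invert_t (W_poly a K') * W_poly b K"
proof -
  have lvk: "long_virtual_knot_diagram D" if "D \<in> X" "X \<in> long_virtual_knots" for D X
    using knot_diagram_equiv[OF that(2)] that(1) by metis
  have poly: "F_diagram a b E = F_poly a b K + F_poly a b K'"
    "G_diagram a b E = G_poly a b K + G_poly a b K'"
    "H_diagram a b E = H_poly a b K + H_poly a b K'
      + invert_t (W_poly a K) * W_poly b K' + invert_t (W_poly a K') * W_poly b K"
    if E: "E \<in> K \<circ>\<^sub>K K'" for E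
  proof -
    obtain D D' R R' where parts: "D \<in> K" "D' \<in> K'" "standard_outside R D" "standard_outside R' D'"
      and eq: "(concat_diagrams R R' D D', E) \<in> diagram_equiv"
      using E unfolding knot_product_def by blast
    interpret concatenation D D' R R' "concat_diagrams R R' D D'"
      by unfold_locales (rule lvk[OF parts(1) assms(1)] lvk[OF parts(2) assms(2)] parts(3,4))+
    note e = diagram_equiv_polynomials[OF eq, symmetric]
    note k = knot_polynomials[OF assms(1) parts(1)] knot_polynomials[OF assms(2) parts(2)]
    show "F_diagram a b E = F_poly a b K + F_poly a b K'"
      "G_diagram a b E = G_poly a b K + G_poly a b K'"
      "H_diagram a b E = H_poly a b K + H_poly a b K'
        + invert_t (W_poly a K) * W_poly b K' + invert_t (W_poly a K') * W_poly b K"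
      unfolding e k by (rule polynomials_concatenation)+
  qed
  \<comment> \<open>the common values on the product exist only because the product has a diagram\<close>
  obtain D where mD: "D \<in> K" using knot_diagram_equiv[OF assms(1)] by blast
  obtain D' where mD': "D' \<in> K'" using knot_diagram_equiv[OF assms(2)] by blast
  have l: "long_virtual_knot_diagram D" "long_virtual_knot_diagram D'" using lvk mD mD' assms by
      blast+
  obtain R where oR: "standard_outside R D" using standard_outside_exists[OF l(1)] ..
  obtain R' where oR': "standard_outside R' D'" using standard_outside_exists[OF l(2)] ..
  interpret concatenation D D' R R' "concat_diagrams R R' D D'"
    by unfold_locales (rule l oR oR')+
  have "(concat_diagrams R R' D D', concat_diagrams R R' D D') \<in> diagram_equiv"
    using concatenation_diagram by (simp add: diagram_equiv_def)
  then have mem: "concat_diagrams R R' D D' \<in> K \<circ>\<^sub>K K'"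
    using mD mD' oR oR' unfolding knot_product_def by blast
  show ?thesis
    unfolding F_poly_def[of a b "K \<circ>\<^sub>K K'"] G_poly_def[of a b "K \<circ>\<^sub>K K'"] H_poly_def[of a b "K \<circ>\<^sub>K K'"]
    by (intro conjI the_common_value[OF mem] poly)
qed

end
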